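(* Let $0<p<1$, let $n\ge1$, $d\ge2$ be integers, $s=\lceil2^7e\log(d/\log d)\rceil$, $m=s-1$, and suppose $s\le\sqrt{(n/2)\log2}$. Let $x_1,\dots,x_n\in\mathbb R^d$ be independent observations with $\mathbb E[x_j]=\theta\in\mathbb R^d$, whose noise $\varepsilon_{j,a}=x_{j,a}-\theta_a$ satisfies, for some $\sigma_n>0$, $\mathbb E[\varepsilon_{j,a}\varepsilon_{j,b}]=0$ for $1\le j\le n$, $1\le a<b\le d$, and $\mathbb E[|n^{-1}\sum_{j=1}^n\varepsilon_j'\varepsilon_{j,a}|^{2k}]\le\sigma_n^{2k}2^{k-1}k!$ for $1\le a\le d$, $1\le k\le s$, where $(\varepsilon_j')$ is a Rademacher sequence independent of the noise. Let $f(\theta)=\|\theta\|_p^p/d=\frac1d\sum_{a=1}^d|\theta_a|^p$, $f_0(x)=|x|^p$, $h=\sigma_n/\sqrt{\log(d/\log d)}$, and $f_h(x)=\int h^{-1}K((x-t)/h)f_0(t)\,dt$, where $K(x)=(2\pi)^{-1/2}\int e^{i\zeta x}Q(\zeta)\,d\zeta$ is the inverse Fourier transform of a twice continuously differentiable function $Q$ satisfying, for a constant $C_1$, $$Q(0)=\frac1{\sqrt{2\pi}},\quad\mathrm{supp}(Q)=[-1,1],\quad\|Q\|_{L_1}\le\frac{C_1}{\sqrt{2/\pi}},\quad\max_{k=0,2}\|Q^{(k)}\|_{L_2}\le\frac{C_1}{\sqrt{2\pi}}.$$ Let $\widehat f$ be the estimator defined in the context. Then $$\mathbb E\big[|\widehat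 f-f(\theta)|^2\big]\le\big(1+\sqrt{2/\log d}+s^{-1/4}\big)^2\,C_1^2\left(\frac{\sigma_n^2}{\log(d/\log d)}\right)^p.$$
   Context: Estimator: $$\widehat f=\frac1d\sum_{a=1}^d\Big\{f_h(\bar x_a)+\sum_{k=2}^m\frac{f_h^{(k)}(\bar x_a)\,\bar u_a^{(k)}}{k!}\Big\},$$ where $\bar x_a=n^{-1}\sum_{j=1}^nx_{j,a}$ and $\bar u_a^{(k)}=\frac{(n-k)!}{n!}\sum_{1\le j_1\neq\cdots\neq j_k\le n}\prod_{\ell=1}^k(x_{j_\ell,a}-\bar x_a)$ (indices pairwise distinct). A Rademacher sequence is an i.i.d. sequence of uniform $\pm1$ signs. *)

theory Defs
  imports "HOL-Probability.Probability"
begin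

text \<open>The k-th derivative of a function of a real variable with complex values.\<close>

definition nth_vderiv :: "nat \<Rightarrow> (real \<Rightarrow> complex) \<Rightarrow> real \<Rightarrow> complex" where
  "nth_vderiv k g = ((\<lambda>g x. vector_derivative g (at x)) ^^ k) g"

definition twice_cont_diff :: "(real \<Rightarrow> complex) \<Rightarrow> bool" where
  "twice_cont_diff g \<longleftrightarrow>
     (\<forall>k<2. \<forall>x. nth_vderiv k g differentiable (at x)) \<and> continuous_on UNIV (nth_vderiv 2 g)"

definition L1_norm :: "(real \<Rightarrow> complex) \<Rightarrow> real" where
  "L1_norm g = (\<integral>x. norm (g x) \<partial>lborel)"

definition L2_norm :: "(real \<Rightarrow> complex) \<Rightarrow> real" where
  "L2_norm g = sqrt (\<integral>x. (norm (g x))\<^sup>2 \<partial>lborel)"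

text \<open>The unitary convention for the inverse Fourier transform. Since the function
  is complex-valued and not assumed to be Hermitian-symmetric, the resulting kernel is
  complex-valued in general; the real-valued case is included.\<close>

definition inv_fourier :: "(real \<Rightarrow> complex) \<Rightarrow> real \<Rightarrow> complex" where
  "inv_fourier Q x =
     complex_of_real (1 / sqrt (2 * pi)) * (\<integral>\<zeta>. exp (\<i> * complex_of_real (\<zeta> * x)) * Q \<zeta> \<partial>lborel)"

definition kernel_smooth :: "(real \<Rightarrow> complex) \<Rightarrow> real \<Rightarrow> (real \<Rightarrow> real) \<Rightarrow> real \<Rightarrow> complex" where
  "kernel_smooth K h f\<^sub>0 x =
     (\<integral>t. complex_of_real (1 / h) * K ((x - t) / h) * complex_of_real (f\<^sub>0 t) \<partial>lborel)"

text \<open>Below, the observations are indexed by \<open>{1..n}\<close> and \<open>X j $ a\<close> is coordinate \<open>a\<close> of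
  the \<open>j\<close>-th observation; the dimension is \<open>CARD('d)\<close>.\<close>

definition sample_mean :: "nat \<Rightarrow> (nat \<Rightarrow> real^'d) \<Rightarrow> 'd \<Rightarrow> real" where
  "sample_mean n X a = (\<Sum>j=1..n. X j $ a) / real n"

text \<open>The lists \<open>js\<close> are the tuples of pairwise distinct indices.\<close>

definition u_stat :: "nat \<Rightarrow> (nat \<Rightarrow> real^'d) \<Rightarrow> nat \<Rightarrow> 'd \<Rightarrow> real" where
  "u_stat n X k a = fact (n - k) / fact n *
     (\<Sum>js | length js = k \<and> distinct js \<and> set js \<subseteq> {1..n}.
        \<Prod>l<k. (X (js ! l) $ a - sample_mean n X a))"

definition f_hat :: "(real \<Rightarrow> complex) \<Rightarrow> nat \<Rightarrow> nat \<Rightarrow> (nat \<Rightarrow> real^'d) \<Rightarrow> complex" where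
  "f_hat fh n m X =
     (\<Sum>a\<in>UNIV. fh (sample_mean n X a) +
        (\<Sum>k=2..m. nth_vderiv k fh (sample_mean n X a) * complex_of_real (u_stat n X k a) / fact k))
     / of_nat CARD('d)"

definition lp_functional :: "real \<Rightarrow> real^'d \<Rightarrow> real" where
  "lp_functional p \<theta> = (\<Sum>a\<in>UNIV. \<bar>\<theta> $ a\<bar> powr p) / real CARD('d)"

definition rademacher :: "'w measure \<Rightarrow> nat set \<Rightarrow> (nat \<Rightarrow> 'w \<Rightarrow> real) \<Rightarrow> bool" where
  "rademacher M I r \<longleftrightarrow> prob_space.indep_vars M (\<lambda>_. borel) r I \<and>
     (\<forall>j\<in>I. measure M {\<omega> \<in> space M. r j \<omega> = 1} = 1 / 2 \<and>
            measure M {\<omega> \<in> space M. r j \<omega> = - 1} = 1 / 2)"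

text \<open>The library's \<open>indep_var\<close> requires both variables to have the same value type; this is
  its heterogeneous form, after \<open>prob_space.indep_var_eq\<close>.\<close>

definition indep_rvs ::
  "'w measure \<Rightarrow> 'b measure \<Rightarrow> ('w \<Rightarrow> 'b) \<Rightarrow> 'c measure \<Rightarrow> ('w \<Rightarrow> 'c) \<Rightarrow> bool" where
  "indep_rvs M S X T Y \<longleftrightarrow> X \<in> measurable M S \<and> Y \<in> measurable M T \<and>
     prob_space.indep_set M
       (sigma_sets (space M) {X -` A \<inter> space M | A. A \<in> sets S})
       (sigma_sets (space M) {Y -` A \<inter> space M | A. A \<in> sets T})"

end

theory Submission
  imports Defs "HOL-Real_Asymp.Real_Asymp" "HOL-Combinatorics.Multiset_Permutations"
begin

text \<open>
  Put \<open>T\<^sub>a(t) = \<Sum>\<^sub>k\<^sub>\<le>\<^sub>m f\<^sub>h\<^sup>(\<^sup>k\<^sup>)(\<theta>\<^sub>a + t) U\<^sub>k(t) / k!\<close>, where \<open>U\<^sub>k(t)\<close> is the U-statistic of order \<open>k\<close> of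
  the noise in coordinate \<open>a\<close>, recentred at \<open>t\<close>. The estimator is the average over \<open>a\<close> of the values of
  \<open>T\<^sub>a\<close> at the noise mean. Its error splits into the bias \<open>f\<^sub>h - f\<^sub>0\<close> at \<open>\<theta>\<close>, the degenerate part
  \<open>T\<^sub>a(0) - f\<^sub>h(\<theta>\<^sub>a)\<close>, and the remainder \<open>T\<^sub>a\<close>(noise mean) \<open>- T\<^sub>a(0)\<close>.

  The degenerate U-statistics of different coordinates and orders are orthogonal, which gains a factor
  \<open>1/d\<close> against \<open>exp (\<sigma>\<^sup>2/h\<^sup>2) = d / log d\<close>. As \<open>U\<^sub>k' = - k U\<^sub>k\<^sub>-\<^sub>1\<close>, the derivative of \<open>T\<^sub>a\<close> telescopes to a
  single term of order \<open>s = m + 1\<close>, and the remainder is controlled by mixed moments of U-statistics and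
  powers of the mean. Expanding these into monomials, every monomial in which an index occurs once has mean
  zero, and the others are dominated by the corresponding terms in the moment of the Rademacher sum.

  The bounds \<open>|f\<^sub>h\<^sup>(\<^sup>k\<^sup>)| \<le> C\<^sub>1 h\<^sup>p\<^sup>-\<^sup>k\<close> for \<open>k \<ge> 2\<close> come from the Fourier representation
  \<open>c |x|\<^sup>p = \<integral> (1 - e\<^sup>i\<^sup>\<xi>\<^sup>x) |\<xi>|\<^sup>-\<^sup>1\<^sup>-\<^sup>p d\<xi>\<close> with \<open>c \<ge> \<pi>\<close>; for \<open>k = 1\<close>, a factor 3/2 is lost by interpolation,
  which the variance bound can afford. The bias needs only Plancherel's inequality for \<open>Q\<close> and \<open>Q''\<close>.
\<close>

section \<open>Fourier integrals\<close>

text \<open>The leading constant has to be exactly \<open>C\<^sub>1\<close>, so the bias may lose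
  nothing and every loss must fit into the two lower-order terms. The degenerate part affords a
  factor 2: it pays 3/2 for replacing falling factorials by powers of \<open>n\<close>, and (3/2)^2
  for the first derivative. The remainder is harder: the coordinates are merely uncorrelated, so
  averaging over them gains nothing, and it must be small for each coordinate alone. Its second
  moment collects 4^m from binomial sums, 9^s from symmetrization and 2^m from the moment
  hypothesis; up to a polynomial factor this is (72 L)^s / s! with L = log(d / log d), which is
  geometrically small once s is at least 128 e L. The obstacle in the symmetrization is that the
  noise need not be symmetric: monomials with odd exponents at least 3 survive in its moments but
  have mean zero under ordinary random signs. They are therefore compared with moments of a skewed
  sign, itself a sum of three ordinary signs, at the price 3^(2s).\<close>

definition fourier_int :: "(real \<Rightarrow> complex) \<Rightarrow> real \<Rightarrow> complex" where
  "fourier_int g u = (\<integral>z. iexp (z * u) * g z \<partial>lborel)"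

lemma norm_iexp [simp]: "norm (iexp t) = 1"
  by (simp add: norm_exp_eq_Re)

lemma borel_measurable_cnj [measurable]: "cnj \<in> borel_measurable borel"
  by (intro borel_measurable_continuous_onI continuous_intros)

lemma borel_measurable_fourier_int [measurable]:
  assumes [measurable]: "g \<in> borel_measurable borel"
  shows "fourier_int g \<in> borel_measurable borel"
  unfolding fourier_int_def by measurable

lemma integrable_iexp_mult:
  assumes "integrable lborel g"
  shows "integrable lborel (\<lambda>z. iexp (z * u) * g z)"
proof (rule Bochner_Integration.integrable_bound[OF assms])
  have [measurable]: "g \<in> borel_measurable borel" using assms by auto
  show "(\<lambda>z. iexp (z * u) * g z) \<in> borel_measurable lborel" by measurable
qed (simp add: norm_mult)

lemma norm_fourier_int_le:
  assumes "integrable lborel g"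
  shows "norm (fourier_int g u) \<le> (\<integral>z. norm (g z) \<partial>lborel)"
proof -
  have "norm (fourier_int g u) \<le> (\<integral>z. norm (iexp (z * u) * g z) \<partial>lborel)"
    unfolding fourier_int_def by (rule integral_norm_bound)
  then show ?thesis by (simp add: norm_mult)
qed

text \<open>Fubini, with the product of \<open>g\<close> and \<open>k\<close> as integrable
  majorant. Moving the transform from one factor to the other drives both the Plancherel inequality
  and the inversion formula.\<close>

lemma fourier_int_multiplication:
  assumes g: "integrable lborel g" and k: "integrable lborel k"
  shows "(\<integral>u. fourier_int g u * k u \<partial>lborel) = (\<integral>z. g z * fourier_int k z \<partial>lborel)"
proof -
  have [measurable]: "g \<in> borel_measurable borel" "k \<in> borel_measurable borel" using g k by auto
  have int: "integrable (lborel \<Otimes>\<^sub>M lborel)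
    (\<lambda>(u, z). iexp (z * u) * g z * k u)"
  proof (rule Bochner_Integration.integrable_bound)
    show "integrable (lborel \<Otimes>\<^sub>M lborel) (\<lambda>(u, z). k u * g z)"
    proof (rule lborel_pair.Fubini_integrable)
      have "integrable lborel (\<lambda>u. norm (k u) * (\<integral>z. norm (g z) \<partial>lborel))" using k by simp
      then show "integrable lborel (\<lambda>x. \<integral>y. norm (case (x, y) of (u, z) \<Rightarrow> k u * g z) \<partial>lborel)"
        by (simp add: norm_mult)
      show "AE x in lborel. integrable lborel (\<lambda>y. case (x, y) of (u, z) \<Rightarrow> k u * g z)"
        using g by simp
    qed measurable
  qed (auto simp: norm_mult)
  have "(\<integral>u. fourier_int g u * k u \<partial>lborel)
      = (\<integral>u. \<integral>z. iexp (z * u) * g z * k u \<partial>lborel \<partial>lborel)"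
    unfolding fourier_int_def by simp
  also have "\<dots> = (\<integral>z. \<integral>u. iexp (z * u) * g z * k u \<partial>lborel \<partial>lborel)"
    using lborel_pair.Fubini_integral[OF int] by simp
  also have "\<dots> = (\<integral>z. \<integral>u. g z * (iexp (u * z) * k u) \<partial>lborel \<partial>lborel)"
    by (simp add: ac_simps)
  finally show ?thesis unfolding fourier_int_def by simp
qed

text \<open>The transform of \<open>exp (- (e * u)\<^sup>2 / 2)\<close>: 2 pi times the density of a
  centred normal variable with standard deviation \<open>e\<close>. The factor 2 pi stays because
  \<open>fourier_int\<close> carries no normalization.\<close>

definition gauss_kernel :: "real \<Rightarrow> real \<Rightarrow> real" where
  "gauss_kernel e t = sqrt (2 * pi) / e * exp (- (t / e)\<^sup>2 / 2)"

lemma borel_measurable_gauss_kernel [measurable]: "gauss_kernel e \<in> borel_measurable borel"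
  unfolding gauss_kernel_def by measurable

lemma gauss_kernel_nonneg: "e > 0 \<Longrightarrow> gauss_kernel e t \<ge> 0"
  unfolding gauss_kernel_def by simp

lemma integrable_gaussian:
  assumes "e > 0"
  shows "integrable lborel (\<lambda>u::real. exp (- (e * u)\<^sup>2 / 2))"
proof -
  have "integrable lborel (\<lambda>x. sqrt (2 * pi) * std_normal_density x)" by simp
  then have "integrable lborel (\<lambda>x::real. exp (- x\<^sup>2 / 2))"
    by (simp add: std_normal_density_def)
  from lborel_integrable_real_affine[OF this, of e 0] assms show ?thesis by simp
qed

lemma fourier_int_gaussian:
  assumes "e > 0"
  shows "fourier_int (\<lambda>u. complex_of_real (exp (- (e * u)\<^sup>2 / 2))) t = complex_of_real (gauss_kernel e t)"
proof -
  have st: "(\<integral>x. iexp (x * t) * complex_of_real (exp (- x\<^sup>2 / 2)) \<partial>lborel)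
      = complex_of_real (sqrt (2 * pi) * exp (- t\<^sup>2 / 2))" for t
  proof -
    have "complex_of_real (exp (- (t^2) / 2)) = char std_normal_distribution t"
      by (simp add: char_std_normal_distribution)
    also have "\<dots> = (\<integral>x. std_normal_density x *\<^sub>R iexp (t * x) \<partial>lborel)"
      unfolding char_def by (subst integral_density) (auto simp: AE_I2)
    also have "\<dots> = (\<integral>x. complex_of_real (1 / sqrt (2 * pi)) *
        (iexp (x * t) * complex_of_real (exp (- x\<^sup>2 / 2))) \<partial>lborel)"
      by (intro Bochner_Integration.integral_cong)
        (auto simp: std_normal_density_def scaleR_conv_of_real ac_simps)
    also have "\<dots> = complex_of_real (1 / sqrt (2 * pi)) *
        (\<integral>x. iexp (x * t) * complex_of_real (exp (- x\<^sup>2 / 2)) \<partial>lborel)"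
      by (rule integral_mult_right_zero)
    finally show ?thesis by (simp add: field_simps)
  qed
  have "complex_of_real (sqrt (2 * pi) * exp (- (t / e)\<^sup>2 / 2))
     = e *\<^sub>R (\<integral>u. iexp (u * t) * complex_of_real (exp (- (e * u)\<^sup>2 / 2)) \<partial>lborel)"
    unfolding st[symmetric]
    by (subst lborel_integral_real_affine[of e _ 0])
       (use assms in \<open>auto simp del: of_real_exp\<close>)
  then show ?thesis using assms
    unfolding fourier_int_def gauss_kernel_def by (simp add: scaleR_conv_of_real field_simps)
qed

lemma nn_integral_gauss_kernel:
  assumes "e > 0"
  shows "(\<integral>\<^sup>+t. ennreal (gauss_kernel e (c + t)) \<partial>lborel) = ennreal (2 * pi)"
proof -
  have "(\<integral>\<^sup>+v. ennreal (std_normal_density v) \<partial>lborel) = 1"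
    using prob_space.emeasure_space_1[OF prob_space_normal_density[of 1 0]]
    by (simp add: emeasure_density)
  then have 1: "(\<integral>\<^sup>+v. ennreal (2 * pi) * ennreal (std_normal_density v) \<partial>lborel) = ennreal (2 * pi)"
    by (simp add: nn_integral_cmult)
  have "(\<integral>\<^sup>+v. ennreal (2 * pi) * ennreal (std_normal_density v) \<partial>lborel)
     = ennreal (1 / e) * (\<integral>\<^sup>+t. ennreal (2 * pi) * ennreal (std_normal_density (c / e + 1 / e * t)) \<partial>lborel)"
    using assms by (subst nn_integral_real_affine[of _ "1 / e" "c / e"]) auto
  also have "\<dots> = (\<integral>\<^sup>+t. ennreal (1 / e) * (ennreal (2 * pi) * ennreal (std_normal_density (c / e + 1 / e * t))) \<partial>lborel)"
    by (simp add: nn_integral_cmult)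
  also have "\<dots> = (\<integral>\<^sup>+t. ennreal (gauss_kernel e (c + t)) \<partial>lborel)"
  proof (intro nn_integral_cong)
    fix t
    have "1 / e * (2 * pi * std_normal_density (c / e + 1 / e * t)) = gauss_kernel e (c + t)"
    proof -
      define r where "r = sqrt (2 * pi)"
      have r: "r > 0" "2 * pi = r * r" unfolding r_def by simp_all
      have a: "c / e + 1 / e * t = (c + t) / e" by (simp add: add_divide_distrib)
      show ?thesis unfolding std_normal_density_def gauss_kernel_def a r_def[symmetric] r(2)
        using r(1) by simp
    qed
    then show "ennreal (1 / e) * (ennreal (2 * pi) * ennreal (std_normal_density (c / e + 1 / e * t)))
       = ennreal (gauss_kernel e (c + t))"
      using assms by (simp flip: ennreal_mult)
  qed
  finally show ?thesis using 1 by simp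
qed

lemma integrable_mult_bounded:
  fixes f g :: "real \<Rightarrow> complex"
  assumes "integrable lborel g" "f \<in> borel_measurable borel" "\<And>u. norm (f u) \<le> B"
  shows "integrable lborel (\<lambda>u. f u * g u)"
proof (rule Bochner_Integration.integrable_bound)
  show "integrable lborel (\<lambda>u. of_real B * g u)" using assms by simp
  have "B \<ge> 0" using assms(3)[of 0] norm_ge_zero order_trans by blast
  then show "AE x in lborel. norm (f x * g x) \<le> norm (of_real B * g x)"
    using assms(3) by (auto simp: norm_mult mult_right_mono)
  show "(\<lambda>u. f u * g u) \<in> borel_measurable lborel" using assms by auto
qed

lemma fourier_int_modulate:
  "fourier_int (\<lambda>u. iexp (u * t) * k u) z = fourier_int k (z + t)"
  unfolding fourier_int_def
  by (intro Bochner_Integration.integral_cong) (auto simp: exp_add[symmetric] algebra_simps)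

lemma cnj_fourier_int:
  "cnj (fourier_int g u) = fourier_int (\<lambda>z. cnj (g (- z))) u"
proof -
  have "cnj (fourier_int g u) = (\<integral>z. cnj (iexp (z * u) * g z) \<partial>lborel)"
    unfolding fourier_int_def by (simp only: integral_cnj Bochner_Integration.integral_cnj)
  also have "\<dots> = (\<integral>z. cnj (iexp (- z * u) * g (- z)) \<partial>lborel)"
    by (subst lborel_integral_real_affine[of "-1" _ 0]) auto
  finally show ?thesis unfolding fourier_int_def
    by (simp add: exp_cnj)
qed

text \<open>The Gaussian weight makes Fubini applicable; it is removed by Fatou's lemma afterwards.\<close>

lemma plancherel_gauss_le:
  fixes g :: "real \<Rightarrow> complex"
  assumes g: "integrable lborel g" and g2: "integrable lborel (\<lambda>z. (norm (g z))\<^sup>2)" and e: "e > 0"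
  shows "(\<integral>\<^sup>+u. ennreal ((norm (fourier_int g u))\<^sup>2 * exp (- (e * u)\<^sup>2 / 2)) \<partial>lborel)
     \<le> ennreal (2 * pi * (\<integral>z. (norm (g z))\<^sup>2 \<partial>lborel))"
proof -
  define w where "w u = complex_of_real (exp (- (e * u)\<^sup>2 / 2))" for u
  \<comment> \<open>The conjugate of a transform is the transform of the reflected conjugate, so the
    squared modulus becomes a product of two transforms.\<close>
  define g' where "g' z = cnj (g (- z))" for z
  have [measurable]: "g \<in> borel_measurable borel" using g by auto
  have w: "integrable lborel w" unfolding w_def
    using integrable_gaussian[OF e] by (simp del: of_real_exp)
  have [measurable]: "w \<in> borel_measurable borel" using w by auto
  have g': "integrable lborel g'"
    unfolding g'_def using lborel_integrable_real_affine[OF g, of "-1" 0] by simp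
  have [measurable]: "g' \<in> borel_measurable borel" using g' by auto
  define k where "k u = cnj (fourier_int g u) * w u" for u
  have k: "integrable lborel k" unfolding k_def
    by (rule integrable_mult_bounded[OF w]) (use norm_fourier_int_le[OF g] in auto)
  \<comment> \<open>The transform of \<open>k\<close> is \<open>g'\<close> smoothed by the Gaussian.
    The argument is \<open>z + y\<close> instead of a difference because of the reflection in
    \<open>g'\<close>.\<close>
  have Fk: "fourier_int k z = (\<integral>y. g' y * complex_of_real (gauss_kernel e (z + y)) \<partial>lborel)" for z
  proof -
    have "fourier_int k z = (\<integral>u. fourier_int g' u * (iexp (u * z) * w u) \<partial>lborel)"
      unfolding k_def cnj_fourier_int g'_def[symmetric]
      by (simp add: fourier_int_def ac_simps)
    also have "\<dots> = (\<integral>y. g' y * fourier_int (\<lambda>u. iexp (u * z) * w u) y \<partial>lborel)"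
      by (intro fourier_int_multiplication g' integrable_iexp_mult w)
    also have "\<dots> = (\<integral>y. g' y * fourier_int w (z + y) \<partial>lborel)"
      by (simp only: fourier_int_modulate add.commute)
    finally show ?thesis unfolding w_def fourier_int_gaussian[OF e] .
  qed
  define X where "X = (\<integral>u. fourier_int g u * k u \<partial>lborel)"
  have eq: "fourier_int g u * k u = complex_of_real ((norm (fourier_int g u))\<^sup>2 * exp (- (e * u)\<^sup>2 / 2))" for u
    unfolding k_def w_def of_real_mult complex_norm_square by (simp only: mult.assoc)
  have "integrable lborel (\<lambda>u. fourier_int g u * k u)"
    by (rule integrable_mult_bounded[OF k]) (use norm_fourier_int_le[OF g] in auto)
  then have intR: "integrable lborel (\<lambda>u. (norm (fourier_int g u))\<^sup>2 * exp (- (e * u)\<^sup>2 / 2))"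
    unfolding eq by (simp only: complex_of_real_integrable_eq)
  have XR: "X = complex_of_real (\<integral>u. (norm (fourier_int g u))\<^sup>2 * exp (- (e * u)\<^sup>2 / 2) \<partial>lborel)"
    unfolding X_def eq by (rule integral_complex_of_real)
  let ?I = "\<integral>z. (norm (g z))\<^sup>2 \<partial>lborel"
  have X: "X = (\<integral>z. g z * fourier_int k z \<partial>lborel)"
    unfolding X_def by (rule fourier_int_multiplication[OF g k])
  have G0: "0 \<le> gauss_kernel e t" for t using gauss_kernel_nonneg[OF e] .
  have nng': "ennreal (norm (\<integral>x. f x \<partial>lborel)) \<le> (\<integral>\<^sup>+x. ennreal (norm (f x)) \<partial>lborel)" for f :: "real \<Rightarrow> complex"
    by (cases "integrable lborel f") (auto intro: integral_norm_bound_ennreal simp: not_integrable_integral_eq)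
  have I0: "(\<integral>\<^sup>+z. ennreal ((norm (g z))\<^sup>2) \<partial>lborel) = ennreal ?I"
    using g2 by (simp add: nn_integral_eq_integral)
  have I0': "(\<integral>\<^sup>+z. ennreal ((norm (g' z))\<^sup>2) \<partial>lborel) = ennreal ?I"
    unfolding I0[symmetric] g'_def
    by (subst nn_integral_real_affine[of "\<lambda>z. ennreal ((norm (g z))\<^sup>2)" "-1" 0]) auto
  have "ennreal (norm X) \<le> (\<integral>\<^sup>+z. ennreal (norm (g z * fourier_int k z)) \<partial>lborel)"
    unfolding X by (rule nng')
  also have "\<dots> \<le> (\<integral>\<^sup>+z. \<integral>\<^sup>+y. ennreal (norm (g z)) * ennreal (norm (g' y) * gauss_kernel e (z + y)) \<partial>lborel \<partial>lborel)"
  proof (rule nn_integral_mono)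
    fix z
    have "ennreal (norm (g z * fourier_int k z)) = ennreal (norm (g z)) * ennreal (norm (fourier_int k z))"
      by (simp add: norm_mult ennreal_mult)
    also have "\<dots> \<le> ennreal (norm (g z)) * (\<integral>\<^sup>+y. ennreal (norm (g' y * complex_of_real (gauss_kernel e (z + y)))) \<partial>lborel)"
      unfolding Fk by (intro mult_left_mono nng') auto
    also have "\<dots> = (\<integral>\<^sup>+y. ennreal (norm (g z)) * ennreal (norm (g' y) * gauss_kernel e (z + y)) \<partial>lborel)"
      by (subst nn_integral_cmult[symmetric]) (auto simp: norm_mult G0)
    finally show "ennreal (norm (g z * fourier_int k z))
      \<le> (\<integral>\<^sup>+y. ennreal (norm (g z)) * ennreal (norm (g' y) * gauss_kernel e (z + y)) \<partial>lborel)" .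
  qed
  also have "\<dots> \<le> (\<integral>\<^sup>+z. \<integral>\<^sup>+y. (ennreal ((norm (g z))\<^sup>2 / 2) * ennreal (gauss_kernel e (z + y))
        + ennreal ((norm (g' y))\<^sup>2 / 2) * ennreal (gauss_kernel e (z + y))) \<partial>lborel \<partial>lborel)"
  proof (intro nn_integral_mono)
    fix z y
    \<comment> \<open>AM-GM decouples \<open>g z\<close> from \<open>g' y\<close>. In each half the
      Gaussian integrates to 2 pi over the free variable, so each half contributes pi times the
      squared norm.\<close>
    have "norm (g z) * norm (g' y) \<le> (norm (g z))\<^sup>2 / 2 + (norm (g' y))\<^sup>2 / 2"
      using sum_squares_bound[of "norm (g z)" "norm (g' y)"] by simp
    from mult_right_mono[OF this G0[of "z + y"]]
    show "ennreal (norm (g z)) * ennreal (norm (g' y) * gauss_kernel e (z + y))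
     \<le> ennreal ((norm (g z))\<^sup>2 / 2) * ennreal (gauss_kernel e (z + y))
        + ennreal ((norm (g' y))\<^sup>2 / 2) * ennreal (gauss_kernel e (z + y))"
      using G0[of "z + y"] by (simp flip: ennreal_mult ennreal_plus add: algebra_simps ennreal_le_iff2)
  qed
  also have "\<dots> = (\<integral>\<^sup>+z. \<integral>\<^sup>+y. ennreal ((norm (g z))\<^sup>2 / 2) * ennreal (gauss_kernel e (z + y)) \<partial>lborel \<partial>lborel)
     + (\<integral>\<^sup>+z. \<integral>\<^sup>+y. ennreal ((norm (g' y))\<^sup>2 / 2) * ennreal (gauss_kernel e (z + y)) \<partial>lborel \<partial>lborel)"
    by (subst nn_integral_add[symmetric]) (auto intro!: nn_integral_cong nn_integral_add)
  also have "(\<integral>\<^sup>+z. \<integral>\<^sup>+y. ennreal ((norm (g' y))\<^sup>2 / 2) * ennreal (gauss_kernel e (z + y)) \<partial>lborel \<partial>lborel)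
     = (\<integral>\<^sup>+y. \<integral>\<^sup>+z. ennreal ((norm (g' y))\<^sup>2 / 2) * ennreal (gauss_kernel e (y + z)) \<partial>lborel \<partial>lborel)"
    by (subst lborel_pair.Fubini') (auto simp: add.commute)
  also have "(\<integral>\<^sup>+z. \<integral>\<^sup>+y. ennreal ((norm (g z))\<^sup>2 / 2) * ennreal (gauss_kernel e (z + y)) \<partial>lborel \<partial>lborel)
    = (\<integral>\<^sup>+z. ennreal ((norm (g z))\<^sup>2) * ennreal pi \<partial>lborel)"
    by (subst nn_integral_cmult) (auto simp: nn_integral_gauss_kernel[OF e] simp flip: ennreal_mult)
  also have "(\<integral>\<^sup>+y. \<integral>\<^sup>+z. ennreal ((norm (g' y))\<^sup>2 / 2) * ennreal (gauss_kernel e (y + z)) \<partial>lborel \<partial>lborel)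
     = (\<integral>\<^sup>+z. ennreal ((norm (g' z))\<^sup>2) * ennreal pi \<partial>lborel)"
    by (subst nn_integral_cmult) (auto simp: nn_integral_gauss_kernel[OF e] simp flip: ennreal_mult)
  also have "(\<integral>\<^sup>+z. ennreal ((norm (g z))\<^sup>2) * ennreal pi \<partial>lborel) + (\<integral>\<^sup>+z. ennreal ((norm (g' z))\<^sup>2) * ennreal pi \<partial>lborel)
     = ennreal (2 * pi * ?I)"
  proof -
    have "?I \<ge> 0" by simp
    then show ?thesis
      by (subst (1 2) nn_integral_multc)
         (auto simp: I0 I0' algebra_simps simp flip: ennreal_mult ennreal_plus)
  qed
  finally have "ennreal (norm X) \<le> ennreal (2 * pi * ?I)" .
  moreover have "norm X = (\<integral>u. (norm (fourier_int g u))\<^sup>2 * exp (- (e * u)\<^sup>2 / 2) \<partial>lborel)"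
    unfolding XR by (simp add: norm_of_real integral_nonneg_AE)
  ultimately show ?thesis
    using intR by (subst nn_integral_eq_integral) auto
qed

lemma plancherel_le:
  fixes g :: "real \<Rightarrow> complex"
  assumes g: "integrable lborel g" and g2: "integrable lborel (\<lambda>z. (norm (g z))\<^sup>2)"
  shows "(\<integral>\<^sup>+u. ennreal ((norm (fourier_int g u))\<^sup>2) \<partial>lborel)
     \<le> ennreal (2 * pi * (\<integral>z. (norm (g z))\<^sup>2 \<partial>lborel))"
proof -
  have [measurable]: "g \<in> borel_measurable borel" using g by auto
  define f where "f j u = ennreal ((norm (fourier_int g u))\<^sup>2 * exp (- (1 / real (Suc j) * u)\<^sup>2 / 2))" for j u
  have lim: "(\<lambda>j. f j u) \<longlonglongrightarrow> ennreal ((norm (fourier_int g u))\<^sup>2)" for u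
  proof -
    have e: "(\<lambda>j. 1 / real (Suc j)) \<longlonglongrightarrow> 0" by (intro LIMSEQ_Suc lim_1_over_n)
    have "(\<lambda>j. (norm (fourier_int g u))\<^sup>2 * exp (- (1 / real (Suc j) * u)\<^sup>2 / 2))
        \<longlonglongrightarrow> (norm (fourier_int g u))\<^sup>2 * exp (- (0 * u)\<^sup>2 / 2)"
      by (intro tendsto_intros e) auto
    then show ?thesis unfolding f_def by (intro tendsto_ennrealI) simp
  qed
  have "(\<integral>\<^sup>+u. ennreal ((norm (fourier_int g u))\<^sup>2) \<partial>lborel) = (\<integral>\<^sup>+u. liminf (\<lambda>j. f j u) \<partial>lborel)"
    using lim_imp_Liminf[OF trivial_limit_sequentially lim] by simp
  also have "\<dots> \<le> liminf (\<lambda>j. \<integral>\<^sup>+u. f j u \<partial>lborel)"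
    by (rule nn_integral_liminf) (auto simp: f_def)
  also have "\<dots> \<le> ennreal (2 * pi * (\<integral>z. (norm (g z))\<^sup>2 \<partial>lborel))"
  proof (intro Liminf_le always_eventually allI)
    show "(\<integral>\<^sup>+u. f j u \<partial>lborel) \<le> ennreal (2 * pi * (\<integral>z. (norm (g z))\<^sup>2 \<partial>lborel))" for j
      unfolding f_def by (rule plancherel_gauss_le[OF g g2]) simp
  qed simp
  finally show ?thesis .
qed

text \<open>A Gaussian-weighted integral is evaluated in two ways. On the transform side dominated
  convergence removes the weight; on the other side the weight has become an approximate identity of
  mass 2 pi concentrating at the continuity point \<open>t\<close>.\<close>

lemma fourier_int_inversion:
  fixes g :: "real \<Rightarrow> complex"
  assumes g: "integrable lborel g" and Fg: "integrable lborel (fourier_int g)"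
    and cont: "isCont g t" and bnd: "\<And>z. norm (g z) \<le> B"
  shows "(\<integral>u. fourier_int g u * iexp (u * (- t)) \<partial>lborel) = 2 * pi * g t"
proof -
  have [measurable]: "g \<in> borel_measurable borel" using g by auto
  define e where "e j = 1 / real (Suc j)" for j
  have e: "e j > 0" for j by (simp add: e_def)
  have elim: "e \<longlonglongrightarrow> 0" unfolding e_def by (intro LIMSEQ_Suc lim_1_over_n)
  define w where "w j u = complex_of_real (exp (- (e j * u)\<^sup>2 / 2))" for j u
  have w: "integrable lborel (w j)" for j unfolding w_def
    using integrable_gaussian[OF e] by (simp del: of_real_exp)
  have [measurable]: "w j \<in> borel_measurable borel" for j using w by auto
  have wle: "norm (w j u) \<le> 1" for j u unfolding w_def by (simp del: of_real_exp)
  let ?L = "\<lambda>j. \<integral>u. fourier_int g u * (iexp (u * (- t)) * w j u) \<partial>lborel"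
  have L1: "?L \<longlonglongrightarrow> (\<integral>u. fourier_int g u * iexp (u * (- t)) \<partial>lborel)"
  proof (rule integral_dominated_convergence[where w="\<lambda>u. norm (fourier_int g u)"])
    show "integrable lborel (\<lambda>u. norm (fourier_int g u))" using Fg by simp
    show "AE u in lborel. (\<lambda>j. fourier_int g u * (iexp (u * (- t)) * w j u))
       \<longlonglongrightarrow> fourier_int g u * iexp (u * (- t))"
    proof (rule AE_I2)
      fix u
      have "(\<lambda>j. w j u) \<longlonglongrightarrow> complex_of_real (exp (- (0 * u)\<^sup>2 / 2))"
        unfolding w_def by (intro tendsto_intros elim) auto
      then have "(\<lambda>j. w j u) \<longlonglongrightarrow> 1" by simp
      then have "(\<lambda>j. fourier_int g u * (iexp (u * (- t)) * w j u))
       \<longlonglongrightarrow> fourier_int g u * (iexp (u * (- t)) * 1)"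
        by (intro tendsto_intros)
      then show "(\<lambda>j. fourier_int g u * (iexp (u * (- t)) * w j u))
       \<longlonglongrightarrow> fourier_int g u * iexp (u * (- t))" by simp
    qed
    show "AE u in lborel. norm (fourier_int g u * (iexp (u * (- t)) * w j u)) \<le> norm (fourier_int g u)" for j
      using wle by (auto simp: norm_mult mult_left_le simp del: of_real_mult mult_minus_right of_real_minus)
  qed auto
  have "?L j = (\<integral>v. g (t + e j * v) * complex_of_real (sqrt (2 * pi) * exp (- v\<^sup>2 / 2)) \<partial>lborel)" for j
  proof -
    have "?L j = (\<integral>z. g z * fourier_int (\<lambda>u. iexp (u * (- t)) * w j u) z \<partial>lborel)"
      by (intro fourier_int_multiplication g integrable_iexp_mult w)
    also have "\<dots> = (\<integral>z. g z * complex_of_real (gauss_kernel (e j) (z - t)) \<partial>lborel)"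
      unfolding fourier_int_modulate w_def fourier_int_gaussian[OF e] by simp
    \<comment> \<open>The substitution \<open>z = t + e j * v\<close> freezes the Gaussian, so that
      only the argument of \<open>g\<close> depends on \<open>j\<close>; the bound on
      \<open>g\<close> then gives a majorant.\<close>
    also have "\<dots> = e j *\<^sub>R (\<integral>v. g (t + e j * v) * complex_of_real (gauss_kernel (e j) (e j * v)) \<partial>lborel)"
      using e[of j] by (subst lborel_integral_real_affine[of "e j" _ t]) auto
    also have "\<dots> = (\<integral>v. e j *\<^sub>R (g (t + e j * v) * complex_of_real (gauss_kernel (e j) (e j * v))) \<partial>lborel)"
      by simp
    also have "\<dots> = (\<integral>v. g (t + e j * v) * complex_of_real (sqrt (2 * pi) * exp (- v\<^sup>2 / 2)) \<partial>lborel)"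
      using e[of j] unfolding gauss_kernel_def
      by (intro Bochner_Integration.integral_cong) (auto simp: scaleR_conv_of_real)
    finally show ?thesis .
  qed
  then have Leq: "?L = (\<lambda>j. \<integral>v. g (t + e j * v) * complex_of_real (sqrt (2 * pi) * exp (- v\<^sup>2 / 2)) \<partial>lborel)"
    by blast
  have ig: "integrable lborel (\<lambda>v::real. sqrt (2 * pi) * exp (- v\<^sup>2 / 2))"
    using integrable_gaussian[of 1] by simp
  have L2: "(\<lambda>j. \<integral>v. g (t + e j * v) * complex_of_real (sqrt (2 * pi) * exp (- v\<^sup>2 / 2)) \<partial>lborel)
     \<longlonglongrightarrow> (\<integral>v. g t * complex_of_real (sqrt (2 * pi) * exp (- v\<^sup>2 / 2)) \<partial>lborel)"
  proof (rule integral_dominated_convergence[where w="\<lambda>v. B * (sqrt (2 * pi) * exp (- v\<^sup>2 / 2))"])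
    show "integrable lborel (\<lambda>v. B * (sqrt (2 * pi) * exp (- v\<^sup>2 / 2)))" using ig by simp
    show "AE v in lborel. (\<lambda>j. g (t + e j * v) * complex_of_real (sqrt (2 * pi) * exp (- v\<^sup>2 / 2)))
        \<longlonglongrightarrow> g t * complex_of_real (sqrt (2 * pi) * exp (- v\<^sup>2 / 2))"
    proof (rule AE_I2)
      fix v
      have "(\<lambda>j. t + e j * v) \<longlonglongrightarrow> t + 0 * v" by (intro tendsto_intros elim)
      then have "(\<lambda>j. g (t + e j * v)) \<longlonglongrightarrow> g t"
        using cont by (intro isCont_tendsto_compose[OF cont]) simp
      then show "(\<lambda>j. g (t + e j * v) * complex_of_real (sqrt (2 * pi) * exp (- v\<^sup>2 / 2)))
        \<longlonglongrightarrow> g t * complex_of_real (sqrt (2 * pi) * exp (- v\<^sup>2 / 2))"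
        by (intro tendsto_intros)
    qed
    show "AE v in lborel. norm (g (t + e j * v) * complex_of_real (sqrt (2 * pi) * exp (- v\<^sup>2 / 2)))
        \<le> B * (sqrt (2 * pi) * exp (- v\<^sup>2 / 2))" for j
    proof (rule AE_I2)
      fix v
      have "norm (complex_of_real (sqrt (2 * pi) * exp (- v\<^sup>2 / 2))) = sqrt (2 * pi) * exp (- v\<^sup>2 / 2)"
        unfolding norm_of_real by simp
      then show "norm (g (t + e j * v) * complex_of_real (sqrt (2 * pi) * exp (- v\<^sup>2 / 2)))
        \<le> B * (sqrt (2 * pi) * exp (- v\<^sup>2 / 2))"
        unfolding norm_mult by (metis bnd mult_right_mono norm_ge_zero)
    qed
  qed (auto simp del: of_real_mult of_real_exp)
  have "(\<integral>v. sqrt (2 * pi) * exp (- v\<^sup>2 / 2) \<partial>lborel) = (\<integral>v. 2 * pi * std_normal_density v \<partial>lborel)"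
  proof (intro Bochner_Integration.integral_cong)
    fix v :: real
    have "2 * pi / sqrt (2 * pi) = sqrt (2 * pi)" by (simp add: real_div_sqrt)
    then show "sqrt (2 * pi) * exp (- v\<^sup>2 / 2) = 2 * pi * std_normal_density v"
      unfolding std_normal_density_def by (metis (no_types) mult.assoc times_divide_eq_right mult.right_neutral)
  qed simp
  also have "\<dots> = 2 * pi" by simp
  finally have "(\<integral>v. g t * complex_of_real (sqrt (2 * pi) * exp (- v\<^sup>2 / 2)) \<partial>lborel) = g t * complex_of_real (2 * pi)"
    by (simp only: integral_mult_right_zero integral_complex_of_real)
  with L2 have "?L \<longlonglongrightarrow> g t * complex_of_real (2 * pi)" unfolding Leq by (simp only:)
  from LIMSEQ_unique[OF L1 this] show ?thesis by simp
qed

section \<open>Weighted integrals of the kernel\<close>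

text \<open>Convexity of \<open>exp\<close> between 0 and \<open>ln x\<close>, that is, the tangent
  at 1 of a concave power. It serves both for the weight of the kernel and for the bound on the
  Gamma integral.\<close>

lemma powr_le_affine:
  fixes x p :: real
  assumes "x \<ge> 0" "0 \<le> p" "p \<le> 1"
  shows "x powr p \<le> (1 - p) + p * x"
proof (cases "x = 0")
  case False
  with assms have x: "x > 0" by simp
  have "convex_on UNIV (exp :: real \<Rightarrow> real)"
    by (rule exp_convex)
  then have "exp ((1 - p) *\<^sub>R 0 + p *\<^sub>R ln x) \<le> (1 - p) * exp 0 + p * exp (ln x)"
    using assms by (intro convex_onD) auto
  then show ?thesis using x by (simp add: powr_def)
qed (use assms in auto)

lemma vector_derivative_zero_outside:
  fixes f :: "real \<Rightarrow> complex"
  assumes "\<And>x. \<bar>x\<bar> > 1 \<Longrightarrow> f x = 0" "\<bar>x\<bar> > 1"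
  shows "vector_derivative f (at x) = 0"
proof (rule vector_derivative_at)
  have "open {x::real. \<bar>x\<bar> > 1}" by (intro open_Collect_less continuous_intros)
  then show "(f has_vector_derivative 0) (at x)"
    using assms by (intro has_vector_derivative_transform_within_open[OF has_vector_derivative_const[of 0]]) auto
qed

lemma continuous_bounded_support:
  fixes g :: "real \<Rightarrow> complex"
  assumes "continuous_on UNIV g" "\<And>x. \<bar>x\<bar> > 1 \<Longrightarrow> g x = 0"
  shows "integrable lborel g" "integrable lborel (\<lambda>z. (norm (g z))\<^sup>2)" "\<exists>B. \<forall>x. norm (g x) \<le> B"
proof -
  have out: "g x = 0" if "x \<notin> {-1..1}" for x
    using that by (intro assms(2)) auto
  have c: "continuous_on {-1..1} g" "continuous_on {-1..1} (\<lambda>z. (norm (g z))\<^sup>2)"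
    using assms(1) by (auto intro!: continuous_intros intro: continuous_on_subset)
  have "integrable lborel (\<lambda>x. indicator {-1..1} x *\<^sub>R g x)"
    by (intro borel_integrable_compact c) simp
  also have "(\<lambda>x. indicator {-1..1} x *\<^sub>R g x) = g"
    using out by (auto simp: fun_eq_iff indicator_def)
  finally show "integrable lborel g" .
  have "integrable lborel (\<lambda>x. indicator {-1..1} x *\<^sub>R (norm (g x))\<^sup>2)"
    by (intro borel_integrable_compact c) simp
  also have "(\<lambda>x. indicator {-1..1} x *\<^sub>R (norm (g x))\<^sup>2) = (\<lambda>z. (norm (g z))\<^sup>2)"
    using out by (auto simp: fun_eq_iff indicator_def)
  finally show "integrable lborel (\<lambda>z. (norm (g z))\<^sup>2)" .
  have "bounded (g ` {-1..1})"
    by (intro compact_imp_bounded compact_continuous_image c) simp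
  then obtain B where B: "B > 0" "\<And>x. x \<in> {-1..1} \<Longrightarrow> norm (g x) \<le> B"
    unfolding bounded_pos by auto
  have "norm (g x) \<le> B" for x
    using B(1) B(2)[of x] out[of x] by (cases "x \<in> {-1..1}") auto
  then show "\<exists>B. \<forall>x. norm (g x) \<le> B" by blast
qed

lemma twice_cont_diffD:
  assumes "twice_cont_diff Q"
  shows "(Q has_vector_derivative nth_vderiv 1 Q x) (at x)"
    "(nth_vderiv 1 Q has_vector_derivative nth_vderiv 2 Q x) (at x)"
    "continuous_on UNIV Q" "continuous_on UNIV (nth_vderiv 1 Q)" "continuous_on UNIV (nth_vderiv 2 Q)"
proof -
  have d: "\<And>k x. k < 2 \<Longrightarrow> nth_vderiv k Q differentiable (at x)"
    and c: "continuous_on UNIV (nth_vderiv 2 Q)"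
    using assms unfolding twice_cont_diff_def by auto
  have 0: "nth_vderiv 0 Q = Q" by (simp add: nth_vderiv_def)
  have 1: "nth_vderiv 1 Q x = vector_derivative Q (at x)" for x by (simp add: nth_vderiv_def)
  have 2: "nth_vderiv 2 Q x = vector_derivative (nth_vderiv 1 Q) (at x)" for x
    by (simp add: nth_vderiv_def numeral_2_eq_2)
  show d1: "(Q has_vector_derivative nth_vderiv 1 Q x) (at x)" for x
    using d[of 0 x] unfolding 0 1 by (simp add: vector_derivative_works)
  show d2: "(nth_vderiv 1 Q has_vector_derivative nth_vderiv 2 Q x) (at x)" for x
    using d[of 1 x] unfolding 2 by (simp add: vector_derivative_works)
  show "continuous_on UNIV (nth_vderiv 2 Q)" by (rule c)
  show "continuous_on UNIV Q" "continuous_on UNIV (nth_vderiv 1 Q)"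
    using d1 d2 by (auto intro!: continuous_at_imp_continuous_on has_vector_derivative_continuous)
qed

lemma support_closureD:
  assumes "closure {z. Q z \<noteq> 0} = {-1..1::real}" "\<bar>x\<bar> > 1"
  shows "Q x = 0"
  using assms closure_subset[of "{z. Q z \<noteq> 0}"] by (auto simp: abs_if split: if_splits)

text \<open>Both integrations by parts are done at once: \<open>H\<close> is an antiderivative of
  the sum \<open>f\<close> of the two integrands, and it vanishes outside the support.\<close>

lemma fourier_int_second_deriv:
  assumes Q: "twice_cont_diff Q" and supp: "\<And>x. \<bar>x\<bar> > 1 \<Longrightarrow> Q x = 0"
  shows "fourier_int (nth_vderiv 2 Q) u = - complex_of_real (u\<^sup>2) * fourier_int Q u"
proof -
  let ?Q1 = "nth_vderiv 1 Q" and ?Q2 = "nth_vderiv 2 Q"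
  note D = twice_cont_diffD[OF Q]
  have s1: "?Q1 x = 0" if "\<bar>x\<bar> > 1" for x
    using vector_derivative_zero_outside[OF supp that] by (simp add: nth_vderiv_def)
  have s2: "?Q2 x = 0" if "\<bar>x\<bar> > 1" for x
    using vector_derivative_zero_outside[OF s1 that] by (simp add: nth_vderiv_def numeral_2_eq_2)
  define E where "E z = iexp (z * u)" for z
  have dE: "(E has_vector_derivative (\<i> * u * E z)) (at z)" for z
  proof -
    have "((\<lambda>w. exp (\<i> * (w * of_real u))) has_field_derivative (\<i> * u * exp (\<i> * (of_real z * of_real u)))) (at (of_real z))"
      by (auto intro!: derivative_eq_intros)
    from has_vector_derivative_real_field[OF this] show ?thesis unfolding E_def by simp
  qed
  define H where "H z = E z * (?Q1 z - \<i> * u * Q z)" for z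
  define f where "f z = E z * (of_real (u\<^sup>2) * Q z) + E z * ?Q2 z" for z
  have dH: "(H has_vector_derivative f z) (at z)" for z
    unfolding H_def f_def
    by (rule derivative_eq_intros dE D refl)+ (simp add: algebra_simps power2_eq_square)
  have cE: "continuous_on UNIV E" unfolding E_def by (intro continuous_intros)
  have "continuous_on UNIV f"
    unfolding f_def by (intro continuous_on_add continuous_on_mult continuous_on_const cE D)
  then have cf: "continuous_on {-2..2} f" by (rule continuous_on_subset) simp
  have out: "f x = 0" if "x \<notin> {-2..2}" for x
  proof -
    have "\<bar>x\<bar> > 1" using that by (simp add: abs_if) linarith
    then show ?thesis unfolding f_def by (simp add: supp s2)
  qed
  \<comment> \<open>The interval reaches beyond [-1, 1] because \<open>Q\<close> and its derivatives
    are known to vanish only strictly outside [-1, 1]; at 2 and -2 the boundary terms are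
    zero.\<close>
  have "(\<integral>x. indicator {-2..2} x *\<^sub>R f x \<partial>lborel) = H 2 - H (- 2)"
    by (rule integral_FTC_atLeastAtMost[OF _ has_vector_derivative_at_within[OF dH] cf]) simp
  also have "\<dots> = 0" unfolding H_def using supp[of 2] supp[of "-2"] s1[of 2] s1[of "-2"] by simp
  also have "(\<lambda>x. indicator {-2..2} x *\<^sub>R f x) = f"
    using out by (auto simp: fun_eq_iff indicator_def)
  finally have f0: "(\<integral>x. f x \<partial>lborel) = 0" .
  have i1: "integrable lborel (\<lambda>z. E z * (of_real (u\<^sup>2) * Q z))" "integrable lborel (\<lambda>z. E z * ?Q2 z)"
  proof -
    have "integrable lborel Q" "integrable lborel ?Q2"
      using continuous_bounded_support(1)[OF D(3) supp] continuous_bounded_support(1)[OF D(5) s2] by simp_all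
    then have "integrable lborel (\<lambda>z. of_real (u\<^sup>2) * Q z)" "integrable lborel ?Q2" by simp_all
    from this[THEN integrable_iexp_mult, of u]
    show "integrable lborel (\<lambda>z. E z * (of_real (u\<^sup>2) * Q z))" "integrable lborel (\<lambda>z. E z * ?Q2 z)"
      unfolding E_def by simp_all
  qed
  have "(\<integral>x. f x \<partial>lborel) = (\<integral>z. of_real (u\<^sup>2) * (E z * Q z) \<partial>lborel) + fourier_int ?Q2 u"
    unfolding f_def fourier_int_def E_def[symmetric]
    by (subst Bochner_Integration.integral_add[OF i1]) (simp add: ac_simps)
  also have "(\<integral>z. of_real (u\<^sup>2) * (E z * Q z) \<partial>lborel) = of_real (u\<^sup>2) * fourier_int Q u"
    unfolding fourier_int_def E_def[symmetric] by (rule integral_mult_right_zero)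
  finally show ?thesis using f0 by (simp add: eq_neg_iff_add_eq_0 add.commute)
qed

lemma nn_integral_FTC_UNIV:
  fixes f F :: "real \<Rightarrow> real"
  assumes "\<And>u. DERIV F u :> f u" "\<And>u. isCont f u" "\<And>u. f u \<ge> 0"
    "(F \<longlongrightarrow> A) at_bot" "(F \<longlongrightarrow> B) at_top"
  shows "(\<integral>\<^sup>+u. ennreal (f u) \<partial>lborel) = ennreal (B - A)"
proof -
  have "set_integrable lborel (einterval (-\<infinity>) \<infinity>) f"
    by (rule interval_integral_FTC_nonneg(1)[of "-\<infinity>" "\<infinity>" F f A B])
      (use assms in \<open>auto simp: ereal_tendsto_simps1\<close>)
  moreover have "(LBINT x=-\<infinity>..\<infinity>. f x) = B - A"
    by (rule interval_integral_FTC_nonneg(2)[of "-\<infinity>" "\<infinity>" F f A B])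
      (use assms in \<open>auto simp: ereal_tendsto_simps1\<close>)
  ultimately have "integrable lborel f" "(\<integral>x. f x \<partial>lborel) = B - A"
    by (simp_all add: set_integrable_def interval_lebesgue_integral_def set_lebesgue_integral_def einterval_eq)
  then show ?thesis by (simp add: nn_integral_eq_integral assms(3))
qed

text \<open>The dependence on \<open>q\<close> sits in the summand
  \<open>(1 - 2 * q) * (u / (1 + u\<^sup>2))\<close> of the antiderivative, which vanishes at both
  ends. This is why an interpolated weight costs no more than a constant one.\<close>

lemma nn_integral_weight:
  assumes "0 \<le> q" "q \<le> 1"
  shows "(\<integral>\<^sup>+u. ennreal (((1 - q) + q * u\<^sup>2) * 2 / (1 + u\<^sup>2)\<^sup>2) \<partial>lborel) = ennreal pi"
proof -
  define f where "f u = ((1 - q) + q * u\<^sup>2) * 2 / (1 + u\<^sup>2)\<^sup>2" for u :: real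
  define F where "F u = arctan u + (1 - 2 * q) * (u / (1 + u\<^sup>2))" for u :: real
  have p: "1 + u\<^sup>2 \<noteq> 0" "1 + u\<^sup>2 > 0" for u :: real
    using zero_le_power2[of u] by linarith+
  have dF: "DERIV F u :> f u" for u
  proof -
    have "1 / (1 + u\<^sup>2) + (1 - 2 * q) * ((1 * (1 + u\<^sup>2) - u * (2 * u)) / (1 + u\<^sup>2)\<^sup>2) = f u"
    proof -
      have "1 / (1 + u\<^sup>2) = (1 + u\<^sup>2) / (1 + u\<^sup>2)\<^sup>2" using p[of u] by (simp add: power2_eq_square)
      then have "1 / (1 + u\<^sup>2) + (1 - 2 * q) * ((1 * (1 + u\<^sup>2) - u * (2 * u)) / (1 + u\<^sup>2)\<^sup>2)
         = ((1 + u\<^sup>2) + (1 - 2 * q) * (1 * (1 + u\<^sup>2) - u * (2 * u))) / (1 + u\<^sup>2)\<^sup>2"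
        by (simp add: add_divide_distrib)
      also have "(1 + u\<^sup>2) + (1 - 2 * q) * (1 * (1 + u\<^sup>2) - u * (2 * u)) = ((1 - q) + q * u\<^sup>2) * 2"
        by (simp add: algebra_simps power2_eq_square)
      finally show ?thesis unfolding f_def .
    qed
    moreover have "DERIV F u :> 1 / (1 + u\<^sup>2) + (1 - 2 * q) * ((1 * (1 + u\<^sup>2) - u * (2 * u)) / (1 + u\<^sup>2)\<^sup>2)"
      unfolding F_def by (rule derivative_eq_intros refl p | simp add: p power2_eq_square field_simps)+
    ultimately show ?thesis by simp
  qed
  have f0: "f u \<ge> 0" for u unfolding f_def using assms by simp
  have cf: "isCont f u" for u unfolding f_def using p[of u] by (intro continuous_intros) simp_all
  have r: "((\<lambda>u::real. u / (1 + u\<^sup>2)) \<longlongrightarrow> 0) at_top" "((\<lambda>u::real. u / (1 + u\<^sup>2)) \<longlongrightarrow> 0) at_bot"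
    by real_asymp+
  have l1: "(F \<longlongrightarrow> pi / 2 + (1 - 2 * q) * 0) at_top"
    unfolding F_def by (intro tendsto_intros r tendsto_arctan_at_top)
  have l2: "(F \<longlongrightarrow> - (pi / 2) + (1 - 2 * q) * 0) at_bot"
    unfolding F_def by (intro tendsto_intros r tendsto_arctan_at_bot)
  have "(\<integral>\<^sup>+u. ennreal (f u) \<partial>lborel) = ennreal ((pi / 2 + (1 - 2 * q) * 0) - (- (pi / 2) + (1 - 2 * q) * 0))"
    by (rule nn_integral_FTC_UNIV[OF dF cf f0 l2 l1])
  then show ?thesis unfolding f_def by simp
qed

text \<open>AM-GM against the weight \<open>1 + u\<^sup>4\<close>, whose integral against \<open>|K|\<^sup>2\<close> is bounded by Plancherel. The constant is
  exactly \<open>C\<close> because \<open>1 / (1 + u\<^sup>4) \<le> 2 / (1 + u\<^sup>2)\<^sup>2\<close>, where the right-hand side has integral \<open>\<pi>\<close>.\<close>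

lemma kernel_weighted_L1:
  fixes Q :: "real \<Rightarrow> complex" and v :: "real \<Rightarrow> real"
  assumes Q: "twice_cont_diff Q" and supp: "\<And>x. \<bar>x\<bar> > 1 \<Longrightarrow> Q x = 0"
    and L2: "L2_norm Q \<le> C / sqrt (2 * pi)" "L2_norm (nth_vderiv 2 Q) \<le> C / sqrt (2 * pi)"
    and C: "C > 0" and q: "0 \<le> q" "q \<le> 1"
    and v: "\<And>u. v u \<ge> 0" "\<And>u. (v u)\<^sup>2 \<le> (1 - q) + q * u\<^sup>2"
    and [measurable]: "v \<in> borel_measurable borel"
  shows "integrable lborel (\<lambda>u. of_real (v u) * inv_fourier Q u)"
    "(\<integral>u. v u * norm (inv_fourier Q u) \<partial>lborel) \<le> C"
proof -
  let ?K = "inv_fourier Q" and ?Q2 = "nth_vderiv 2 Q"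
  note D = twice_cont_diffD[OF Q]
  have s1: "nth_vderiv 1 Q x = 0" if "\<bar>x\<bar> > 1" for x
    using vector_derivative_zero_outside[OF supp that] by (simp add: nth_vderiv_def)
  have s2: "?Q2 x = 0" if "\<bar>x\<bar> > 1" for x
    using vector_derivative_zero_outside[OF s1 that] by (simp add: nth_vderiv_def numeral_2_eq_2)
  note B = continuous_bounded_support[OF D(3) supp] and B2 = continuous_bounded_support[OF D(5) s2]
  have Kf: "?K u = complex_of_real (1 / sqrt (2 * pi)) * fourier_int Q u" for u
    unfolding inv_fourier_def fourier_int_def ..
  have [measurable]: "Q \<in> borel_measurable borel" "?Q2 \<in> borel_measurable borel" using B B2 by auto
  have [measurable]: "?K \<in> borel_measurable borel" unfolding Kf by measurable
  have sq: "(\<integral>z. (norm (g z))\<^sup>2 \<partial>lborel) \<le> C\<^sup>2 / (2 * pi)" if "L2_norm g \<le> C / sqrt (2 * pi)" for g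
  proof -
    have "0 \<le> (\<integral>z. (norm (g z))\<^sup>2 \<partial>lborel)" by simp
    then have "(\<integral>z. (norm (g z))\<^sup>2 \<partial>lborel) = (L2_norm g)\<^sup>2" unfolding L2_norm_def by simp
    also have "\<dots> \<le> (C / sqrt (2 * pi))\<^sup>2" using that by (intro power_mono) (simp_all add: L2_norm_def)
    finally show ?thesis by (simp add: power_divide)
  qed
  have K2: "(norm (?K u))\<^sup>2 = 1 / (2 * pi) * (norm (fourier_int Q u))\<^sup>2" for u
    unfolding Kf by (simp add: norm_mult norm_divide power_mult_distrib power_divide)
  have K4: "u ^ 4 * (norm (?K u))\<^sup>2 = 1 / (2 * pi) * (norm (fourier_int ?Q2 u))\<^sup>2" for u
  proof -
    have "fourier_int ?Q2 u = - complex_of_real (u\<^sup>2) * fourier_int Q u"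
      by (rule fourier_int_second_deriv[OF Q]) (rule supp)
    then have "norm (fourier_int ?Q2 u) = u\<^sup>2 * norm (fourier_int Q u)"
      by (simp add: norm_mult norm_power)
    then show ?thesis unfolding K2 by (simp add: power_mult_distrib)
  qed
  have pl: "(\<integral>\<^sup>+u. ennreal (1 / (2 * pi) * (norm (fourier_int g u))\<^sup>2) \<partial>lborel) \<le> ennreal (C\<^sup>2 / (2 * pi))"
    if "integrable lborel g" "integrable lborel (\<lambda>z. (norm (g z))\<^sup>2)" "L2_norm g \<le> C / sqrt (2 * pi)" for g
  proof -
    have [measurable]: "g \<in> borel_measurable borel" using that by auto
    have "(\<integral>\<^sup>+u. ennreal (1 / (2 * pi) * (norm (fourier_int g u))\<^sup>2) \<partial>lborel)
        = ennreal (1 / (2 * pi)) * (\<integral>\<^sup>+u. ennreal ((norm (fourier_int g u))\<^sup>2) \<partial>lborel)"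
      by (subst nn_integral_cmult[symmetric]) (auto simp flip: ennreal_mult)
    also have "\<dots> \<le> ennreal (1 / (2 * pi)) * ennreal (2 * pi * (\<integral>z. (norm (g z))\<^sup>2 \<partial>lborel))"
      by (intro mult_left_mono plancherel_le that) simp
    also have "\<dots> = ennreal (\<integral>z. (norm (g z))\<^sup>2 \<partial>lborel)"
      by (simp flip: ennreal_mult)
    also have "\<dots> \<le> ennreal (C\<^sup>2 / (2 * pi))" by (intro ennreal_leI sq that)
    finally show ?thesis .
  qed
  have p: "1 + u\<^sup>2 > 0" "1 + u ^ 4 > 0" for u :: real
    by (simp_all add: add_pos_nonneg)
  have pw: "v u * norm (?K u) \<le> pi / (2 * C) * ((norm (?K u))\<^sup>2 + u ^ 4 * (norm (?K u))\<^sup>2)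
      + C / (2 * pi) * (((1 - q) + q * u\<^sup>2) * 2 / (1 + u\<^sup>2)\<^sup>2)" for u
  proof -
    let ?k = "norm (?K u)"
    \<comment> \<open>The scale is chosen so that, after integration, the kernel half and the weight
      half of AM-GM contribute C / 2 each.\<close>
    define S where "S = sqrt (pi / C * (1 + u ^ 4))"
    define a where "a = S * ?k"
    define b where "b = v u / S"
    have pos: "pi / C * (1 + u ^ 4) > 0" using C p(2)[of u] by (intro mult_pos_pos divide_pos_pos) simp_all
    have S: "S > 0" "S\<^sup>2 = pi / C * (1 + u ^ 4)" unfolding S_def using pos by (simp_all only: real_sqrt_gt_zero real_sqrt_pow2 less_imp_le)
    have "v u * ?k = a * b" unfolding a_def b_def using S(1) by simp
    also have "\<dots> \<le> a\<^sup>2 / 2 + b\<^sup>2 / 2" using sum_squares_bound[of a b] by simp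
    also have "a\<^sup>2 / 2 = pi / (2 * C) * (?k\<^sup>2 + u ^ 4 * ?k\<^sup>2)"
      unfolding a_def power_mult_distrib S(2) by (simp add: algebra_simps add_divide_distrib)
    also have "b\<^sup>2 / 2 = C / (2 * pi) * ((v u)\<^sup>2 / (1 + u ^ 4))"
      unfolding b_def power_divide S(2) by (simp add: ac_simps)
    also have "\<dots> \<le> C / (2 * pi) * (((1 - q) + q * u\<^sup>2) * 2 / (1 + u\<^sup>2)\<^sup>2)"
    proof (intro mult_left_mono)
      have "(1 + u\<^sup>2)\<^sup>2 + (u\<^sup>2 - 1)\<^sup>2 = 2 * (1 + u ^ 4)"
        by algebra
      then have "(1 + u\<^sup>2)\<^sup>2 \<le> 2 * (1 + u ^ 4)"
        using zero_le_power2[of "u\<^sup>2 - 1"] by linarith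
      then have "2 / (2 * (1 + u ^ 4)) \<le> 2 / (1 + u\<^sup>2)\<^sup>2"
        by (rule divide_left_mono) (use p[of u] in \<open>auto intro!: mult_pos_pos zero_less_power\<close>)
      then have le: "1 / (1 + u ^ 4) \<le> 2 / (1 + u\<^sup>2)\<^sup>2"
        using nonzero_mult_divide_mult_cancel_left[of "2::real" 1 "1 + u ^ 4"] by simp
      have "(v u)\<^sup>2 * (1 / (1 + u ^ 4)) \<le> ((1 - q) + q * u\<^sup>2) * (2 / (1 + u\<^sup>2)\<^sup>2)"
        by (rule mult_mono[OF v(2) le]) (use q p[of u] in auto)
      then show "(v u)\<^sup>2 / (1 + u ^ 4) \<le> ((1 - q) + q * u\<^sup>2) * 2 / (1 + u\<^sup>2)\<^sup>2"
        by (simp only: times_divide_eq_right mult_1_right)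
    qed (use C in simp)
    finally show ?thesis by simp
  qed
  have "(\<integral>\<^sup>+u. ennreal (v u * norm (?K u)) \<partial>lborel)
      \<le> (\<integral>\<^sup>+u. (ennreal (pi / (2 * C)) * (ennreal ((norm (?K u))\<^sup>2) + ennreal (u ^ 4 * (norm (?K u))\<^sup>2))
      + ennreal (C / (2 * pi)) * ennreal (((1 - q) + q * u\<^sup>2) * 2 / (1 + u\<^sup>2)\<^sup>2)) \<partial>lborel)"
  proof (rule nn_integral_mono)
    fix u
    have 1: "0 \<le> pi / (2 * C)" "0 \<le> C / (2 * pi)" "0 \<le> ((1 - q) + q * u\<^sup>2) * 2 / (1 + u\<^sup>2)\<^sup>2"
      "0 \<le> (norm (?K u))\<^sup>2" "0 \<le> u ^ 4 * (norm (?K u))\<^sup>2"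
      using C q by auto
    show "ennreal (v u * norm (?K u)) \<le> ennreal (pi / (2 * C)) * (ennreal ((norm (?K u))\<^sup>2) + ennreal (u ^ 4 * (norm (?K u))\<^sup>2))
      + ennreal (C / (2 * pi)) * ennreal (((1 - q) + q * u\<^sup>2) * 2 / (1 + u\<^sup>2)\<^sup>2)"
      using ennreal_leI[OF pw[of u]] 1
      by (simp only: ennreal_mult ennreal_plus mult_nonneg_nonneg add_nonneg_nonneg)
  qed
  also have "\<dots> = ennreal (pi / (2 * C)) * ((\<integral>\<^sup>+u. ennreal ((norm (?K u))\<^sup>2) \<partial>lborel)
        + (\<integral>\<^sup>+u. ennreal (u ^ 4 * (norm (?K u))\<^sup>2) \<partial>lborel))
      + ennreal (C / (2 * pi)) * (\<integral>\<^sup>+u. ennreal (((1 - q) + q * u\<^sup>2) * 2 / (1 + u\<^sup>2)\<^sup>2) \<partial>lborel)"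
  proof -
    have lin: "(\<integral>\<^sup>+u. a * (f u + g u) + c * w u \<partial>lborel)
        = a * ((\<integral>\<^sup>+u. f u \<partial>lborel) + (\<integral>\<^sup>+u. g u \<partial>lborel)) + c * (\<integral>\<^sup>+u. w u \<partial>lborel)"
      if [measurable]: "f \<in> borel_measurable lborel" "g \<in> borel_measurable lborel" "w \<in> borel_measurable lborel"
      for f g w :: "real \<Rightarrow> ennreal" and a c
    proof -
      have "(\<integral>\<^sup>+u. a * (f u + g u) + c * w u \<partial>lborel)
          = (\<integral>\<^sup>+u. a * (f u + g u) \<partial>lborel) + (\<integral>\<^sup>+u. c * w u \<partial>lborel)"
        by (rule nn_integral_add) measurable
      then show ?thesis by (simp add: nn_integral_cmult nn_integral_add that)
    qed
    show ?thesis by (rule lin) measurable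
  qed
  also have "\<dots> \<le> ennreal (pi / (2 * C)) * (ennreal (C\<^sup>2 / (2 * pi)) + ennreal (C\<^sup>2 / (2 * pi)))
      + ennreal (C / (2 * pi)) * ennreal pi"
    unfolding nn_integral_weight[OF q] K4 unfolding K2
    by (intro add_mono mult_left_mono pl B B2 L2 order_refl) auto
  also have "\<dots> = ennreal (pi / (2 * C) * (C\<^sup>2 / (2 * pi) + C\<^sup>2 / (2 * pi)) + C / (2 * pi) * pi)"
  proof -
    have lin: "ennreal a * (ennreal b + ennreal b) + ennreal c * ennreal e = ennreal (a * (b + b) + c * e)"
      if "a \<ge> 0" "b \<ge> 0" "c \<ge> 0" "e \<ge> 0" for a b c e
      using that by (simp only: ennreal_mult ennreal_plus mult_nonneg_nonneg add_nonneg_nonneg)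
    show ?thesis by (rule lin) (use C in simp_all)
  qed
  also have "pi / (2 * C) * (C\<^sup>2 / (2 * pi) + C\<^sup>2 / (2 * pi)) + C / (2 * pi) * pi = C"
  proof -
    have "C\<^sup>2 / (2 * pi) + C\<^sup>2 / (2 * pi) = C\<^sup>2 / pi" by simp
    moreover have "pi / (2 * C) * (C\<^sup>2 / pi) = C / 2" using C by (simp add: power2_eq_square)
    moreover have "C / (2 * pi) * pi = C / 2" by simp
    ultimately show ?thesis by simp
  qed
  finally have fin: "(\<integral>\<^sup>+u. ennreal (v u * norm (?K u)) \<partial>lborel) \<le> ennreal C" .
  have int: "integrable lborel (\<lambda>u. v u * norm (?K u))"
  proof (rule integrableI_nonneg)
    show "(\<integral>\<^sup>+u. ennreal (v u * norm (?K u)) \<partial>lborel) < \<infinity>"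
      by (rule le_less_trans[OF fin]) simp
  qed (use v(1) in simp_all)
  show "integrable lborel (\<lambda>u. of_real (v u) * ?K u)"
  proof (rule Bochner_Integration.integrable_bound[OF int])
    show "(\<lambda>u. of_real (v u) * ?K u) \<in> borel_measurable lborel" by measurable
    show "AE u in lborel. norm (of_real (v u) * ?K u) \<le> norm (v u * norm (?K u))"
      by (rule AE_I2) (simp add: norm_mult)
  qed
  have nn: "(\<integral>\<^sup>+u. ennreal (v u * norm (?K u)) \<partial>lborel) = ennreal (\<integral>u. v u * norm (?K u) \<partial>lborel)"
    by (rule nn_integral_eq_integral[OF int]) (simp add: v(1))
  have le: "x \<le> y" if "ennreal x \<le> ennreal y" "0 \<le> y" for x y :: real
    using that ennreal_le_iff[of y x] by blast
  have "ennreal (\<integral>u. v u * norm (?K u) \<partial>lborel) \<le> ennreal C"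
    using fin unfolding nn .
  from le[OF this] C show "(\<integral>u. v u * norm (?K u) \<partial>lborel) \<le> C"
    by linarith
qed

section \<open>Fourier representation of powers\<close>

text \<open>After the substitution \<open>y = e\<^sup>v\<close> this is \<open>\<integral> y\<^sup>p e\<^sup>-\<^sup>\<xi>\<^sup>y dy \<le> \<xi>\<^sup>-\<^sup>1\<^sup>-\<^sup>p\<close>, that is, \<open>\<Gamma>(1 + p) \<le> 1\<close>. In the variable \<open>v\<close>,
  the symmetry \<open>y \<mapsto> 1 / y\<close> used below becomes a reflection.\<close>

lemma exp_powr_integral_le:
  fixes \<xi> p :: real
  assumes x: "\<xi> > 0" and p: "0 < p" "p < 1"
  shows "(\<integral>\<^sup>+v. ennreal (exp v * exp (p * v) * exp (- (\<xi> * exp v))) \<partial>lborel) \<le> ennreal (\<xi> powr (- 1 - p))"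
proof -
  \<comment> \<open>The majorant obtained from the tangent bound on
    \<open>(\<xi> * exp v) powr p\<close>. Unlike the original integrand it has an elementary
    antiderivative, and its total mass is exactly \<open>\<xi> powr (- 1 - p)\<close>.\<close>
  define f where "f v = \<xi> powr (- p) * (exp v * exp (- (\<xi> * exp v)) * ((1 - p) + p * (\<xi> * exp v)))" for v
  define F where "F v = - (\<xi> powr (- p) * (1 / \<xi> * (exp (- (\<xi> * exp v)) * (1 + p * (\<xi> * exp v)))))" for v
  have dF: "DERIV F v :> f v" for v
    unfolding F_def f_def
    by (rule derivative_eq_intros refl)+ (use x in \<open>simp add: field_simps\<close>)
  have cf: "isCont f v" for v unfolding f_def by (intro continuous_intros)
  have f0: "f v \<ge> 0" for v unfolding f_def using x p by (intro mult_nonneg_nonneg add_nonneg_nonneg) auto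
  have l1: "(F \<longlongrightarrow> - (\<xi> powr (- p) * (1 / \<xi> * (exp (- (\<xi> * 0)) * (1 + p * (\<xi> * 0)))))) at_bot"
    unfolding F_def by (intro tendsto_intros exp_at_bot)
  have "((\<lambda>y. exp (- (\<xi> * y)) * (1 + p * (\<xi> * y))) \<longlongrightarrow> 0) at_top"
    using x p by real_asymp
  then have "((\<lambda>v. exp (- (\<xi> * exp v)) * (1 + p * (\<xi> * exp v))) \<longlongrightarrow> 0) at_top"
    by (rule filterlim_compose) (rule exp_at_top)
  then have l2: "(F \<longlongrightarrow> - (\<xi> powr (- p) * (1 / \<xi> * 0))) at_top"
    unfolding F_def by (intro tendsto_intros)
  have "(\<integral>\<^sup>+v. ennreal (exp v * exp (p * v) * exp (- (\<xi> * exp v))) \<partial>lborel) \<le> (\<integral>\<^sup>+v. ennreal (f v) \<partial>lborel)"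
  proof (intro nn_integral_mono ennreal_leI)
    fix v
    have "\<xi> powr p * exp (p * v) = (\<xi> * exp v) powr p"
      using x by (simp add: powr_mult) (simp add: powr_def)
    also have "\<dots> \<le> (1 - p) + p * (\<xi> * exp v)" using x p by (intro powr_le_affine) auto
    finally have "\<xi> powr (- p) * (\<xi> powr p * exp (p * v)) \<le> \<xi> powr (- p) * ((1 - p) + p * (\<xi> * exp v))"
      by (intro mult_left_mono) auto
    moreover have "\<xi> powr (- p) * (\<xi> powr p * exp (p * v)) = exp (p * v)"
      using x by (simp add: powr_minus field_simps)
    ultimately have "exp (p * v) \<le> \<xi> powr (- p) * ((1 - p) + p * (\<xi> * exp v))" by simp
    then have "exp v * exp (- (\<xi> * exp v)) * exp (p * v) \<le> exp v * exp (- (\<xi> * exp v)) * (\<xi> powr (- p) * ((1 - p) + p * (\<xi> * exp v)))"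
      by (intro mult_left_mono) auto
    then show "exp v * exp (p * v) * exp (- (\<xi> * exp v)) \<le> f v" unfolding f_def by (simp only: ac_simps)
  qed
  also have "\<dots> = ennreal (- (\<xi> powr (- p) * (1 / \<xi> * 0)) - - (\<xi> powr (- p) * (1 / \<xi> * (exp (- (\<xi> * 0)) * (1 + p * (\<xi> * 0))))))"
    by (rule nn_integral_FTC_UNIV[OF dF cf f0 l1 l2])
  also have "- (\<xi> powr (- p) * (1 / \<xi> * 0)) - - (\<xi> powr (- p) * (1 / \<xi> * (exp (- (\<xi> * 0)) * (1 + p * (\<xi> * 0)))))
      = \<xi> powr (- 1 - p)"
    using x by (simp add: powr_minus powr_diff field_simps powr_add)
  finally show ?thesis .
qed

text \<open>The difference of the Laplace transforms 1 / y of 1 and y / (1 + y^2) of the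
  cosine.\<close>

lemma laplace_one_minus_cos:
  fixes y :: real
  assumes y: "y > 0"
  shows "(\<integral>\<^sup>+\<xi>. ennreal ((1 - cos \<xi>) * exp (- (\<xi> * y))) * indicator {0..} \<xi> \<partial>lborel) = ennreal (1 / (y * (1 + y\<^sup>2)))"
proof -
  define F where "F \<xi> = exp (- (\<xi> * y)) * (- (1 / y) + (y * cos \<xi> - sin \<xi>) / (1 + y\<^sup>2))" for \<xi>
  have p: "1 + y\<^sup>2 > 0" "1 + y\<^sup>2 \<noteq> 0" by (simp_all add: add_pos_nonneg add_nonneg_eq_0_iff)
  have dF: "DERIV F \<xi> :> (1 - cos \<xi>) * exp (- (\<xi> * y))" for \<xi>
  proof -
    have "DERIV F \<xi> :> exp (- (\<xi> * y)) * (- y) * (- (1 / y) + (y * cos \<xi> - sin \<xi>) / (1 + y\<^sup>2))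
        + exp (- (\<xi> * y)) * ((y * (- sin \<xi>) - cos \<xi>) / (1 + y\<^sup>2))"
      unfolding F_def by (rule derivative_eq_intros refl p | simp add: p)+
    also have "exp (- (\<xi> * y)) * (- y) * (- (1 / y) + (y * cos \<xi> - sin \<xi>) / (1 + y\<^sup>2))
        + exp (- (\<xi> * y)) * ((y * (- sin \<xi>) - cos \<xi>) / (1 + y\<^sup>2))
       = exp (- (\<xi> * y)) * (y * (1 / y) + (- y * (y * cos \<xi> - sin \<xi>) + (y * (- sin \<xi>) - cos \<xi>)) / (1 + y\<^sup>2))"
      by (simp add: algebra_simps add_divide_distrib diff_divide_distrib)
    also have "- y * (y * cos \<xi> - sin \<xi>) + (y * (- sin \<xi>) - cos \<xi>) = - cos \<xi> * (1 + y\<^sup>2)"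
      by (simp add: algebra_simps power2_eq_square)
    also have "exp (- (\<xi> * y)) * (y * (1 / y) + - cos \<xi> * (1 + y\<^sup>2) / (1 + y\<^sup>2)) = (1 - cos \<xi>) * exp (- (\<xi> * y))"
      using p y by simp
    finally show ?thesis .
  qed
  have e: "((\<lambda>\<xi>. exp (- (\<xi> * y))) \<longlongrightarrow> 0) at_top" using y by real_asymp
  have lim: "(F \<longlongrightarrow> 0) at_top"
  proof (rule Lim_null_comparison)
    show "eventually (\<lambda>\<xi>. norm (F \<xi>) \<le> exp (- (\<xi> * y)) * (1 / y + (y + 1) / (1 + y\<^sup>2))) at_top"
    proof (rule always_eventually, rule allI)
      fix \<xi>
      have "\<bar>y * cos \<xi> - sin \<xi>\<bar> \<le> \<bar>y * cos \<xi>\<bar> + \<bar>sin \<xi>\<bar>" by (rule abs_triangle_ineq4)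
      also have "\<dots> \<le> y + 1" using y abs_cos_le_one[of \<xi>] abs_sin_le_one[of \<xi>]
        by (intro add_mono) (auto simp: abs_mult mult_left_le)
      finally have "\<bar>(y * cos \<xi> - sin \<xi>) / (1 + y\<^sup>2)\<bar> \<le> (y + 1) / (1 + y\<^sup>2)"
        using p by (simp add: divide_right_mono abs_divide)
      then have "\<bar>- (1 / y) + (y * cos \<xi> - sin \<xi>) / (1 + y\<^sup>2)\<bar> \<le> 1 / y + (y + 1) / (1 + y\<^sup>2)"
        using y by (intro order_trans[OF abs_triangle_ineq] add_mono) auto
      then show "norm (F \<xi>) \<le> exp (- (\<xi> * y)) * (1 / y + (y + 1) / (1 + y\<^sup>2))"
        unfolding F_def by (simp add: abs_mult)
    qed
    show "((\<lambda>\<xi>. exp (- (\<xi> * y)) * (1 / y + (y + 1) / (1 + y\<^sup>2))) \<longlongrightarrow> 0) at_top"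
      using tendsto_mult_right[OF e, of "1 / y + (y + 1) / (1 + y\<^sup>2)"] by simp
  qed
  have "(\<integral>\<^sup>+\<xi>. ennreal ((1 - cos \<xi>) * exp (- (\<xi> * y))) * indicator {0..} \<xi> \<partial>lborel) = ennreal (0 - F 0)"
    by (rule nn_integral_FTC_atLeast[OF _ dF _ lim]) auto
  also have "0 - F 0 = 1 / (y * (1 + y\<^sup>2))"
    unfolding F_def using p y by (simp add: field_simps power2_eq_square)
  finally show ?thesis .
qed

text \<open>By \<open>exp_powr_integral_le\<close>, \<open>\<xi> powr (- 1 - p)\<close> dominates a
  superposition of exponentials. Tonelli and \<open>laplace_one_minus_cos\<close> leave the integral
  of y^(p-1) / (1 + y^2) over the half-line, which is that of \<open>g\<close> in the variable v =
  log y. The bound pi / 2 is its value at p = 1.\<close>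

lemma nn_integral_one_minus_cos_powr_ge:
  fixes p :: real
  assumes p: "0 < p" "p < 1"
  shows "ennreal (pi / 2) \<le> (\<integral>\<^sup>+\<xi>. ennreal ((1 - cos \<xi>) * \<bar>\<xi>\<bar> powr (- 1 - p)) * indicator {0..} \<xi> \<partial>lborel)"
proof -
  define g where "g v = exp (p * v) / (1 + (exp v)\<^sup>2)" for v :: real
  have pos: "1 + (exp v)\<^sup>2 > 0" for v :: real by (simp add: add_pos_nonneg)
  have [measurable]: "g \<in> borel_measurable borel" unfolding g_def by measurable
  have arct: "(\<integral>\<^sup>+v. ennreal (exp v / (1 + (exp v)\<^sup>2)) \<partial>lborel) = ennreal (pi / 2 - 0)"
  proof (rule nn_integral_FTC_UNIV[where F="\<lambda>v. arctan (exp v)"])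
    show "DERIV (\<lambda>v. arctan (exp v)) u :> exp u / (1 + (exp u)\<^sup>2)" for u
      by (rule derivative_eq_intros refl)+ (simp add: divide_inverse mult.commute)
    show "isCont (\<lambda>v. exp v / (1 + (exp v)\<^sup>2)) u" for u :: real
      using pos[of u] by (intro continuous_intros) simp_all
    show "0 \<le> exp u / (1 + (exp u)\<^sup>2)" for u :: real using pos[of u] by simp
    show "((\<lambda>v::real. arctan (exp v)) \<longlongrightarrow> pi / 2) at_top"
      by (rule filterlim_compose[OF tendsto_arctan_at_top exp_at_top])
    have "((\<lambda>v::real. arctan (exp v)) \<longlongrightarrow> arctan 0) at_bot"
      by (intro tendsto_intros exp_at_bot)
    then show "((\<lambda>v::real. arctan (exp v)) \<longlongrightarrow> 0) at_bot" by simp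
  qed
  have refl: "(\<integral>\<^sup>+v. ennreal (g v) \<partial>lborel) = (\<integral>\<^sup>+v. ennreal (g (- v)) \<partial>lborel)"
    by (subst nn_integral_real_affine[of "\<lambda>v. ennreal (g v)" "-1" 0]) auto
  \<comment> \<open>AM-GM for the reflected pair: the geometric mean of \<open>exp (p * v)\<close>
    and \<open>exp (2 * v - p * v)\<close> is \<open>exp v\<close> whatever \<open>p\<close>
    is.\<close>
  have sym: "2 * (exp v / (1 + (exp v)\<^sup>2)) \<le> g v + g (- v)" for v
  proof -
    have "1 + (exp (- v))\<^sup>2 = (1 + (exp v)\<^sup>2) * exp (- (2 * v))"
      by (simp add: power2_eq_square algebra_simps flip: exp_add)
    then have "g (- v) = exp (- (p * v)) / ((1 + (exp v)\<^sup>2) * exp (- (2 * v)))" unfolding g_def by simp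
    also have "\<dots> = exp (2 * v - p * v) / (1 + (exp v)\<^sup>2)"
      by (simp add: exp_minus exp_diff field_simps)
    finally have "g v + g (- v) = (exp (p * v) + exp (2 * v - p * v)) / (1 + (exp v)\<^sup>2)"
      unfolding g_def by (simp add: add_divide_distrib)
    moreover have "2 * exp v \<le> exp (p * v) + exp (2 * v - p * v)"
    proof -
      define a where "a = exp (p * v / 2)"
      define b where "b = exp ((2 * v - p * v) / 2)"
      have "a * a = exp (p * v)" "b * b = exp (2 * v - p * v)" "a * b = exp v"
        unfolding a_def b_def by (simp_all flip: exp_add add: field_simps)
      then show ?thesis using sum_squares_bound[of a b] by (simp add: power2_eq_square)
    qed
    ultimately show ?thesis using pos[of v] by (simp add: divide_right_mono)
  qed
  have "2 * ennreal (pi / 2) = (\<integral>\<^sup>+v. 2 * ennreal (exp v / (1 + (exp v)\<^sup>2)) \<partial>lborel)"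
    using arct by (simp add: nn_integral_cmult)
  also have "\<dots> \<le> (\<integral>\<^sup>+v. ennreal (g v) + ennreal (g (- v)) \<partial>lborel)"
  proof (rule nn_integral_mono)
    fix v
    have "2 * ennreal (exp v / (1 + (exp v)\<^sup>2)) = ennreal (2 * (exp v / (1 + (exp v)\<^sup>2)))"
      using pos[of v] by (subst ennreal_mult) simp_all
    also have "\<dots> \<le> ennreal (g v + g (- v))" by (rule ennreal_leI[OF sym])
    also have "\<dots> = ennreal (g v) + ennreal (g (- v))" unfolding g_def using pos by (intro ennreal_plus) (auto intro: less_imp_le)
    finally show "2 * ennreal (exp v / (1 + (exp v)\<^sup>2)) \<le> ennreal (g v) + ennreal (g (- v))" .
  qed
  also have "\<dots> = (\<integral>\<^sup>+v. ennreal (g v) \<partial>lborel) + (\<integral>\<^sup>+v. ennreal (g (- v)) \<partial>lborel)"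
    by (rule nn_integral_add) measurable
  also have "\<dots> = 2 * (\<integral>\<^sup>+v. ennreal (g v) \<partial>lborel)" by (simp add: refl[symmetric] mult_2)
  finally have J: "ennreal (pi / 2) \<le> (\<integral>\<^sup>+v. ennreal (g v) \<partial>lborel)"
    by (subst (asm) ennreal_mult_le_mult_iff) auto
  have "(\<integral>\<^sup>+v. ennreal (g v) \<partial>lborel)
     = (\<integral>\<^sup>+v. ennreal (exp v * exp (p * v)) * ennreal (1 / (exp v * (1 + (exp v)\<^sup>2))) \<partial>lborel)"
  proof (intro nn_integral_cong)
    fix v :: real
    have "exp v * exp (p * v) * (1 / (exp v * (1 + (exp v)\<^sup>2))) = g v" unfolding g_def by simp
    then show "ennreal (g v) = ennreal (exp v * exp (p * v)) * ennreal (1 / (exp v * (1 + (exp v)\<^sup>2)))"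
      using pos[of v] by (simp flip: ennreal_mult)
  qed
  also have "\<dots> = (\<integral>\<^sup>+v. \<integral>\<^sup>+\<xi>. ennreal (exp v * exp (p * v)) * (ennreal ((1 - cos \<xi>) * exp (- (\<xi> * exp v))) * indicator {0..} \<xi>) \<partial>lborel \<partial>lborel)"
    by (subst laplace_one_minus_cos[symmetric], simp, subst nn_integral_cmult) auto
  also have "\<dots> = (\<integral>\<^sup>+\<xi>. \<integral>\<^sup>+v. ennreal (exp v * exp (p * v)) * (ennreal ((1 - cos \<xi>) * exp (- (\<xi> * exp v))) * indicator {0..} \<xi>) \<partial>lborel \<partial>lborel)"
    by (rule lborel_pair.Fubini') measurable
  also have "\<dots> \<le> (\<integral>\<^sup>+\<xi>. ennreal ((1 - cos \<xi>) * \<bar>\<xi>\<bar> powr (- 1 - p)) * indicator {0..} \<xi> \<partial>lborel)"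
  proof (rule nn_integral_mono)
    fix \<xi> :: real
    show "(\<integral>\<^sup>+v. ennreal (exp v * exp (p * v)) * (ennreal ((1 - cos \<xi>) * exp (- (\<xi> * exp v))) * indicator {0..} \<xi>) \<partial>lborel)
      \<le> ennreal ((1 - cos \<xi>) * \<bar>\<xi>\<bar> powr (- 1 - p)) * indicator {0..} \<xi>"
    proof (cases "\<xi> > 0")
      case True
      have "(\<integral>\<^sup>+v. ennreal (exp v * exp (p * v)) * (ennreal ((1 - cos \<xi>) * exp (- (\<xi> * exp v))) * indicator {0..} \<xi>) \<partial>lborel)
        = (\<integral>\<^sup>+v. ennreal (1 - cos \<xi>) * ennreal (exp v * exp (p * v) * exp (- (\<xi> * exp v))) \<partial>lborel)"
        using True by (intro nn_integral_cong) (simp add: ac_simps flip: ennreal_mult)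
      also have "\<dots> = ennreal (1 - cos \<xi>) * (\<integral>\<^sup>+v. ennreal (exp v * exp (p * v) * exp (- (\<xi> * exp v))) \<partial>lborel)"
        by (rule nn_integral_cmult) measurable
      also have "\<dots> \<le> ennreal (1 - cos \<xi>) * ennreal (\<xi> powr (- 1 - p))"
        by (intro mult_left_mono exp_powr_integral_le True p) simp
      finally show ?thesis using True by (simp flip: ennreal_mult)
    next
      case False
      then have "\<xi> = 0 \<or> \<xi> < 0" by linarith
      then show ?thesis by auto
    qed
  qed
  finally show ?thesis using J order_trans by blast
qed

lemma integrable_even:
  fixes f :: "real \<Rightarrow> real"
  assumes "integrable lborel (\<lambda>x. indicator {0<..} x * f x)" "\<And>x. f (- x) = f x" "f 0 = 0"
  shows "integrable lborel f"
proof -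
  have "integrable lborel (\<lambda>x. indicator {0<..} (- x) * f (- x))"
    using lborel_integrable_real_affine[OF assms(1), of "-1" 0] by simp
  from Bochner_Integration.integrable_add[OF assms(1) this]
  have "integrable lborel (\<lambda>x. indicator {0<..} x * f x + indicator {0<..} (- x) * f (- x))" .
  also have "(\<lambda>x. indicator {0<..} x * f x + indicator {0<..} (- x) * f (- x)) = f"
  proof
    fix x show "indicator {0<..} x * f x + indicator {0<..} (- x) * f (- x) = f x"
      using assms(2)[of x] assms(3) by (cases "x > 0"; cases "x < 0"; cases "x = 0") (auto simp: indicator_def)
  qed
  finally show ?thesis .
qed

text \<open>The size of \<open>(1 - iexp \<xi>) * \<bar>\<xi>\<bar> powr (- 1 - p)\<close>: near 0
  the first factor gains one power, at infinity it is bounded. The two pieces are integrable because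
  of \<open>p < 1\<close> and \<open>p > 0\<close> respectively.\<close>

definition powr_majorant :: "real \<Rightarrow> real \<Rightarrow> real" where
  "powr_majorant p \<xi> = (if \<bar>\<xi>\<bar> < 1 then \<bar>\<xi>\<bar> powr (- p) else \<bar>\<xi>\<bar> powr (- 1 - p))"

lemma powr_majorant_nonneg: "powr_majorant p \<xi> \<ge> 0"
  unfolding powr_majorant_def by simp

lemma integrable_powr_majorant:
  assumes p: "0 < p" "p < 1"
  shows "integrable lborel (powr_majorant p)"
proof (rule integrable_even)
  have "set_integrable lborel (einterval (ereal 0) (ereal 1)) (\<lambda>x. x powr (- p))"
  proof (rule interval_integral_FTC_nonneg(1)[where F="\<lambda>x. x powr (1 - p) / (1 - p)" and A=0 and B="1 powr (1 - p) / (1 - p)"])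
    fix x assume "ereal 0 < ereal x"
    then have x: "x > 0" by simp
    show "DERIV (\<lambda>x. x powr (1 - p) / (1 - p)) x :> x powr (- p)"
      using x p by (auto intro!: derivative_eq_intros)
    show "isCont (\<lambda>x. x powr (- p)) x" using x by (intro continuous_intros) auto
  next
    have "((\<lambda>x::real. x powr (1 - p) / (1 - p)) \<longlongrightarrow> 0 powr (1 - p) / (1 - p)) (at_right 0)"
      using p eventually_mono[OF eventually_at_right_less[of "0::real"], of "\<lambda>x. 0 \<le> x"]
      by (intro tendsto_intros) auto
    then show "(((\<lambda>x. x powr (1 - p) / (1 - p)) \<circ> real_of_ereal) \<longlongrightarrow> 0) (at_right (ereal 0))"
      by (simp add: ereal_tendsto_simps)
    have "((\<lambda>x::real. x powr (1 - p) / (1 - p)) \<longlongrightarrow> 1 powr (1 - p) / (1 - p)) (at_left 1)"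
      using p by (intro tendsto_intros) auto
    then show "(((\<lambda>x. x powr (1 - p) / (1 - p)) \<circ> real_of_ereal) \<longlongrightarrow> 1 powr (1 - p) / (1 - p)) (at_left (ereal 1))"
      by (simp add: ereal_tendsto_simps)
  qed auto
  then have i1: "integrable lborel (\<lambda>x. indicator {0<..<1} x * x powr (- p))"
    by (simp add: set_integrable_def)
  have "set_integrable lborel (einterval (ereal 1) \<infinity>) (\<lambda>x. x powr (- 1 - p))"
  proof (rule interval_integral_FTC_nonneg(1)[where F="\<lambda>x. - (x powr (- p)) / p" and A="- (1 powr (- p)) / p" and B=0])
    fix x assume "ereal 1 < ereal x"
    then have x: "x > 1" by simp
    show "DERIV (\<lambda>x. - (x powr (- p)) / p) x :> x powr (- 1 - p)"
      using x p by (auto intro!: derivative_eq_intros simp: minus_diff_commute[of p 1])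
    show "isCont (\<lambda>x. x powr (- 1 - p)) x" using x by (intro continuous_intros) auto
  next
    have "((\<lambda>x::real. - (x powr (- p)) / p) \<longlongrightarrow> - (1 powr (- p)) / p) (at_right 1)"
      using p by (intro tendsto_intros) auto
    then show "(((\<lambda>x. - (x powr (- p)) / p) \<circ> real_of_ereal) \<longlongrightarrow> - (1 powr (- p)) / p) (at_right (ereal 1))"
      by (simp add: ereal_tendsto_simps)
    have "((\<lambda>x::real. - (x powr (- p)) / p) \<longlongrightarrow> 0) at_top" using p by real_asymp
    then show "(((\<lambda>x. - (x powr (- p)) / p) \<circ> real_of_ereal) \<longlongrightarrow> 0) (at_left \<infinity>)"
      by (simp add: ereal_tendsto_simps)
  qed auto
  then have i2: "integrable lborel (\<lambda>x. indicator {1<..} x * x powr (- 1 - p))"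
    by (simp add: set_integrable_def)
  have i3: "integrable lborel (\<lambda>x::real. indicator {1::real} x * 1 :: real)"
    by (rule integrable_real_indicator[where A="{1::real}" and M=lborel, THEN integrable_mult_left, of 1]) auto
  have "integrable lborel (\<lambda>x. indicator {0<..<1} x * x powr (- p) + indicator {1<..} x * x powr (- 1 - p) + indicator {1::real} x * 1)"
    by (intro Bochner_Integration.integrable_add i1 i2 i3)
  also have "(\<lambda>x. indicator {0<..<1} x * x powr (- p) + indicator {1<..} x * x powr (- 1 - p) + indicator {1::real} x * 1)
     = (\<lambda>x. indicator {0<..} x * powr_majorant p x)"
  proof
    fix x :: real
    consider "x \<le> 0" | "0 < x" "x < 1" | "x = 1" | "x > 1" by linarith
    then show "indicator {0<..<1} x * x powr (- p) + indicator {1<..} x * x powr (- 1 - p) + indicator {1::real} x * 1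
       = indicator {0<..} x * powr_majorant p x"
      by cases (auto simp: powr_majorant_def indicator_def)
  qed
  finally show "integrable lborel (\<lambda>x. indicator {0<..} x * powr_majorant p x)" .
qed (auto simp: powr_majorant_def)

lemma norm_one_minus_iexp_le: "norm (1 - iexp t) \<le> min 2 \<bar>t\<bar>"
proof -
  have "norm (1 - iexp t) \<le> norm (1::complex) + norm (iexp t)"
    by (rule norm_triangle_ineq4)
  moreover have "norm (iexp t - 1) \<le> \<bar>t\<bar>"
    using iexp_approx1[of t 0] by simp
  ultimately show ?thesis by (simp add: norm_minus_commute)
qed

lemma integrable_one_minus_iexp_powr:
  assumes p: "0 < p" "p < 1"
  shows "integrable lborel (\<lambda>\<xi>. (1 - iexp (\<xi> * x)) * complex_of_real (\<bar>\<xi>\<bar> powr (- 1 - p)))"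
proof (rule Bochner_Integration.integrable_bound)
  show "integrable lborel (\<lambda>\<xi>. (2 + \<bar>x\<bar>) * powr_majorant p \<xi>)"
    using integrable_powr_majorant[OF p] by simp
  show "AE \<xi> in lborel. norm ((1 - iexp (\<xi> * x)) * complex_of_real (\<bar>\<xi>\<bar> powr (- 1 - p)))
      \<le> norm ((2 + \<bar>x\<bar>) * powr_majorant p \<xi>)"
  proof (rule AE_I2)
    fix \<xi> :: real
    let ?e = "norm (1 - iexp (\<xi> * x))"
    have e: "?e \<le> 2" "?e \<le> \<bar>\<xi>\<bar> * \<bar>x\<bar>" using norm_one_minus_iexp_le[of "\<xi> * x"] by (simp_all add: abs_mult)
    have "?e * \<bar>\<xi>\<bar> powr (- 1 - p) \<le> (2 + \<bar>x\<bar>) * powr_majorant p \<xi>"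
    proof (cases "\<bar>\<xi>\<bar> < 1")
      case True
      have "?e * \<bar>\<xi>\<bar> powr (- 1 - p) \<le> \<bar>\<xi>\<bar> * \<bar>x\<bar> * \<bar>\<xi>\<bar> powr (- 1 - p)"
        by (rule mult_right_mono[OF e(2)]) simp
      also have "\<dots> = \<bar>x\<bar> * \<bar>\<xi>\<bar> powr (- p)"
        by (cases "\<xi> = 0") (simp_all add: powr_diff powr_minus field_simps)
      also have "\<dots> \<le> (2 + \<bar>x\<bar>) * \<bar>\<xi>\<bar> powr (- p)" by (rule mult_right_mono) simp_all
      finally show ?thesis using True by (simp add: powr_majorant_def)
    next
      case False
      have "?e * \<bar>\<xi>\<bar> powr (- 1 - p) \<le> (2 + \<bar>x\<bar>) * \<bar>\<xi>\<bar> powr (- 1 - p)"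
        by (rule mult_right_mono) (use e(1) in simp_all)
      then show ?thesis using False by (simp add: powr_majorant_def)
    qed
    then show "norm ((1 - iexp (\<xi> * x)) * complex_of_real (\<bar>\<xi>\<bar> powr (- 1 - p)))
      \<le> norm ((2 + \<bar>x\<bar>) * powr_majorant p \<xi>)"
      using powr_majorant_nonneg[of p \<xi>] by (simp add: norm_mult del: of_real_mult)
  qed
qed measurable

text \<open>Real by the symmetry of the weight, but typed as complex because it multiplies complex
  integrals; its modulus is bounded below through its real part.\<close>

definition powr_const :: "real \<Rightarrow> complex" where
  "powr_const p = (\<integral>\<xi>. (1 - iexp \<xi>) * complex_of_real (\<bar>\<xi>\<bar> powr (- 1 - p)) \<partial>lborel)"

text \<open>Homogeneity: substituting \<open>\<xi> / x\<close> for \<open>\<xi>\<close> pulls out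
  \<open>\<bar>x\<bar> powr p\<close>, and the even weight absorbs the sign of
  \<open>x\<close>.\<close>

lemma powr_fourier_repr:
  "(\<integral>\<xi>. (1 - iexp (\<xi> * x)) * complex_of_real (\<bar>\<xi>\<bar> powr (- 1 - p)) \<partial>lborel)
     = complex_of_real (\<bar>x\<bar> powr p) * powr_const p"
proof (cases "x = 0")
  case False
  have "(\<integral>\<xi>. (1 - iexp (\<xi> * x)) * complex_of_real (\<bar>\<xi>\<bar> powr (- 1 - p)) \<partial>lborel)
      = \<bar>1 / x\<bar> *\<^sub>R (\<integral>\<xi>. (1 - iexp ((0 + 1 / x * \<xi>) * x)) * complex_of_real (\<bar>0 + 1 / x * \<xi>\<bar> powr (- 1 - p)) \<partial>lborel)"
    using False by (intro lborel_integral_real_affine) simp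
  also have "\<dots> = (\<integral>\<xi>. complex_of_real \<bar>1 / x\<bar> * ((1 - iexp ((0 + 1 / x * \<xi>) * x)) * complex_of_real (\<bar>0 + 1 / x * \<xi>\<bar> powr (- 1 - p))) \<partial>lborel)"
    by (simp only: scaleR_conv_of_real integral_mult_right_zero)
  also have "\<dots> = (\<integral>\<xi>. complex_of_real (\<bar>x\<bar> powr p) * ((1 - iexp \<xi>) * complex_of_real (\<bar>\<xi>\<bar> powr (- 1 - p))) \<partial>lborel)"
  proof (intro Bochner_Integration.integral_cong refl)
    fix \<xi>
    have "\<bar>1 / x\<bar> * \<bar>0 + 1 / x * \<xi>\<bar> powr (- 1 - p) = \<bar>1 / x\<bar> * (\<bar>1 / x\<bar> powr (- 1 - p) * \<bar>\<xi>\<bar> powr (- 1 - p))"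
      by (simp only: add_0 abs_mult powr_mult abs_ge_zero)
    also have "\<dots> = \<bar>x\<bar> powr p * \<bar>\<xi>\<bar> powr (- 1 - p)"
      using False by (simp add: powr_divide powr_diff powr_minus field_simps)
    finally have "complex_of_real \<bar>1 / x\<bar> * complex_of_real (\<bar>0 + 1 / x * \<xi>\<bar> powr (- 1 - p))
        = complex_of_real (\<bar>x\<bar> powr p) * complex_of_real (\<bar>\<xi>\<bar> powr (- 1 - p))"
      by (simp only: of_real_mult[symmetric])
    then have eq: "complex_of_real \<bar>1 / x\<bar> * (a * complex_of_real (\<bar>0 + 1 / x * \<xi>\<bar> powr (- 1 - p)))
        = complex_of_real (\<bar>x\<bar> powr p) * (a * complex_of_real (\<bar>\<xi>\<bar> powr (- 1 - p)))" for a
      by (simp only: mult.left_commute[of _ a])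
    have "(0 + 1 / x * \<xi>) * x = \<xi>" using False by simp
    then show "complex_of_real \<bar>1 / x\<bar> * ((1 - iexp ((0 + 1 / x * \<xi>) * x)) * complex_of_real (\<bar>0 + 1 / x * \<xi>\<bar> powr (- 1 - p)))
      = complex_of_real (\<bar>x\<bar> powr p) * ((1 - iexp \<xi>) * complex_of_real (\<bar>\<xi>\<bar> powr (- 1 - p)))"
      unfolding eq by (simp only:)
  qed
  finally show ?thesis unfolding powr_const_def by (simp only: integral_mult_right_zero)
qed simp

text \<open>The value pi is what keeps the derivative bounds at the constant \<open>C\<close>: it
  cancels the quotient of the \<open>sqrt (2 * pi)\<close> from inversion by the
  \<open>sqrt (2 / pi)\<close> in the hypothesis on \<open>Q\<close>.\<close>

lemma norm_powr_const_ge: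
  assumes p: "0 < p" "p < 1"
  shows "pi \<le> norm (powr_const p)"
proof -
  define f where "f \<xi> = (1 - cos \<xi>) * \<bar>\<xi>\<bar> powr (- 1 - p)" for \<xi> :: real
  have [measurable]: "f \<in> borel_measurable borel" unfolding f_def by measurable
  have f0: "f \<xi> \<ge> 0" for \<xi> unfolding f_def by simp
  have f_even: "f (- \<xi>) = f \<xi>" for \<xi> unfolding f_def by simp
  have int: "integrable lborel (\<lambda>\<xi>. (1 - iexp \<xi>) * complex_of_real (\<bar>\<xi>\<bar> powr (- 1 - p)))"
    using integrable_one_minus_iexp_powr[OF p, of 1] by simp
  have Re: "Re ((1 - iexp \<xi>) * complex_of_real (\<bar>\<xi>\<bar> powr (- 1 - p))) = f \<xi>" for \<xi>
    unfolding f_def by (simp add: Re_exp)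
  have fi: "integrable lborel f" using integrable_Re[OF int] unfolding Re .
  have Rf: "Re (powr_const p) = (\<integral>\<xi>. f \<xi> \<partial>lborel)"
    unfolding powr_const_def integral_Re[OF int, symmetric] Re ..
  have "ennreal pi = ennreal (pi / 2) + ennreal (pi / 2)" by (simp flip: ennreal_plus)
  also have "\<dots> \<le> (\<integral>\<^sup>+\<xi>. ennreal (f \<xi>) * indicator {0..} \<xi> \<partial>lborel) + (\<integral>\<^sup>+\<xi>. ennreal (f \<xi>) * indicator {0..} \<xi> \<partial>lborel)"
    unfolding f_def by (intro add_mono nn_integral_one_minus_cos_powr_ge p)
  also have "(\<integral>\<^sup>+\<xi>. ennreal (f \<xi>) * indicator {0..} \<xi> \<partial>lborel) + (\<integral>\<^sup>+\<xi>. ennreal (f \<xi>) * indicator {0..} \<xi> \<partial>lborel)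
     = (\<integral>\<^sup>+\<xi>. ennreal (f \<xi>) * indicator {0..} \<xi> \<partial>lborel) + (\<integral>\<^sup>+\<xi>. ennreal (f \<xi>) * indicator {0..} (- \<xi>) \<partial>lborel)"
    by (subst (2) nn_integral_real_affine[of _ "-1" 0]) (simp_all add: f_even)
  also have "\<dots> = (\<integral>\<^sup>+\<xi>. ennreal (f \<xi>) * indicator {0..} \<xi> + ennreal (f \<xi>) * indicator {0..} (- \<xi>) \<partial>lborel)"
    by (rule nn_integral_add[symmetric]) measurable
  also have "\<dots> \<le> (\<integral>\<^sup>+\<xi>. ennreal (f \<xi>) \<partial>lborel)"
    by (intro nn_integral_mono) (auto simp: indicator_def f_def)
  also have "\<dots> = ennreal (\<integral>\<xi>. f \<xi> \<partial>lborel)"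
    by (rule nn_integral_eq_integral[OF fi]) (simp add: f0)
  finally have "ennreal pi \<le> ennreal (\<integral>\<xi>. f \<xi> \<partial>lborel)" .
  then have "pi \<le> (\<integral>\<xi>. f \<xi> \<partial>lborel)"
    by (subst (asm) ennreal_le_iff) (auto intro!: integral_nonneg_AE simp: f0)
  also have "\<dots> \<le> norm (powr_const p)" unfolding Rf[symmetric] by (rule complex_Re_le_cmod)
  finally show ?thesis .
qed

section \<open>Smoothing of powers\<close>

text \<open>Dividing by \<open>a + b\<close> reduces this to \<open>t \<le> t powr p\<close> on the
  unit interval.\<close>

lemma powr_add_le:
  fixes a b p :: real
  assumes "a \<ge> 0" "b \<ge> 0" "0 < p" "p \<le> 1"
  shows "(a + b) powr p \<le> a powr p + b powr p"
proof (cases "a + b = 0")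
  case False
  with assms have s: "a + b > 0" by simp
  have le: "t \<le> t powr p" if "0 \<le> t" "t \<le> 1" for t :: real
    using that assms powr_mono'[of p 1 t] by (cases "t = 0") auto
  have "1 = a / (a + b) + b / (a + b)" using s by (simp flip: add_divide_distrib)
  also have "\<dots> \<le> (a / (a + b)) powr p + (b / (a + b)) powr p"
    using s assms by (intro add_mono le) auto
  also have "\<dots> = (a powr p + b powr p) / (a + b) powr p"
    using s assms by (simp add: powr_divide add_divide_distrib)
  finally show ?thesis using s by (simp add: field_simps)
qed (use assms in auto)

lemma abs_powr_diff_le:
  fixes a b p :: real
  assumes "0 < p" "p \<le> 1"
  shows "\<bar>\<bar>a\<bar> powr p - \<bar>b\<bar> powr p\<bar> \<le> \<bar>a - b\<bar> powr p"
proof -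
  have le: "\<bar>a\<bar> powr p \<le> \<bar>b\<bar> powr p + \<bar>a - b\<bar> powr p" for a b :: real
  proof -
    have "\<bar>a\<bar> powr p \<le> (\<bar>b\<bar> + \<bar>a - b\<bar>) powr p"
      using assms by (intro powr_mono2) auto
    also have "\<dots> \<le> \<bar>b\<bar> powr p + \<bar>a - b\<bar> powr p" using assms by (intro powr_add_le) auto
    finally show ?thesis .
  qed
  show ?thesis using le[of a b] le[of b a] by (simp add: abs_minus_commute abs_le_iff)
qed

text \<open>Stated for differences because the smoothed power is not itself a Fourier integral: its
  density behaves like \<open>\<bar>\<xi>\<bar> powr (- 1 - p)\<close> at 0, and only its products
  with positive powers of \<open>\<xi>\<close> are integrable. The explicit quadratic remainder
  gives differentiability and is reused to interpolate the first derivative.\<close>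

lemma fourier_difference_taylor:
  fixes g :: "real \<Rightarrow> complex" and F :: "real \<Rightarrow> complex"
  assumes F: "\<And>x y. F y - F x = (\<integral>\<xi>. (iexp (\<xi> * y) - iexp (\<xi> * x)) * g \<xi> \<partial>lborel)"
    and g[measurable]: "g \<in> borel_measurable borel"
    and i1: "integrable lborel (\<lambda>\<xi>. complex_of_real \<xi> * g \<xi>)"
    and i2: "integrable lborel (\<lambda>\<xi>. complex_of_real \<xi> ^ 2 * g \<xi>)"
  defines "D x \<equiv> \<integral>\<xi>. iexp (\<xi> * x) * (\<i> * complex_of_real \<xi> * g \<xi>) \<partial>lborel"
  shows "norm (F y - F x - complex_of_real (y - x) * D x) \<le> (y - x)\<^sup>2 / 2 * (\<integral>\<xi>. norm (complex_of_real \<xi> ^ 2 * g \<xi>) \<partial>lborel)"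
    and "(F has_vector_derivative D x) (at x)"
proof -
  let ?e = "\<lambda>t. iexp t"
  let ?A = "\<integral>\<xi>. norm (complex_of_real \<xi> ^ 2 * g \<xi>) \<partial>lborel"
  have bound: "norm (F y - F x - complex_of_real (y - x) * D x) \<le> (y - x)\<^sup>2 / 2 * ?A" for x y
  proof -
    have j1: "integrable lborel (\<lambda>\<xi>. (?e (\<xi> * y) - ?e (\<xi> * x)) * g \<xi>)"
    proof (rule Bochner_Integration.integrable_bound)
      show "integrable lborel (\<lambda>\<xi>. complex_of_real \<bar>y - x\<bar> * (complex_of_real \<xi> * g \<xi>))"
        using i1 by simp
      show "AE \<xi> in lborel. norm ((?e (\<xi> * y) - ?e (\<xi> * x)) * g \<xi>) \<le> norm (complex_of_real \<bar>y - x\<bar> * (complex_of_real \<xi> * g \<xi>))"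
      proof (rule AE_I2)
        fix \<xi>
        have "?e (\<xi> * y) - ?e (\<xi> * x) = - (?e (\<xi> * x) * (1 - ?e (\<xi> * (y - x))))"
          by (simp add: algebra_simps flip: exp_add)
        then have "norm (?e (\<xi> * y) - ?e (\<xi> * x)) = norm (1 - ?e (\<xi> * (y - x)))"
          by (simp only: norm_minus_cancel norm_mult norm_iexp mult_1_left)
        also have "\<dots> \<le> \<bar>\<xi> * (y - x)\<bar>" using norm_one_minus_iexp_le[of "\<xi> * (y - x)"] by simp
        finally have "norm (?e (\<xi> * y) - ?e (\<xi> * x)) * norm (g \<xi>) \<le> \<bar>\<xi> * (y - x)\<bar> * norm (g \<xi>)"
          by (rule mult_right_mono) simp
        then show "norm ((?e (\<xi> * y) - ?e (\<xi> * x)) * g \<xi>) \<le> norm (complex_of_real \<bar>y - x\<bar> * (complex_of_real \<xi> * g \<xi>))"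
          by (simp only: norm_mult norm_of_real abs_mult abs_abs) (simp only: ac_simps)
      qed
    qed measurable
    have "integrable lborel (\<lambda>\<xi>. \<i> * (complex_of_real \<xi> * g \<xi>))" using i1 by simp
    from integrable_iexp_mult[OF this, of x]
    have j2: "integrable lborel (\<lambda>\<xi>. complex_of_real (y - x) * (?e (\<xi> * x) * (\<i> * complex_of_real \<xi> * g \<xi>)))"
      by (simp add: mult.assoc)
    have "F y - F x - complex_of_real (y - x) * D x
      = (\<integral>\<xi>. (?e (\<xi> * y) - ?e (\<xi> * x)) * g \<xi> \<partial>lborel)
        - (\<integral>\<xi>. complex_of_real (y - x) * (?e (\<xi> * x) * (\<i> * complex_of_real \<xi> * g \<xi>)) \<partial>lborel)"
      unfolding F D_def by (simp only: integral_mult_right_zero)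
    also have "\<dots> = (\<integral>\<xi>. (?e (\<xi> * y) - ?e (\<xi> * x)) * g \<xi>
        - complex_of_real (y - x) * (?e (\<xi> * x) * (\<i> * complex_of_real \<xi> * g \<xi>)) \<partial>lborel)"
      by (rule Bochner_Integration.integral_diff[symmetric, OF j1 j2])
    also have "norm \<dots> \<le> (\<integral>\<xi>. (y - x)\<^sup>2 / 2 * norm (complex_of_real \<xi> ^ 2 * g \<xi>) \<partial>lborel)"
    proof (rule Bochner_Integration.integral_norm_bound_integral)
      show "integrable lborel (\<lambda>\<xi>. (?e (\<xi> * y) - ?e (\<xi> * x)) * g \<xi>
        - complex_of_real (y - x) * (?e (\<xi> * x) * (\<i> * complex_of_real \<xi> * g \<xi>)))"
        by (rule Bochner_Integration.integrable_diff[OF j1 j2])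
      show "integrable lborel (\<lambda>\<xi>. (y - x)\<^sup>2 / 2 * norm (complex_of_real \<xi> ^ 2 * g \<xi>))"
        using integrable_norm[OF i2] by simp
    next
      fix \<xi> :: real
      define t where "t = \<xi> * (y - x)"
      have ty: "?e (\<xi> * y) = ?e (\<xi> * x) * ?e t"
        unfolding t_def by (simp add: algebra_simps flip: exp_add)
      have "(?e (\<xi> * y) - ?e (\<xi> * x)) * g \<xi> - complex_of_real (y - x) * (?e (\<xi> * x) * (\<i> * complex_of_real \<xi> * g \<xi>))
        = ?e (\<xi> * x) * (?e t - (1 + \<i> * complex_of_real t)) * g \<xi>"
        unfolding ty by (simp add: t_def algebra_simps)
      then have "norm ((?e (\<xi> * y) - ?e (\<xi> * x)) * g \<xi> - complex_of_real (y - x) * (?e (\<xi> * x) * (\<i> * complex_of_real \<xi> * g \<xi>)))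
        = norm (?e t - (1 + \<i> * complex_of_real t)) * norm (g \<xi>)"
        by (simp only: norm_mult norm_iexp mult_1_left)
      also have "\<dots> \<le> \<bar>t\<bar>\<^sup>2 / 2 * norm (g \<xi>)"
        using iexp_approx1[of t 1] by (intro mult_right_mono) (simp_all add: numeral_2_eq_2)
      also have "\<dots> = (y - x)\<^sup>2 / 2 * norm (complex_of_real \<xi> ^ 2 * g \<xi>)"
        by (simp add: t_def norm_mult norm_power power_mult_distrib)
      finally show "norm ((?e (\<xi> * y) - ?e (\<xi> * x)) * g \<xi> - complex_of_real (y - x) * (?e (\<xi> * x) * (\<i> * complex_of_real \<xi> * g \<xi>)))
         \<le> (y - x)\<^sup>2 / 2 * norm (complex_of_real \<xi> ^ 2 * g \<xi>)" .
    qed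
    also have "\<dots> = (y - x)\<^sup>2 / 2 * ?A" by (rule integral_mult_right_zero)
    finally show ?thesis .
  qed
  show "norm (F y - F x - complex_of_real (y - x) * D x) \<le> (y - x)\<^sup>2 / 2 * ?A" by (rule bound)
  have "(\<lambda>y. norm (F y - F x - (y - x) *\<^sub>R D x) / norm (y - x)) \<midarrow>x\<rightarrow> 0"
  proof (rule Lim_null_comparison)
    show "eventually (\<lambda>y. norm (norm (F y - F x - (y - x) *\<^sub>R D x) / norm (y - x)) \<le> norm (y - x) / 2 * ?A) (at x)"
    proof (rule eventually_at_topological[THEN iffD2], intro exI[of _ UNIV] conjI ballI impI)
      fix y assume "y \<noteq> x"
      then have pos: "norm (y - x) > 0" by simp
      have "norm (F y - F x - (y - x) *\<^sub>R D x) \<le> (norm (y - x) / 2 * ?A) * norm (y - x)"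
        using bound[of y x] by (simp add: scaleR_conv_of_real power2_eq_square ac_simps)
      then have "norm (F y - F x - (y - x) *\<^sub>R D x) / norm (y - x) \<le> norm (y - x) / 2 * ?A"
        by (subst pos_divide_le_eq[OF pos])
      then show "norm (norm (F y - F x - (y - x) *\<^sub>R D x) / norm (y - x)) \<le> norm (y - x) / 2 * ?A"
        by simp
    qed simp_all
    have "((\<lambda>y. norm (y - x) / 2 * ?A) \<longlongrightarrow> norm (x - x) / 2 * ?A) (at x)" by (intro tendsto_intros) simp
    then show "((\<lambda>y. norm (y - x) / 2 * ?A) \<longlongrightarrow> 0) (at x)" by simp
  qed
  then show "(F has_vector_derivative D x) (at x)"
    unfolding has_vector_derivative_def has_derivative_iff_norm by (simp add: bounded_linear_scaleR_left)
qed

section \<open>The smoothed power function and its derivatives\<close>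

locale kernel_smoothing =
  fixes Q :: "real \<Rightarrow> complex" and p h C :: real
  assumes Q: "twice_cont_diff Q"
    and Q_0: "Q 0 = complex_of_real (1 / sqrt (2 * pi))"
    and Q_supp: "closure {z. Q z \<noteq> 0} = {-1..1}"
    and Q_L1: "L1_norm Q \<le> C / sqrt (2 / pi)"
    and Q_L2: "L2_norm Q \<le> C / sqrt (2 * pi)" "L2_norm (nth_vderiv 2 Q) \<le> C / sqrt (2 * pi)"
    and p: "0 < p" "p < 1"
    and h: "h > 0"
begin

abbreviation "K \<equiv> inv_fourier Q"

definition fh :: "real \<Rightarrow> complex" where
  "fh = kernel_smooth K h (\<lambda>t. \<bar>t\<bar> powr p)"

lemma Q_outside: "\<bar>x\<bar> > 1 \<Longrightarrow> Q x = 0"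
  by (rule support_closureD[OF Q_supp])

lemma continuous_Q: "continuous_on UNIV Q"
  by (rule twice_cont_diffD(3)[OF Q])

lemma integrable_Q: "integrable lborel Q"
  by (rule continuous_bounded_support(1)[OF continuous_Q Q_outside])

lemma borel_Q [measurable]: "Q \<in> borel_measurable borel"
  using integrable_Q by auto

lemma bounded_Q: "\<exists>B. \<forall>x. norm (Q x) \<le> B"
  by (rule continuous_bounded_support(3)[OF continuous_Q Q_outside])

lemma isCont_Q: "isCont Q t"
  using continuous_Q by (simp add: continuous_on_eq_continuous_at)

text \<open>A nonpositive \<open>C\<close> would make the transform of \<open>Q\<close> vanish, and
  inversion at 0 would then contradict the prescribed value of \<open>Q 0\<close>.\<close>

lemma C_pos: "C > 0"
proof (rule ccontr)
  assume "\<not> C > 0"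
  then have "C / sqrt (2 / pi) \<le> 0" by (simp add: divide_nonpos_pos)
  then have "L1_norm Q \<le> 0" using Q_L1 by linarith
  then have "norm (fourier_int Q u) \<le> 0" for u
    using norm_fourier_int_le[OF integrable_Q, of u] unfolding L1_norm_def by linarith
  then have F: "fourier_int Q = (\<lambda>u. 0)" by auto
  obtain B where "\<And>x. norm (Q x) \<le> B" using bounded_Q by blast
  from fourier_int_inversion[OF integrable_Q _ isCont_Q this, of 0]
  have "Q 0 = 0" unfolding F by simp
  then show False using Q_0 by simp
qed

lemma K_fourier: "K u = complex_of_real (1 / sqrt (2 * pi)) * fourier_int Q u"
  unfolding inv_fourier_def fourier_int_def ..

lemma borel_K [measurable]: "K \<in> borel_measurable borel"
  unfolding K_fourier by measurable

lemma K_L1: "integrable lborel K" "(\<integral>u. norm (K u) \<partial>lborel) \<le> C"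
  using kernel_weighted_L1[OF Q Q_outside Q_L2 C_pos, of 0 "\<lambda>u. 1"] by simp_all

text \<open>The weight is admissible with \<open>q = p\<close>, because its square is
  \<open>(u\<^sup>2) powr p\<close>.\<close>

lemma K_powr:
  "integrable lborel (\<lambda>u. complex_of_real (\<bar>u\<bar> powr p) * K u)" "(\<integral>u. \<bar>u\<bar> powr p * norm (K u) \<partial>lborel) \<le> C"
proof -
  have "(\<bar>u\<bar> powr p)\<^sup>2 \<le> (1 - p) + p * u\<^sup>2" for u :: real
  proof -
    have "(\<bar>u\<bar> powr p)\<^sup>2 = (u\<^sup>2) powr p"
      by (simp add: power2_eq_square powr_mult[symmetric])
    also have "\<dots> \<le> (1 - p) + p * u\<^sup>2" using p by (intro powr_le_affine) auto
    finally show ?thesis .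
  qed
  from kernel_weighted_L1[OF Q Q_outside Q_L2 C_pos _ _ _ this]
  show "integrable lborel (\<lambda>u. complex_of_real (\<bar>u\<bar> powr p) * K u)" "(\<integral>u. \<bar>u\<bar> powr p * norm (K u) \<partial>lborel) \<le> C"
    using p by simp_all
qed

text \<open>Inversion asks for an integrable transform, which is \<open>K_L1\<close>. At
  \<open>t = 0\<close> the normalization of \<open>Q\<close> becomes total mass 1 of the
  kernel.\<close>

lemma K_inversion: "(\<integral>u. K u * iexp (u * (- t)) \<partial>lborel) = complex_of_real (sqrt (2 * pi)) * Q t"
proof -
  have s: "complex_of_real (sqrt (2 * pi)) * complex_of_real (sqrt (2 * pi)) = complex_of_real (2 * pi)"
    unfolding of_real_mult[symmetric] by simp
  have "fourier_int Q = (\<lambda>u. complex_of_real (sqrt (2 * pi)) * K u)"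
    unfolding K_fourier by (simp add: fun_eq_iff)
  then have F: "integrable lborel (fourier_int Q)" using K_L1(1) by simp
  obtain B where "\<And>x. norm (Q x) \<le> B" using bounded_Q by blast
  from fourier_int_inversion[OF integrable_Q F isCont_Q this, of t]
  have "(\<integral>u. K u * iexp (u * (- t)) \<partial>lborel) = complex_of_real (1 / sqrt (2 * pi)) * (complex_of_real (2 * pi) * Q t)"
    unfolding K_fourier mult.assoc integral_mult_right_zero by simp
  then show ?thesis unfolding s[symmetric] by simp
qed

lemma integral_K: "(\<integral>u. K u \<partial>lborel) = 1"
  using K_inversion[of 0] unfolding Q_0 by simp

lemma fh_shift: "fh x = (\<integral>u. complex_of_real (\<bar>x - h * u\<bar> powr p) * K u \<partial>lborel)"
proof -
  have "fh x = \<bar>- h\<bar> *\<^sub>R (\<integral>u. complex_of_real (1 / h) * K ((x - (x + (- h) * u)) / h) * complex_of_real (\<bar>x + (- h) * u\<bar> powr p) \<partial>lborel)"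
    unfolding fh_def kernel_smooth_def using h by (intro lborel_integral_real_affine) simp
  also have "\<dots> = (\<integral>u. complex_of_real \<bar>- h\<bar> * (complex_of_real (1 / h) * K ((x - (x + (- h) * u)) / h) * complex_of_real (\<bar>x + (- h) * u\<bar> powr p)) \<partial>lborel)"
    by (simp only: scaleR_conv_of_real integral_mult_right_zero)
  also have "\<dots> = (\<integral>u. complex_of_real (\<bar>x - h * u\<bar> powr p) * K u \<partial>lborel)"
    using h by (intro Bochner_Integration.integral_cong refl) simp
  finally show ?thesis .
qed

lemma integrable_shift: "integrable lborel (\<lambda>u. complex_of_real (\<bar>x - h * u\<bar> powr p) * K u)"
proof (rule Bochner_Integration.integrable_bound)
  show "integrable lborel (\<lambda>u. \<bar>x\<bar> powr p * norm (K u) + h powr p * norm (complex_of_real (\<bar>u\<bar> powr p) * K u))"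
    by (intro Bochner_Integration.integrable_add integrable_mult_right integrable_norm K_L1 K_powr)
  show "AE u in lborel. norm (complex_of_real (\<bar>x - h * u\<bar> powr p) * K u)
     \<le> norm (\<bar>x\<bar> powr p * norm (K u) + h powr p * norm (complex_of_real (\<bar>u\<bar> powr p) * K u))"
  proof (rule AE_I2)
    fix u
    have "\<bar>x - h * u\<bar> powr p \<le> (\<bar>x\<bar> + \<bar>h * u\<bar>) powr p"
      using p by (intro powr_mono2) auto
    also have "\<dots> \<le> \<bar>x\<bar> powr p + \<bar>h * u\<bar> powr p" using p by (intro powr_add_le) auto
    also have "\<bar>h * u\<bar> powr p = h powr p * \<bar>u\<bar> powr p" using h by (simp add: abs_mult powr_mult)
    finally have "\<bar>x - h * u\<bar> powr p * norm (K u) \<le> (\<bar>x\<bar> powr p + h powr p * \<bar>u\<bar> powr p) * norm (K u)"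
      by (rule mult_right_mono) simp
    then show "norm (complex_of_real (\<bar>x - h * u\<bar> powr p) * K u)
     \<le> norm (\<bar>x\<bar> powr p * norm (K u) + h powr p * norm (complex_of_real (\<bar>u\<bar> powr p) * K u))"
      by (simp add: norm_mult algebra_simps)
  qed
qed measurable

text \<open>As the kernel has mass 1, the bias is a weighted average of increments of the power
  function, each at most \<open>h powr p * \<bar>u\<bar> powr p\<close>. The weighted norm of the
  kernel then gives \<open>C\<close> without loss.\<close>

lemma fh_bias: "norm (fh x - complex_of_real (\<bar>x\<bar> powr p)) \<le> C * h powr p"
proof -
  have i: "integrable lborel (\<lambda>u. complex_of_real (\<bar>x\<bar> powr p) * K u)" using K_L1(1) by simp
  have "fh x - complex_of_real (\<bar>x\<bar> powr p)
      = (\<integral>u. complex_of_real (\<bar>x - h * u\<bar> powr p) * K u \<partial>lborel) - (\<integral>u. complex_of_real (\<bar>x\<bar> powr p) * K u \<partial>lborel)"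
    unfolding fh_shift integral_mult_right_zero integral_K by simp
  also have "\<dots> = (\<integral>u. complex_of_real (\<bar>x - h * u\<bar> powr p) * K u - complex_of_real (\<bar>x\<bar> powr p) * K u \<partial>lborel)"
    by (rule Bochner_Integration.integral_diff[symmetric, OF integrable_shift i])
  also have "norm \<dots> \<le> (\<integral>u. h powr p * (\<bar>u\<bar> powr p * norm (K u)) \<partial>lborel)"
  proof (rule Bochner_Integration.integral_norm_bound_integral)
    show "integrable lborel (\<lambda>u. complex_of_real (\<bar>x - h * u\<bar> powr p) * K u - complex_of_real (\<bar>x\<bar> powr p) * K u)"
      by (rule Bochner_Integration.integrable_diff[OF integrable_shift i])
    show "integrable lborel (\<lambda>u. h powr p * (\<bar>u\<bar> powr p * norm (K u)))"
      using integrable_norm[OF K_powr(1)] by (simp add: norm_mult)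
  next
    fix u
    have "\<bar>\<bar>x - h * u\<bar> powr p - \<bar>x\<bar> powr p\<bar> \<le> \<bar>x - h * u - x\<bar> powr p"
      using p by (intro abs_powr_diff_le) auto
    also have "\<dots> = h powr p * \<bar>u\<bar> powr p" using h by (simp add: abs_mult powr_mult)
    finally have "\<bar>\<bar>x - h * u\<bar> powr p - \<bar>x\<bar> powr p\<bar> * norm (K u) \<le> h powr p * \<bar>u\<bar> powr p * norm (K u)"
      by (rule mult_right_mono) simp
    then show "norm (complex_of_real (\<bar>x - h * u\<bar> powr p) * K u - complex_of_real (\<bar>x\<bar> powr p) * K u) \<le> h powr p * (\<bar>u\<bar> powr p * norm (K u))"
      by (simp only: left_diff_distrib[symmetric] of_real_diff[symmetric] norm_mult norm_of_real mult.assoc)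
  qed
  also have "\<dots> = h powr p * (\<integral>u. \<bar>u\<bar> powr p * norm (K u) \<partial>lborel)" by (rule integral_mult_right_zero)
  also have "\<dots> \<le> h powr p * C" by (rule mult_left_mono[OF K_powr(2)]) simp
  finally show ?thesis by (simp add: mult.commute)
qed

text \<open>The increment falls on the power function, so no derivative of the kernel enters. This
  feeds the interpolation bound for the first derivative.\<close>

lemma fh_increment: "norm (fh (x + h) - fh x) \<le> C * h powr p"
proof -
  have "fh (x + h) - fh x = (\<integral>u. complex_of_real (\<bar>x + h - h * u\<bar> powr p) * K u - complex_of_real (\<bar>x - h * u\<bar> powr p) * K u \<partial>lborel)"
    unfolding fh_shift by (rule Bochner_Integration.integral_diff[symmetric, OF integrable_shift integrable_shift])
  also have "norm \<dots> \<le> (\<integral>u. h powr p * norm (K u) \<partial>lborel)"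
  proof (rule Bochner_Integration.integral_norm_bound_integral)
    show "integrable lborel (\<lambda>u. complex_of_real (\<bar>x + h - h * u\<bar> powr p) * K u - complex_of_real (\<bar>x - h * u\<bar> powr p) * K u)"
      by (rule Bochner_Integration.integrable_diff[OF integrable_shift integrable_shift])
    show "integrable lborel (\<lambda>u. h powr p * norm (K u))"
      using integrable_norm[OF K_L1(1)] by simp
  next
    fix u
    have "\<bar>\<bar>x + h - h * u\<bar> powr p - \<bar>x - h * u\<bar> powr p\<bar> \<le> \<bar>x + h - h * u - (x - h * u)\<bar> powr p"
      using p by (intro abs_powr_diff_le) auto
    also have "\<dots> = h powr p" using h by simp
    finally have "\<bar>\<bar>x + h - h * u\<bar> powr p - \<bar>x - h * u\<bar> powr p\<bar> * norm (K u) \<le> h powr p * norm (K u)"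
      by (rule mult_right_mono) simp
    then show "norm (complex_of_real (\<bar>x + h - h * u\<bar> powr p) * K u - complex_of_real (\<bar>x - h * u\<bar> powr p) * K u) \<le> h powr p * norm (K u)"
      by (simp only: left_diff_distrib[symmetric] of_real_diff[symmetric] norm_mult norm_of_real mult.assoc)
  qed
  also have "\<dots> = h powr p * (\<integral>u. norm (K u) \<partial>lborel)" by (rule integral_mult_right_zero)
  also have "\<dots> \<le> h powr p * C" by (rule mult_left_mono[OF K_L1(2)]) simp
  finally show ?thesis by (simp add: mult.commute)
qed

text \<open>The Fourier density of the k-th derivative: smoothing multiplies the density of the
  power function by \<open>sqrt (2 * pi) * Q (h * \<xi>)\<close>, each differentiation by
  \<open>\<i> * \<xi>\<close>. The minus sign comes from the exponential being subtracted in
  \<open>powr_fourier_repr\<close>.\<close>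

definition spectrum :: "nat \<Rightarrow> real \<Rightarrow> complex" where
  "spectrum k \<xi> = - (1 / powr_const p) * (\<i> * complex_of_real \<xi>) ^ k
     * (complex_of_real (\<bar>\<xi>\<bar> powr (- 1 - p)) * (complex_of_real (sqrt (2 * pi)) * Q (h * \<xi>)))"

lemma borel_spectrum [measurable]: "spectrum k \<in> borel_measurable borel"
  unfolding spectrum_def by measurable

lemma spectrum_Suc: "spectrum (Suc k) \<xi> = \<i> * complex_of_real \<xi> * spectrum k \<xi>"
  unfolding spectrum_def by simp

lemma powr_const_nz: "powr_const p \<noteq> 0"
proof
  assume "powr_const p = 0"
  then have "pi \<le> 0" using norm_powr_const_ge[OF p] by simp
  then show False using pi_gt_zero by linarith
qed

lemma norm_spectrum:
  "norm (spectrum k \<xi>) = 1 / norm (powr_const p) * sqrt (2 * pi) * (\<bar>\<xi>\<bar> ^ k * \<bar>\<xi>\<bar> powr (- 1 - p) * norm (Q (h * \<xi>)))"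
  unfolding spectrum_def by (simp add: norm_mult norm_divide norm_power)

text \<open>A difference cancels the constant 1 in the representation of the power and leaves
  \<open>D\<close>, which is integrable at 0 and at infinity. Fubini against \<open>K\<close> then
  applies, and the inner integral is \<open>K_inversion\<close> at \<open>h * \<xi>\<close>.\<close>

lemma fh_diff:
  "fh y - fh x = (\<integral>\<xi>. (iexp (\<xi> * y) - iexp (\<xi> * x)) * spectrum 0 \<xi> \<partial>lborel)"
proof -
  let ?e = "\<lambda>t. iexp t"
  let ?w = "\<lambda>\<xi>. complex_of_real (\<bar>\<xi>\<bar> powr (- 1 - p))"
  define D where "D \<xi> = (?e (\<xi> * y) - ?e (\<xi> * x)) * ?w \<xi>" for \<xi>
  have [measurable]: "D \<in> borel_measurable borel" unfolding D_def by measurable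
  have iD: "integrable lborel D"
  proof -
    have "integrable lborel (\<lambda>\<xi>. (1 - ?e (\<xi> * x)) * ?w \<xi> - (1 - ?e (\<xi> * y)) * ?w \<xi>)"
      by (intro Bochner_Integration.integrable_diff integrable_one_minus_iexp_powr p)
    also have "(\<lambda>\<xi>. (1 - ?e (\<xi> * x)) * ?w \<xi> - (1 - ?e (\<xi> * y)) * ?w \<xi>) = D"
      unfolding D_def by (simp add: fun_eq_iff algebra_simps)
    finally show ?thesis .
  qed
  have "integrable (lborel \<Otimes>\<^sub>M lborel) (\<lambda>(u, \<xi>). K u * D \<xi>)"
  proof (rule lborel_pair.Fubini_integrable)
    show "integrable lborel (\<lambda>u. \<integral>\<xi>. norm (case (u, \<xi>) of (u, \<xi>) \<Rightarrow> K u * D \<xi>) \<partial>lborel)"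
      using integrable_norm[OF K_L1(1)] by (simp add: norm_mult)
    show "AE u in lborel. integrable lborel (\<lambda>\<xi>. case (u, \<xi>) of (u, \<xi>) \<Rightarrow> K u * D \<xi>)"
      using iD by simp
  qed measurable
  then have iP: "integrable (lborel \<Otimes>\<^sub>M lborel) (\<lambda>(u, \<xi>). K u * (?e (- (\<xi> * (h * u))) * D \<xi>))"
    by (rule Bochner_Integration.integrable_bound) (auto simp: norm_mult simp del: of_real_mult of_real_minus)
  have pd: "complex_of_real (\<bar>y - h * u\<bar> powr p) * powr_const p - complex_of_real (\<bar>x - h * u\<bar> powr p) * powr_const p
      = - (\<integral>\<xi>. ?e (- (\<xi> * (h * u))) * D \<xi> \<partial>lborel)" for u
  proof -
    have "complex_of_real (\<bar>y - h * u\<bar> powr p) * powr_const p - complex_of_real (\<bar>x - h * u\<bar> powr p) * powr_const p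
      = (\<integral>\<xi>. (1 - ?e (\<xi> * (y - h * u))) * ?w \<xi> - (1 - ?e (\<xi> * (x - h * u))) * ?w \<xi> \<partial>lborel)"
      unfolding powr_fourier_repr[symmetric]
      by (rule Bochner_Integration.integral_diff[symmetric]) (intro integrable_one_minus_iexp_powr p)+
    also have "\<dots> = (\<integral>\<xi>. - (?e (- (\<xi> * (h * u))) * D \<xi>) \<partial>lborel)"
      unfolding D_def by (intro Bochner_Integration.integral_cong refl) (simp add: algebra_simps flip: exp_add)
    finally show ?thesis by (simp only: Bochner_Integration.integral_minus)
  qed
  have "powr_const p * (fh y - fh x)
     = powr_const p * (\<integral>u. complex_of_real (\<bar>y - h * u\<bar> powr p) * K u - complex_of_real (\<bar>x - h * u\<bar> powr p) * K u \<partial>lborel)"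
    unfolding fh_shift by (simp only: Bochner_Integration.integral_diff[OF integrable_shift integrable_shift])
  also have "\<dots> = (\<integral>u. powr_const p * (complex_of_real (\<bar>y - h * u\<bar> powr p) * K u - complex_of_real (\<bar>x - h * u\<bar> powr p) * K u) \<partial>lborel)"
    by (rule integral_mult_right_zero[symmetric])
  also have "\<dots> = (\<integral>u. - (\<integral>\<xi>. K u * (?e (- (\<xi> * (h * u))) * D \<xi>) \<partial>lborel) \<partial>lborel)"
  proof (intro Bochner_Integration.integral_cong refl)
    fix u
    have "powr_const p * (complex_of_real (\<bar>y - h * u\<bar> powr p) * K u - complex_of_real (\<bar>x - h * u\<bar> powr p) * K u)
       = K u * (complex_of_real (\<bar>y - h * u\<bar> powr p) * powr_const p - complex_of_real (\<bar>x - h * u\<bar> powr p) * powr_const p)"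
      by (simp add: algebra_simps)
    also have "\<dots> = - (K u * (\<integral>\<xi>. ?e (- (\<xi> * (h * u))) * D \<xi> \<partial>lborel))" unfolding pd by simp
    finally show "powr_const p * (complex_of_real (\<bar>y - h * u\<bar> powr p) * K u - complex_of_real (\<bar>x - h * u\<bar> powr p) * K u)
       = - (\<integral>\<xi>. K u * (?e (- (\<xi> * (h * u))) * D \<xi>) \<partial>lborel)"
      by (simp only: integral_mult_right_zero)
  qed
  also have "\<dots> = - (\<integral>u. (\<integral>\<xi>. K u * (?e (- (\<xi> * (h * u))) * D \<xi>) \<partial>lborel) \<partial>lborel)"
    by (rule Bochner_Integration.integral_minus)
  also have "(\<integral>u. (\<integral>\<xi>. K u * (?e (- (\<xi> * (h * u))) * D \<xi>) \<partial>lborel) \<partial>lborel)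
     = (\<integral>\<xi>. (\<integral>u. K u * (?e (- (\<xi> * (h * u))) * D \<xi>) \<partial>lborel) \<partial>lborel)"
    using lborel_pair.Fubini_integral[OF iP] by simp
  also have "\<dots> = (\<integral>\<xi>. D \<xi> * (complex_of_real (sqrt (2 * pi)) * Q (h * \<xi>)) \<partial>lborel)"
  proof (intro Bochner_Integration.integral_cong refl)
    fix \<xi>
    have "(\<integral>u. K u * (?e (- (\<xi> * (h * u))) * D \<xi>) \<partial>lborel) = (\<integral>u. D \<xi> * (K u * ?e (u * (- (h * \<xi>)))) \<partial>lborel)"
      by (intro Bochner_Integration.integral_cong refl) (simp add: ac_simps)
    also have "\<dots> = D \<xi> * (\<integral>u. K u * ?e (u * (- (h * \<xi>))) \<partial>lborel)" by (rule integral_mult_right_zero)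
    finally show "(\<integral>u. K u * (?e (- (\<xi> * (h * u))) * D \<xi>) \<partial>lborel) = D \<xi> * (complex_of_real (sqrt (2 * pi)) * Q (h * \<xi>))"
      unfolding K_inversion .
  qed
  finally have "powr_const p * (fh y - fh x) = - (\<integral>\<xi>. D \<xi> * (complex_of_real (sqrt (2 * pi)) * Q (h * \<xi>)) \<partial>lborel)" .
  then have "fh y - fh x = - (1 / powr_const p) * (\<integral>\<xi>. D \<xi> * (complex_of_real (sqrt (2 * pi)) * Q (h * \<xi>)) \<partial>lborel)"
    using powr_const_nz by (simp add: field_simps)
  also have "\<dots> = (\<integral>\<xi>. - (1 / powr_const p) * (D \<xi> * (complex_of_real (sqrt (2 * pi)) * Q (h * \<xi>))) \<partial>lborel)"
    by (rule integral_mult_right_zero[symmetric])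
  also have "\<dots> = (\<integral>\<xi>. (?e (\<xi> * y) - ?e (\<xi> * x)) * spectrum 0 \<xi> \<partial>lborel)"
    unfolding D_def spectrum_def by (intro Bochner_Integration.integral_cong refl) (simp only: power_0 mult_1_right mult_1_left ac_simps)
  finally show ?thesis .
qed

lemma integrable_spectrum_1: "integrable lborel (spectrum 1)"
proof -
  obtain B where B: "\<And>x. norm (Q x) \<le> B" using bounded_Q by blast
  have B0: "B \<ge> 0" using B[of 0] norm_ge_zero order_trans by blast
  define c where "c = 1 / norm (powr_const p) * sqrt (2 * pi)"
  have c: "c \<ge> 0" unfolding c_def by simp
  show ?thesis
  proof (rule Bochner_Integration.integrable_bound)
    \<comment> \<open>The factor \<open>1 + 1 / h\<close> covers two ranges: 1 suffices where
      \<open>\<bar>\<xi>\<bar> < 1\<close>, and on the rest of the support of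
      \<open>Q (h * \<xi>)\<close> the additional power of \<open>\<bar>\<xi>\<bar>\<close> is at
      most \<open>1 / h\<close>.\<close>
    show "integrable lborel (\<lambda>\<xi>. c * ((1 + 1 / h) * powr_majorant p \<xi> * B))"
      using integrable_powr_majorant[OF p] by simp
    show "AE \<xi> in lborel. norm (spectrum 1 \<xi>) \<le> norm (c * ((1 + 1 / h) * powr_majorant p \<xi> * B))"
    proof (rule AE_I2)
      fix \<xi>
      have m: "0 \<le> (1 + 1 / h) * powr_majorant p \<xi>" using h powr_majorant_nonneg[of p \<xi>] by simp
      have "\<bar>\<xi>\<bar> ^ 1 * \<bar>\<xi>\<bar> powr (- 1 - p) * norm (Q (h * \<xi>)) \<le> (1 + 1 / h) * powr_majorant p \<xi> * B"
      proof (cases "\<bar>h * \<xi>\<bar> > 1")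
        case True
        then show ?thesis using Q_outside[OF True] m B0 by simp
      next
        case False
        then have le: "\<bar>\<xi>\<bar> \<le> 1 / h" using h by (simp add: abs_mult field_simps)
        have "\<bar>\<xi>\<bar> * \<bar>\<xi>\<bar> powr (- 1 - p) \<le> (1 + 1 / h) * powr_majorant p \<xi>"
        proof (cases "\<bar>\<xi>\<bar> < 1")
          case True
          have "\<bar>\<xi>\<bar> * \<bar>\<xi>\<bar> powr (- 1 - p) = 1 * \<bar>\<xi>\<bar> powr (- p)"
            by (cases "\<xi> = 0") (simp_all add: powr_diff powr_minus field_simps)
          also have "\<dots> \<le> (1 + 1 / h) * \<bar>\<xi>\<bar> powr (- p)" using h by (intro mult_right_mono) simp_all
          finally show ?thesis using True by (simp add: powr_majorant_def)
        next
          case False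
          have "\<bar>\<xi>\<bar> * \<bar>\<xi>\<bar> powr (- 1 - p) \<le> (1 + 1 / h) * \<bar>\<xi>\<bar> powr (- 1 - p)"
            using le by (intro mult_right_mono) simp_all
          then show ?thesis using False by (simp add: powr_majorant_def)
        qed
        then have "\<bar>\<xi>\<bar> * \<bar>\<xi>\<bar> powr (- 1 - p) * norm (Q (h * \<xi>)) \<le> (1 + 1 / h) * powr_majorant p \<xi> * B"
          by (rule mult_mono[OF _ B m]) simp
        then show ?thesis by simp
      qed
      then have "c * (\<bar>\<xi>\<bar> ^ 1 * \<bar>\<xi>\<bar> powr (- 1 - p) * norm (Q (h * \<xi>))) \<le> c * ((1 + 1 / h) * powr_majorant p \<xi> * B)"
        using c by (rule mult_left_mono)
      then show "norm (spectrum 1 \<xi>) \<le> norm (c * ((1 + 1 / h) * powr_majorant p \<xi> * B))"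
        unfolding norm_spectrum c_def[symmetric] real_norm_def by linarith
    qed
  qed simp
qed

text \<open>Band limitation: the density lives on \<open>\<bar>\<xi>\<bar> \<le> 1 / h\<close>, so
  every further derivative costs at most one factor \<open>1 / h\<close>.\<close>

lemma norm_spectrum_le:
  "norm (spectrum (Suc k) \<xi>) \<le> (1 / h) ^ k * norm (spectrum 1 \<xi>)"
proof (cases "\<bar>h * \<xi>\<bar> > 1")
  case True
  then show ?thesis using Q_outside[OF True] by (simp add: norm_spectrum)
next
  case False
  then have "\<bar>\<xi>\<bar> \<le> 1 / h" using h by (simp add: abs_mult field_simps)
  then have "\<bar>\<xi>\<bar> ^ k \<le> (1 / h) ^ k" by (intro power_mono) simp_all
  then have "\<bar>\<xi>\<bar> ^ k * norm (spectrum 1 \<xi>) \<le> (1 / h) ^ k * norm (spectrum 1 \<xi>)"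
    by (rule mult_right_mono) simp
  moreover have "norm (spectrum (Suc k) \<xi>) = \<bar>\<xi>\<bar> ^ k * norm (spectrum 1 \<xi>)"
    unfolding norm_spectrum by simp
  ultimately show ?thesis by simp
qed

lemma integrable_spectrum:
  assumes "k \<ge> 1"
  shows "integrable lborel (spectrum k)"
proof -
  obtain j where k: "k = Suc j" using assms by (cases k) auto
  show ?thesis
  proof (rule Bochner_Integration.integrable_bound)
    show "integrable lborel (\<lambda>\<xi>. complex_of_real ((1 / h) ^ j) * spectrum 1 \<xi>)"
      using integrable_spectrum_1 by simp
    show "AE \<xi> in lborel. norm (spectrum k \<xi>) \<le> norm (complex_of_real ((1 / h) ^ j) * spectrum 1 \<xi>)"
      using norm_spectrum_le[of j] h unfolding k by (simp add: norm_mult norm_divide norm_power)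
  qed simp
qed

text \<open>For \<open>k \<ge> 2\<close> the exponent \<open>k - 1 - p\<close> is positive, so the
  power of \<open>\<bar>\<xi>\<bar>\<close> is largest at the band edge \<open>1 / h\<close>. What
  remains is the rescaled L1 norm of \<open>Q\<close>.\<close>

lemma spectrum_L1:
  assumes k: "k \<ge> 2"
  shows "(\<integral>\<xi>. norm (spectrum k \<xi>) \<partial>lborel) \<le> C * h powr p / h ^ k"
proof -
  define a where "a = h powr p * (h / h ^ k)"
  have a: "a \<ge> 0" unfolding a_def using h by simp
  have pw: "\<bar>\<xi>\<bar> ^ k * \<bar>\<xi>\<bar> powr (- 1 - p) * norm (Q (h * \<xi>)) \<le> a * norm (Q (h * \<xi>))" for \<xi>
  proof (cases "\<bar>h * \<xi>\<bar> > 1")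
    case True
    then show ?thesis using Q_outside[OF True] by simp
  next
    case False
    show ?thesis
    proof (cases "\<xi> = 0")
      case True
      then show ?thesis using a by simp
    next
      case nz: False
      have "\<bar>\<xi>\<bar> ^ k * \<bar>\<xi>\<bar> powr (- 1 - p) = \<bar>\<xi>\<bar> powr (real k + (- 1 - p))"
        using nz by (simp add: powr_realpow[symmetric] powr_add[symmetric])
      also have "\<dots> = \<bar>\<xi>\<bar> powr (real k - 1 - p)"
      proof -
        have e: "real k + (- 1 - p) = real k - 1 - p" by simp
        show ?thesis unfolding e ..
      qed
      also have "\<dots> \<le> (1 / h) powr (real k - 1 - p)"
        using False h p k by (intro powr_mono2) (auto simp: abs_mult field_simps)
      also have "\<dots> = a"
      proof -
        have "1 / h = h powr (- 1)" using h by (simp add: powr_minus_divide)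
        then have "(1 / h) powr (real k - 1 - p) = h powr (- 1 * (real k - 1 - p))" by (simp only: powr_powr)
        also have "- 1 * (real k - 1 - p) = p + (1 - real k)" by simp
        also have "h powr (p + (1 - real k)) = a"
          unfolding a_def powr_add powr_diff using h by (simp add: powr_realpow)
        finally show ?thesis .
      qed
      finally show ?thesis by (intro mult_right_mono) simp_all
    qed
  qed
  have "integrable lborel (\<lambda>\<xi>. Q (0 + h * \<xi>))" using integrable_Q h by (intro lborel_integrable_real_affine) auto
  then have iQ: "integrable lborel (\<lambda>\<xi>. norm (Q (h * \<xi>)))" by simp
  have "(\<integral>z. norm (Q z) \<partial>lborel) = \<bar>h\<bar> *\<^sub>R (\<integral>\<xi>. norm (Q (0 + h * \<xi>)) \<partial>lborel)"
    using h by (intro lborel_integral_real_affine) simp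
  then have L: "(\<integral>\<xi>. norm (Q (h * \<xi>)) \<partial>lborel) = L1_norm Q / h"
    unfolding L1_norm_def using h by simp
  let ?c = "1 / norm (powr_const p) * sqrt (2 * pi)"
  have "(\<integral>\<xi>. norm (spectrum k \<xi>) \<partial>lborel) \<le> (\<integral>\<xi>. ?c * a * norm (Q (h * \<xi>)) \<partial>lborel)"
  proof (rule integral_mono)
    show "integrable lborel (\<lambda>\<xi>. norm (spectrum k \<xi>))"
      using k by (intro integrable_norm integrable_spectrum) simp
    show "integrable lborel (\<lambda>\<xi>. ?c * a * norm (Q (h * \<xi>)))" using iQ by simp
    fix \<xi>
    have "?c * (\<bar>\<xi>\<bar> ^ k * \<bar>\<xi>\<bar> powr (- 1 - p) * norm (Q (h * \<xi>))) \<le> ?c * (a * norm (Q (h * \<xi>)))"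
      by (rule mult_left_mono[OF pw]) simp
    then show "norm (spectrum k \<xi>) \<le> ?c * a * norm (Q (h * \<xi>))"
      unfolding norm_spectrum by (simp only: mult.assoc)
  qed
  also have "\<dots> = ?c * a * (L1_norm Q / h)" unfolding L[symmetric] by (rule integral_mult_right_zero)
  also have "\<dots> \<le> 1 / pi * sqrt (2 * pi) * a * (C / sqrt (2 / pi) / h)"
    using a h norm_powr_const_ge[OF p] Q_L1
    by (intro mult_mono divide_right_mono divide_left_mono mult_pos_pos) (auto intro!: divide_nonneg_pos simp: L1_norm_def powr_const_nz)
  also have "\<dots> = C * h powr p / h ^ k"
  proof -
    have "sqrt (2 * pi) / sqrt (2 / pi) = pi"
      by (simp add: real_sqrt_divide[symmetric] real_sqrt_mult_self)
    then have "1 / pi * sqrt (2 * pi) * a * (C / sqrt (2 / pi) / h) = a * C / h"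
      by (metis (no_types, lifting) divide_divide_eq_left mult.commute mult.left_commute nonzero_mult_div_cancel_left pi_neq_zero times_divide_eq_left times_divide_eq_right mult_1)
    also have "\<dots> = C * h powr p / h ^ k" unfolding a_def using h by simp
    finally show ?thesis .
  qed
  finally show ?thesis .
qed

text \<open>Order 0 is treated apart because \<open>spectrum 0\<close> is too singular at 0 for its
  Fourier integral to represent the function; the differences in \<open>fh_deriv_diff\<close> put
  all orders on the same footing.\<close>

definition fh_deriv :: "nat \<Rightarrow> real \<Rightarrow> complex" where
  "fh_deriv k = (if k = 0 then fh else fourier_int (spectrum k))"

lemma fh_deriv_diff:
  "fh_deriv k y - fh_deriv k x = (\<integral>\<xi>. (iexp (\<xi> * y) - iexp (\<xi> * x)) * spectrum k \<xi> \<partial>lborel)"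
proof (cases "k = 0")
  case True
  then show ?thesis unfolding fh_deriv_def by (simp add: fh_diff)
next
  case False
  then have "integrable lborel (spectrum k)" by (intro integrable_spectrum) simp
  note i = integrable_iexp_mult[OF this]
  show ?thesis using False unfolding fh_deriv_def fourier_int_def
    by (simp add: Bochner_Integration.integral_diff[OF i i] left_diff_distrib del: of_real_mult)
qed

lemma fh_deriv_taylor:
  "norm (fh_deriv k y - fh_deriv k x - complex_of_real (y - x) * fh_deriv (Suc k) x)
     \<le> (y - x)\<^sup>2 / 2 * (\<integral>\<xi>. norm (spectrum (k + 2) \<xi>) \<partial>lborel)"
  "(fh_deriv k has_vector_derivative fh_deriv (Suc k) x) (at x)"
proof -
  have D: "fh_deriv (Suc k) x = (\<integral>\<xi>. iexp (\<xi> * x) * (\<i> * complex_of_real \<xi> * spectrum k \<xi>) \<partial>lborel)" for x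
    unfolding fh_deriv_def fourier_int_def spectrum_Suc by simp
  have s1: "complex_of_real \<xi> * spectrum k \<xi> = - \<i> * spectrum (Suc k) \<xi>" for \<xi>
    unfolding spectrum_Suc by (simp add: mult.assoc[symmetric])
  have s2: "complex_of_real \<xi> ^ 2 * spectrum k \<xi> = - spectrum (k + 2) \<xi>" for \<xi>
  proof -
    have "spectrum (k + 2) \<xi> = \<i> * complex_of_real \<xi> * (\<i> * complex_of_real \<xi> * spectrum k \<xi>)"
      by (simp add: spectrum_Suc)
    also have "\<dots> = (\<i> * \<i>) * (complex_of_real \<xi> ^ 2 * spectrum k \<xi>)"
      by (simp only: power2_eq_square ac_simps)
    finally show ?thesis by simp
  qed
  have i1: "integrable lborel (\<lambda>\<xi>. complex_of_real \<xi> * spectrum k \<xi>)"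
    unfolding s1 by (intro integrable_mult_right integrable_spectrum) simp
  have i2: "integrable lborel (\<lambda>\<xi>. complex_of_real \<xi> ^ 2 * spectrum k \<xi>)"
    unfolding s2 by (intro integrable_minus integrable_spectrum) simp
  note T = fourier_difference_taylor[OF fh_deriv_diff borel_spectrum i1 i2, folded D]
  show "norm (fh_deriv k y - fh_deriv k x - complex_of_real (y - x) * fh_deriv (Suc k) x)
     \<le> (y - x)\<^sup>2 / 2 * (\<integral>\<xi>. norm (spectrum (k + 2) \<xi>) \<partial>lborel)"
    using T(1)[of y x] unfolding s2 norm_minus_cancel .
  show "(fh_deriv k has_vector_derivative fh_deriv (Suc k) x) (at x)" by (rule T(2))
qed

lemma nth_vderiv_fh: "nth_vderiv k fh = fh_deriv k"
proof (induction k)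
  case 0
  show ?case by (simp add: nth_vderiv_def fh_deriv_def)
next
  case (Suc k)
  have "nth_vderiv (Suc k) fh = (\<lambda>x. vector_derivative (nth_vderiv k fh) (at x))"
    by (simp add: nth_vderiv_def)
  also have "\<dots> = fh_deriv (Suc k)"
    unfolding Suc by (intro ext vector_derivative_at fh_deriv_taylor(2))
  finally show ?case .
qed

lemma nth_vderiv_fh_has_derivative:
  "(nth_vderiv k fh has_vector_derivative nth_vderiv (Suc k) fh x) (at x)"
  unfolding nth_vderiv_fh by (rule fh_deriv_taylor(2))

lemma nth_vderiv_fh_bound:
  assumes "k \<ge> 2"
  shows "norm (nth_vderiv k fh x) \<le> C * h powr p / h ^ k"
proof -
  have "norm (nth_vderiv k fh x) \<le> (\<integral>\<xi>. norm (spectrum k \<xi>) \<partial>lborel)"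
    using assms unfolding nth_vderiv_fh fh_deriv_def
    by (auto intro!: norm_fourier_int_le integrable_spectrum)
  also have "\<dots> \<le> C * h powr p / h ^ k" by (rule spectrum_L1[OF assms])
  finally show ?thesis .
qed

text \<open>The spectral bound fails for \<open>k = 1\<close>, where \<open>|\<xi>|\<^sup>-\<^sup>p\<close> is singular at 0. Instead, the derivative is
  interpolated between the increment over a step \<open>h\<close> and the second derivative.\<close>

lemma nth_vderiv_fh_bound_1: "norm (nth_vderiv 1 fh x) \<le> 3 / 2 * C * h powr p / h"
proof -
  have "norm (fh (x + h) - fh x - complex_of_real h * fh_deriv 1 x) \<le> h\<^sup>2 / 2 * (\<integral>\<xi>. norm (spectrum 2 \<xi>) \<partial>lborel)"
    using fh_deriv_taylor(1)[of 0 "x + h" x] by (simp add: fh_deriv_def numeral_2_eq_2)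
  also have "\<dots> \<le> h\<^sup>2 / 2 * (C * h powr p / h\<^sup>2)"
    by (intro mult_left_mono spectrum_L1) simp_all
  also have "\<dots> = C * h powr p / 2" using h by simp
  \<comment> \<open>The factor 3/2 is 1 from the increment plus 1/2 from the Taylor
    remainder.\<close>
  finally have "norm (complex_of_real h * fh_deriv 1 x) \<le> C * h powr p + C * h powr p / 2"
    using fh_increment[of x] norm_triangle_ineq4[of "fh (x + h) - fh x" "fh (x + h) - fh x - complex_of_real h * fh_deriv 1 x"]
    by simp
  then have "h * norm (fh_deriv 1 x) \<le> 3 / 2 * C * h powr p" using h by (simp add: norm_mult)
  then show ?thesis unfolding nth_vderiv_fh using h by (simp add: field_simps)
qed

end

section \<open>Elementary symmetric polynomials and symmetrized moments\<close>

text \<open>Lists are used so that a product of sums over tuples expands by concatenation.\<close>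

definition tuples :: "nat \<Rightarrow> 'i set \<Rightarrow> 'i list set" where
  "tuples N J = {js. length js = N \<and> set js \<subseteq> J}"

definition dtuples :: "nat \<Rightarrow> 'i set \<Rightarrow> 'i list set" where
  "dtuples N J = {js. length js = N \<and> distinct js \<and> set js \<subseteq> J}"

definition esym :: "nat \<Rightarrow> 'i set \<Rightarrow> ('i \<Rightarrow> real) \<Rightarrow> real" where
  "esym k J z = (\<Sum>S | S \<subseteq> J \<and> card S = k. \<Prod>j\<in>S. z j)"

lemma finite_tuples [simp]: "finite J \<Longrightarrow> finite (tuples N J)"
  unfolding tuples_def using finite_lists_length_eq[of J N] by (simp add: conj_commute)

lemma dtuples_subset: "dtuples N J \<subseteq> tuples N J"
  unfolding tuples_def dtuples_def by auto

lemma finite_dtuples [simp]: "finite J \<Longrightarrow> finite (dtuples N J)"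
  by (rule finite_subset[OF dtuples_subset]) simp

lemma sum_power_tuples:
  fixes y :: "'i \<Rightarrow> real"
  assumes "finite J"
  shows "(\<Sum>j\<in>J. y j) ^ N = (\<Sum>js\<in>tuples N J. prod_list (map y js))"
proof (induction N)
  case 0
  have "tuples 0 J = {[]}" by (auto simp: tuples_def)
  then show ?case by simp
next
  case (Suc N)
  have eq: "tuples (Suc N) J = (\<lambda>(xs, n). n # xs) ` (tuples N J \<times> J)"
    using lists_length_Suc_eq[of J N] by (simp add: tuples_def conj_commute)
  have "(\<Sum>js\<in>tuples (Suc N) J. prod_list (map y js)) = (\<Sum>(xs, n)\<in>tuples N J \<times> J. y n * prod_list (map y xs))"
    unfolding eq by (subst sum.reindex) (auto simp: inj_on_def case_prod_beta)
  also have "\<dots> = (\<Sum>xs\<in>tuples N J. \<Sum>n\<in>J. y n * prod_list (map y xs))"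
    by (rule sum.cartesian_product[symmetric])
  also have "\<dots> = (\<Sum>n\<in>J. y n) * (\<Sum>xs\<in>tuples N J. prod_list (map y xs))"
    by (simp add: sum_distrib_left sum_distrib_right)
  finally show ?case using Suc by simp
qed

text \<open>A set of \<open>k\<close> indices is listed by exactly k! distinct tuples.\<close>

lemma sum_dtuples:
  fixes z :: "'i \<Rightarrow> real"
  assumes J: "finite J"
  shows "(\<Sum>js\<in>dtuples k J. prod_list (map z js)) = fact k * esym k J z"
proof -
  let ?T = "{S. S \<subseteq> J \<and> card S = k}"
  have "(\<Sum>js\<in>dtuples k J. prod_list (map z js)) = (\<Sum>S\<in>?T. \<Sum>js | js \<in> dtuples k J \<and> set js = S. prod_list (map z js))"
  proof (rule sum.group[symmetric])
    show "set ` dtuples k J \<subseteq> ?T" by (auto simp: dtuples_def distinct_card)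
  qed (use J in simp_all)
  also have "\<dots> = (\<Sum>S\<in>?T. fact k * (\<Prod>j\<in>S. z j))"
  proof (rule sum.cong[OF refl])
    fix S assume S: "S \<in> ?T"
    then have fS: "finite S" using J finite_subset by blast
    have eq: "{js. js \<in> dtuples k J \<and> set js = S} = permutations_of_set S"
      using S by (auto simp: dtuples_def permutations_of_set_def distinct_card)
    have "prod_list (map z js) = (\<Prod>j\<in>S. z j)" if "js \<in> permutations_of_set S" for js
      using that by (auto simp: permutations_of_set_def prod.distinct_set_conv_list)
    then show "(\<Sum>js | js \<in> dtuples k J \<and> set js = S. prod_list (map z js)) = fact k * (\<Prod>j\<in>S. z j)"
      using S fS unfolding eq by simp
  qed
  finally show ?thesis unfolding esym_def by (simp add: sum_distrib_left)
qed

text \<open>The monomials of the power include those with distinct indices, and the others are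
  nonnegative.\<close>

lemma fact_esym_le_power:
  assumes "finite J" "\<And>j. j \<in> J \<Longrightarrow> v j \<ge> 0"
  shows "fact k * esym k J v \<le> (\<Sum>j\<in>J. v j) ^ k"
proof -
  have "prod_list (map v js) \<ge> 0" if "set js \<subseteq> J" for js
    using that assms(2) by (induction js) auto
  then show ?thesis
    unfolding sum_power_tuples[OF assms(1)] sum_dtuples[OF assms(1), symmetric]
    by (intro sum_mono2 finite_tuples assms dtuples_subset) (auto simp: tuples_def)
qed

lemma card_supersets:
  assumes J: "finite J" and T: "T \<subseteq> J"
  shows "card {S. S \<subseteq> J \<and> card S = card T + i \<and> T \<subseteq> S} = (card J - card T) choose i"
proof -
  have fT: "finite T" using J T finite_subset by blast
  have "card {S. S \<subseteq> J \<and> card S = card T + i \<and> T \<subseteq> S} = card {B. B \<subseteq> J - T \<and> card B = i}"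
  proof (rule bij_betw_same_card[of "\<lambda>S. S - T"], rule bij_betw_byWitness[where f'="\<lambda>B. B \<union> T"])
    show "(\<lambda>S. S - T) ` {S. S \<subseteq> J \<and> card S = card T + i \<and> T \<subseteq> S} \<subseteq> {B. B \<subseteq> J - T \<and> card B = i}"
      using fT by (auto simp: card_Diff_subset)
    show "(\<lambda>B. B \<union> T) ` {B. B \<subseteq> J - T \<and> card B = i} \<subseteq> {S. S \<subseteq> J \<and> card S = card T + i \<and> T \<subseteq> S}"
    proof
      fix S assume "S \<in> (\<lambda>B. B \<union> T) ` {B. B \<subseteq> J - T \<and> card B = i}"
      then obtain B where B: "S = B \<union> T" "B \<subseteq> J - T" "card B = i" by blast
      then have "finite B" using J by (meson finite_Diff finite_subset)
      then have "card S = card B + card T" using B fT by (auto intro!: card_Un_disjoint)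
      then show "S \<in> {S. S \<subseteq> J \<and> card S = card T + i \<and> T \<subseteq> S}" using B T by auto
    qed
  qed auto
  also have "\<dots> = (card J - card T) choose i"
    using J T fT by (simp add: n_subsets card_Diff_subset)
  finally show ?thesis .
qed

text \<open>After expanding every product, a set \<open>T\<close> is counted once for each superset
  of size \<open>k\<close> inside \<open>J\<close>; \<open>card_supersets\<close> supplies the
  binomial coefficient.\<close>

lemma esym_shift:
  assumes J: "finite J" and k: "k \<le> card J"
  shows "esym k J (\<lambda>j. z j - t) = (\<Sum>i\<le>k. real ((card J - i) choose (k - i)) * esym i J z * (- t) ^ (k - i))"
proof -
  let ?A = "{S. S \<subseteq> J \<and> card S = k}"
  define g where "g T = (\<Prod>j\<in>T. z j) * (- t) ^ (k - card T)" for T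
  have fA: "finite ?A" using J by simp
  have "esym k J (\<lambda>j. z j - t) = (\<Sum>S\<in>?A. \<Sum>T | T \<in> Pow J \<and> T \<subseteq> S. g T)"
    unfolding esym_def
  proof (rule sum.cong[OF refl])
    fix S assume S: "S \<in> ?A"
    then have fS: "finite S" using J finite_subset by blast
    have "(\<Prod>j\<in>S. z j - t) = (\<Prod>j\<in>S. z j + (- t))" by simp
    also have "\<dots> = (\<Sum>T\<in>Pow S. (\<Prod>j\<in>T. z j) * (\<Prod>j\<in>S - T. - t))"
      by (rule prod_add[OF fS])
    also have "\<dots> = (\<Sum>T\<in>Pow S. g T)"
      using S fS by (intro sum.cong refl) (auto simp: g_def card_Diff_subset finite_subset)
    also have "Pow S = {T \<in> Pow J. T \<subseteq> S}" using S by auto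
    finally show "(\<Prod>j\<in>S. z j - t) = (\<Sum>T | T \<in> Pow J \<and> T \<subseteq> S. g T)" by simp
  qed
  also have "\<dots> = (\<Sum>T\<in>Pow J. \<Sum>S | S \<in> ?A \<and> T \<subseteq> S. g T)"
    using fA J by (intro sum.swap_restrict) auto
  also have "\<dots> = (\<Sum>T\<in>Pow J. if card T \<le> k then real ((card J - card T) choose (k - card T)) * g T else 0)"
  proof (rule sum.cong[OF refl])
    fix T assume T: "T \<in> Pow J"
    show "(\<Sum>S | S \<in> ?A \<and> T \<subseteq> S. g T) = (if card T \<le> k then real ((card J - card T) choose (k - card T)) * g T else 0)"
    proof (cases "card T \<le> k")
      case True
      then show ?thesis using card_supersets[OF J, of T "k - card T"] T by (simp add: conj_assoc)
    next
      case False
      have "{S. S \<in> ?A \<and> T \<subseteq> S} = {}"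
      proof (rule ccontr)
        assume "{S. S \<in> ?A \<and> T \<subseteq> S} \<noteq> {}"
        then obtain S where "S \<subseteq> J" "card S = k" "T \<subseteq> S" by auto
        then have "card T \<le> k" using J card_mono[of S T] finite_subset by blast
        with False show False by simp
      qed
      then show ?thesis using False by (simp only: sum.empty if_False)
    qed
  qed
  also have "\<dots> = (\<Sum>T | T \<subseteq> J \<and> card T \<le> k. real ((card J - card T) choose (k - card T)) * g T)"
    using J by (subst sum.inter_filter[symmetric]) (auto intro!: sum.cong)
  also have "\<dots> = (\<Sum>i\<le>k. \<Sum>T | T \<in> {T. T \<subseteq> J \<and> card T \<le> k} \<and> card T = i. real ((card J - card T) choose (k - card T)) * g T)"
    using J by (intro sum.group[symmetric]) auto
  also have "\<dots> = (\<Sum>i\<le>k. real ((card J - i) choose (k - i)) * esym i J z * (- t) ^ (k - i))"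
  proof (rule sum.cong[OF refl])
    fix i assume "i \<in> {..k}"
    then have "{T. T \<in> {T. T \<subseteq> J \<and> card T \<le> k} \<and> card T = i} = {T. T \<subseteq> J \<and> card T = i}" by auto
    then show "(\<Sum>T | T \<in> {T. T \<subseteq> J \<and> card T \<le> k} \<and> card T = i. real ((card J - card T) choose (k - card T)) * g T)
      = real ((card J - i) choose (k - i)) * esym i J z * (- t) ^ (k - i)"
      unfolding esym_def g_def by (simp add: sum_distrib_left sum_distrib_right ac_simps)
  qed
  finally show ?thesis .
qed

text \<open>Dividing by the number of index sets removes \<open>card J\<close> from the coefficients
  and leaves \<open>k choose i\<close>. This is why recentred U-statistics form an Appell
  sequence.\<close>

lemma esym_shift_normalized:
  assumes J: "finite J" and k: "k \<le> card J"
  shows "esym k J (\<lambda>j. z j - t) / real (card J choose k)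
    = (\<Sum>i\<le>k. real (k choose i) * (esym i J z / real (card J choose i)) * (- t) ^ (k - i))"
  unfolding esym_shift[OF assms] sum_divide_distrib
proof (rule sum.cong[OF refl])
  fix i assume "i \<in> {..k}"
  then have i: "i \<le> k" by simp
  have pos: "(card J choose k) > 0" "(card J choose i) > 0" using k i by auto
  have "real (card J choose k) * real (k choose i) = real (card J choose i) * real ((card J - i) choose (k - i))"
    using choose_mult[OF i k] by (simp flip: of_nat_mult)
  then have "real ((card J - i) choose (k - i)) / real (card J choose k) = real (k choose i) / real (card J choose i)"
    using pos by (simp only: frac_eq_eq of_nat_eq_0_iff neq0_conv mult.commute)
  then have "real ((card J - i) choose (k - i)) / real (card J choose k) * (esym i J z * (- t) ^ (k - i))
     = real (k choose i) / real (card J choose i) * (esym i J z * (- t) ^ (k - i))"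
    by (rule arg_cong)
  then show "real ((card J - i) choose (k - i)) * esym i J z * (- t) ^ (k - i) / real (card J choose k)
     = real (k choose i) * (esym i J z / real (card J choose i)) * (- t) ^ (k - i)"
    by simp
qed

section \<open>Averages over sign patterns\<close>

abbreviation signs :: "'i set \<Rightarrow> ('i \<Rightarrow> real) set" where
  "signs J \<equiv> PiE J (\<lambda>_. {-1, 1})"

text \<open>Expectation over independent fair signs, written as a finite average so that it
  interchanges freely with integrals over the probability space.\<close>

definition sign_avg :: "'i set \<Rightarrow> (('i \<Rightarrow> real) \<Rightarrow> real) \<Rightarrow> real" where
  "sign_avg J g = (\<Sum>\<sigma>\<in>signs J. g \<sigma>) / 2 ^ card J"

lemma sign_avg_mono: "(\<And>\<sigma>. \<sigma> \<in> signs J \<Longrightarrow> f \<sigma> \<le> g \<sigma>) \<Longrightarrow> sign_avg J f \<le> sign_avg J g"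
  unfolding sign_avg_def by (intro divide_right_mono sum_mono) auto

lemma sign_avg_add: "sign_avg J (\<lambda>\<sigma>. f \<sigma> + g \<sigma>) = sign_avg J f + sign_avg J g"
  unfolding sign_avg_def by (simp add: sum.distrib add_divide_distrib)

lemma sign_avg_cmult: "sign_avg J (\<lambda>\<sigma>. c * f \<sigma>) = c * sign_avg J f"
  unfolding sign_avg_def by (simp add: sum_distrib_left)

lemma sign_avg_sum: "sign_avg J (\<lambda>\<sigma>. \<Sum>a\<in>A. f a \<sigma>) = (\<Sum>a\<in>A. sign_avg J (f a))"
  unfolding sign_avg_def by (subst sum.swap) (simp add: sum_divide_distrib)

lemma sign_avg_const: "finite J \<Longrightarrow> sign_avg J (\<lambda>\<sigma>. c) = c"
  unfolding sign_avg_def by (simp add: card_PiE)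

lemma sign_avg_cong: "(\<And>\<sigma>. \<sigma> \<in> signs J \<Longrightarrow> f \<sigma> = g \<sigma>) \<Longrightarrow> sign_avg J f = sign_avg J g"
  unfolding sign_avg_def by simp

text \<open>Multiplication by a fixed sign pattern is an involution of \<open>signs J\<close>, so it
  only permutes the terms of the average.\<close>

lemma sign_avg_twist:
  assumes "\<And>j. j \<in> J \<Longrightarrow> \<tau> j = -1 \<or> \<tau> j = 1"
  shows "sign_avg J (\<lambda>\<sigma>. (\<Sum>j\<in>J. \<sigma> j * \<tau> j * z j) ^ N) = sign_avg J (\<lambda>\<sigma>. (\<Sum>j\<in>J. \<sigma> j * z j) ^ N)"
proof -
  define T where "T \<sigma> = (\<lambda>j\<in>J. \<sigma> j * \<tau> j)" for \<sigma> :: "_ \<Rightarrow> real"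
  have TT: "T \<sigma> \<in> signs J" if "\<sigma> \<in> signs J" for \<sigma>
  proof (rule PiE_I)
    fix j assume j: "j \<in> J"
    then have "\<sigma> j = -1 \<or> \<sigma> j = 1" using that by auto
    with assms[OF j] show "T \<sigma> j \<in> {-1, 1}" using j by (auto simp: T_def)
  qed (simp add: T_def)
  have inv: "T (T \<sigma>) = \<sigma>" if "\<sigma> \<in> signs J" for \<sigma>
  proof
    fix j show "T (T \<sigma>) j = \<sigma> j"
    proof (cases "j \<in> J")
      case True
      then show ?thesis using assms[OF True] by (auto simp: T_def)
    next
      case False
      then show ?thesis using that by (auto simp: T_def PiE_def extensional_def)
    qed
  qed
  have "bij_betw T (signs J) (signs J)"
    by (rule bij_betw_byWitness[where f'=T]) (use TT inv in auto)
  then have "(\<Sum>\<sigma>\<in>signs J. (\<Sum>j\<in>J. T \<sigma> j * z j) ^ N) = (\<Sum>\<sigma>\<in>signs J. (\<Sum>j\<in>J. \<sigma> j * z j) ^ N)"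
    by (rule sum.reindex_bij_betw)
  then show ?thesis unfolding sign_avg_def T_def by (simp cong: sum.cong)
qed

lemma sign_avg_abs:
  "sign_avg J (\<lambda>\<sigma>. (\<Sum>j\<in>J. \<sigma> j * \<bar>z j\<bar>) ^ N) = sign_avg J (\<lambda>\<sigma>. (\<Sum>j\<in>J. \<sigma> j * z j) ^ N)"
proof -
  have "\<bar>z j\<bar> = (if z j < 0 then -1 else 1) * z j" for j by simp
  then have "sign_avg J (\<lambda>\<sigma>. (\<Sum>j\<in>J. \<sigma> j * \<bar>z j\<bar>) ^ N) = sign_avg J (\<lambda>\<sigma>. (\<Sum>j\<in>J. \<sigma> j * (if z j < 0 then -1 else 1) * z j) ^ N)"
    by (simp add: mult.assoc)
  also have "\<dots> = sign_avg J (\<lambda>\<sigma>. (\<Sum>j\<in>J. \<sigma> j * z j) ^ N)" by (rule sign_avg_twist) auto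
  finally show ?thesis .
qed

text \<open>If \<open>\<sigma>\<close>, \<open>\<tau>\<close> are independent signs, then \<open>\<sigma> + \<tau> + \<sigma>\<tau>\<close> takes the value 3 with probability 1/4
  and -1 otherwise. It is centred and all its higher moments are at least 1, so multiplying by it
  kills exactly the monomials in which some variable occurs once.\<close>

definition skew_sign :: "('i \<Rightarrow> real) \<Rightarrow> ('i \<Rightarrow> real) \<Rightarrow> 'i \<Rightarrow> real" where
  "skew_sign \<sigma> \<tau> j = \<sigma> j + \<tau> j + \<sigma> j * \<tau> j"

definition skew_avg :: "'i set \<Rightarrow> (('i \<Rightarrow> real) \<Rightarrow> real) \<Rightarrow> real" where
  "skew_avg J g = sign_avg J (\<lambda>\<sigma>. sign_avg J (\<lambda>\<tau>. g (skew_sign \<sigma> \<tau>)))"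

text \<open>The average factorizes over \<open>J\<close>, and each factor is the moment of a
  variable with value 3 in one of four equally likely cases and -1 in the other three.\<close>

lemma skew_avg_prod:
  assumes J: "finite J"
  shows "skew_avg J (\<lambda>\<xi>. \<Prod>j\<in>J. \<xi> j ^ \<alpha> j) = (\<Prod>j\<in>J. (3 ^ \<alpha> j + 3 * (-1) ^ \<alpha> j) / 4)"
proof -
  define f where "f j a b = (a + b + a * b) ^ \<alpha> j" for j and a b :: real
  have "skew_avg J (\<lambda>\<xi>. \<Prod>j\<in>J. \<xi> j ^ \<alpha> j)
      = (\<Sum>\<sigma>\<in>signs J. \<Sum>\<tau>\<in>signs J. \<Prod>j\<in>J. f j (\<sigma> j) (\<tau> j)) / 4 ^ card J"
    unfolding skew_avg_def sign_avg_def f_def skew_sign_def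
    by (simp add: sum_divide_distrib[symmetric] power_mult_distrib[symmetric])
  also have "(\<Sum>\<sigma>\<in>signs J. \<Sum>\<tau>\<in>signs J. \<Prod>j\<in>J. f j (\<sigma> j) (\<tau> j)) = (\<Sum>\<sigma>\<in>signs J. \<Prod>j\<in>J. \<Sum>b\<in>{-1,1}. f j (\<sigma> j) b)"
    using J by (intro sum.cong refl prod_sum_PiE[symmetric]) auto
  also have "\<dots> = (\<Prod>j\<in>J. \<Sum>a\<in>{-1,1}. \<Sum>b\<in>{-1,1}. f j a b)"
    using J by (intro prod_sum_PiE[symmetric, where f="\<lambda>j a. \<Sum>b\<in>{-1,1}. f j a b"]) auto
  also have "\<dots> = (\<Prod>j\<in>J. 3 ^ \<alpha> j + 3 * (-1) ^ \<alpha> j)"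
    by (intro prod.cong refl) (simp add: f_def)
  finally show ?thesis by (simp add: prod_dividef)
qed

lemma skew_moment:
  fixes k :: nat
  shows "0 \<le> ((3::real) ^ k + 3 * (-1) ^ k) / 4" "k \<noteq> 1 \<Longrightarrow> 1 \<le> ((3::real) ^ k + 3 * (-1) ^ k) / 4"
proof -
  have 1: "1 \<le> ((3::real) ^ k + 3 * (-1) ^ k) / 4" if k: "k \<noteq> 1"
  proof (cases "k = 0")
    case False
    with k have "k \<ge> 2" by simp
    then have "(3::real) ^ 2 \<le> 3 ^ k" by (intro power_increasing) auto
    moreover have "(-1::real) ^ k \<ge> -1" by (cases "even k") auto
    ultimately show ?thesis by simp
  qed simp
  show "k \<noteq> 1 \<Longrightarrow> 1 \<le> ((3::real) ^ k + 3 * (-1) ^ k) / 4" by (rule 1)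
  show "0 \<le> ((3::real) ^ k + 3 * (-1) ^ k) / 4"
    using 1 by (cases "k = 1") force+
qed

text \<open>Convexity splits the power of a sum of three. Each summand is a Rademacher sum, the one
  with signs \<open>\<tau> j * \<sigma> j\<close> by \<open>sign_avg_twist\<close>, so the total
  factor is 3^(2s) = 9^s.\<close>

lemma skew_avg_sum_power_le:
  assumes J: "finite J" and s: "s \<ge> 1"
  shows "skew_avg J (\<lambda>\<xi>. (\<Sum>j\<in>J. \<xi> j * y j) ^ (2 * s)) \<le> 9 ^ s * sign_avg J (\<lambda>\<sigma>. (\<Sum>j\<in>J. \<sigma> j * y j) ^ (2 * s))"
proof -
  let ?N = "2 * s"
  let ?A = "sign_avg J (\<lambda>\<sigma>. (\<Sum>j\<in>J. \<sigma> j * y j) ^ ?N)"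
  have cvx: "(a + b + c) ^ ?N \<le> 3 ^ (?N - 1) * (a ^ ?N + b ^ ?N + c ^ ?N)" for a b c :: real
  proof -
    have cv: "convex_on UNIV (\<lambda>x::real. x ^ ?N)" by (rule convex_power_even) simp
    \<comment> \<open>Jensen for three points in two nested steps: weights 1/3 and 2/3, then two
      halves.\<close>
    have "((1/3) *\<^sub>R a + (2/3) *\<^sub>R ((1/2) *\<^sub>R b + (1/2) *\<^sub>R c)) ^ ?N
       \<le> (1/3) * a ^ ?N + (2/3) * ((1/2) *\<^sub>R b + (1/2) *\<^sub>R c) ^ ?N"
      using convex_onD[OF cv, of "2/3" a "(1/2) *\<^sub>R b + (1/2) *\<^sub>R c"] by simp
    also have "((1/2) *\<^sub>R b + (1/2) *\<^sub>R c) ^ ?N \<le> (1/2) * b ^ ?N + (1/2) * c ^ ?N"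
      using convex_onD[OF cv, of "1/2" b c] by simp
    finally have "((a + b + c) / 3) ^ ?N \<le> (a ^ ?N + b ^ ?N + c ^ ?N) / 3"
      by (simp add: add_divide_distrib add.assoc)
    note le = this
    have t: "(3::real) ^ ?N = 3 ^ (?N - 1) * 3" using s by (simp flip: power_Suc2)
    have "(a + b + c) ^ ?N = 3 ^ ?N * ((a + b + c) / 3) ^ ?N" by (simp add: power_divide)
    also have "\<dots> \<le> 3 ^ ?N * ((a ^ ?N + b ^ ?N + c ^ ?N) / 3)" by (rule mult_left_mono[OF le]) simp
    also have "\<dots> = 3 ^ (?N - 1) * (a ^ ?N + b ^ ?N + c ^ ?N)" unfolding t by simp
    finally show ?thesis .
  qed
  have "skew_avg J (\<lambda>\<xi>. (\<Sum>j\<in>J. \<xi> j * y j) ^ ?N)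
    \<le> sign_avg J (\<lambda>\<sigma>. sign_avg J (\<lambda>\<tau>. 3 ^ (?N - 1) * ((\<Sum>j\<in>J. \<sigma> j * y j) ^ ?N + (\<Sum>j\<in>J. \<tau> j * y j) ^ ?N
        + (\<Sum>j\<in>J. \<tau> j * \<sigma> j * y j) ^ ?N)))"
    unfolding skew_avg_def
  proof (intro sign_avg_mono)
    fix \<sigma> \<tau> :: "_ \<Rightarrow> real"
    have "(\<Sum>j\<in>J. skew_sign \<sigma> \<tau> j * y j) = (\<Sum>j\<in>J. \<sigma> j * y j) + (\<Sum>j\<in>J. \<tau> j * y j) + (\<Sum>j\<in>J. \<tau> j * \<sigma> j * y j)"
      by (simp add: skew_sign_def algebra_simps sum.distrib)
    then show "(\<Sum>j\<in>J. skew_sign \<sigma> \<tau> j * y j) ^ ?N \<le> 3 ^ (?N - 1) * ((\<Sum>j\<in>J. \<sigma> j * y j) ^ ?N + (\<Sum>j\<in>J. \<tau> j * y j) ^ ?N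
        + (\<Sum>j\<in>J. \<tau> j * \<sigma> j * y j) ^ ?N)"
      using cvx by simp
  qed
  also have "\<dots> = sign_avg J (\<lambda>\<sigma>. 3 ^ (?N - 1) * ((\<Sum>j\<in>J. \<sigma> j * y j) ^ ?N + ?A + ?A))"
  proof (rule sign_avg_cong)
    fix \<sigma> assume \<sigma>: "\<sigma> \<in> signs J"
    have "sign_avg J (\<lambda>\<tau>. (\<Sum>j\<in>J. \<tau> j * \<sigma> j * y j) ^ ?N) = ?A"
      by (rule sign_avg_twist) (use \<sigma> in auto)
    then show "sign_avg J (\<lambda>\<tau>. 3 ^ (?N - 1) * ((\<Sum>j\<in>J. \<sigma> j * y j) ^ ?N + (\<Sum>j\<in>J. \<tau> j * y j) ^ ?N
        + (\<Sum>j\<in>J. \<tau> j * \<sigma> j * y j) ^ ?N)) = 3 ^ (?N - 1) * ((\<Sum>j\<in>J. \<sigma> j * y j) ^ ?N + ?A + ?A)"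
      by (simp only: sign_avg_cmult sign_avg_add sign_avg_const[OF J])
  qed
  also have "\<dots> = 3 ^ (?N - 1) * (?A + ?A + ?A)"
    by (simp only: sign_avg_cmult sign_avg_add sign_avg_const[OF J])
  also have "\<dots> = (3 * 3 ^ (?N - 1)) * ?A" by simp
  also have "(3::real) * 3 ^ (?N - 1) = 3 ^ ?N" using s by (simp flip: power_Suc)
  also have "(3::real) ^ ?N = 9 ^ s" by (simp add: power_mult)
  finally show ?thesis .
qed

lemma prod_list_map_count:
  fixes z :: "'i \<Rightarrow> real"
  assumes "finite J" "set js \<subseteq> J"
  shows "prod_list (map z js) = (\<Prod>j\<in>J. z j ^ count_list js j)"
  using assms(2)
proof (induction js)
  case (Cons a js)
  have a: "a \<in> J" using Cons by simp
  have "(\<Prod>j\<in>J. z j ^ count_list (a # js) j) = (\<Prod>j\<in>J. (if j = a then z a else 1) * z j ^ count_list js j)"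
    by (intro prod.cong refl) auto
  also have "\<dots> = z a * (\<Prod>j\<in>J. z j ^ count_list js j)"
    using assms(1) a by (simp add: prod.distrib prod.delta)
  finally show ?case using Cons by simp
qed simp

section \<open>Moments of independent centred variables\<close>

context prob_space
begin

lemma integrable_power_le:
  fixes Z :: "'a \<Rightarrow> real"
  assumes [measurable]: "Z \<in> borel_measurable M" and i: "integrable M (\<lambda>\<omega>. \<bar>Z \<omega>\<bar> ^ N)" and k: "k \<le> N"
  shows "integrable M (\<lambda>\<omega>. \<bar>Z \<omega>\<bar> ^ k)" "integrable M (\<lambda>\<omega>. Z \<omega> ^ k)"
proof -
  have le: "\<bar>x\<bar> ^ k \<le> 1 + \<bar>x\<bar> ^ N" for x :: real
  proof (cases "\<bar>x\<bar> \<le> 1")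
    case True
    then have "\<bar>x\<bar> ^ k \<le> 1" by (intro power_le_one) auto
    then show ?thesis by (simp add: add_increasing2)
  next
    case False
    then have "\<bar>x\<bar> ^ k \<le> \<bar>x\<bar> ^ N" using k by (intro power_increasing) auto
    then show ?thesis by simp
  qed
  have i1: "integrable M (\<lambda>\<omega>. 1 + \<bar>Z \<omega>\<bar> ^ N)" using i by simp
  show "integrable M (\<lambda>\<omega>. \<bar>Z \<omega>\<bar> ^ k)"
  proof (rule Bochner_Integration.integrable_bound[OF i1])
    show "AE \<omega> in M. norm (\<bar>Z \<omega>\<bar> ^ k) \<le> norm (1 + \<bar>Z \<omega>\<bar> ^ N)"
      using le by (intro AE_I2) (smt (verit) real_norm_def zero_le_power abs_ge_zero)
  qed simp
  then show "integrable M (\<lambda>\<omega>. Z \<omega> ^ k)"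
    by (rule Bochner_Integration.integrable_bound) (auto simp: power_abs)
qed

text \<open>The set \<open>A\<close> is arbitrary: only a subset of the monomials of \<open>(\<Sum>j\<in>J. Z j) ^ (2 * s)\<close> need be summed,
  as all those of the dominating expansion are nonnegative.\<close>

lemma symmetrized_moment_bound:
  fixes Z :: "'i \<Rightarrow> 'a \<Rightarrow> real"
  assumes J: "finite J" and s: "s \<ge> 1"
    and ind: "indep_vars (\<lambda>_. borel) Z J"
    and mean: "\<And>j. j \<in> J \<Longrightarrow> expectation (Z j) = 0"
    and int: "\<And>j. j \<in> J \<Longrightarrow> integrable M (\<lambda>\<omega>. \<bar>Z j \<omega>\<bar> ^ (2 * s))"
    and A: "A \<subseteq> tuples (2 * s) J"
  shows "integrable M (\<lambda>\<omega>. \<Sum>js\<in>A. prod_list (map (\<lambda>j. Z j \<omega>) js))"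
    "expectation (\<lambda>\<omega>. \<Sum>js\<in>A. prod_list (map (\<lambda>j. Z j \<omega>) js))
      \<le> 9 ^ s * sign_avg J (\<lambda>\<sigma>. expectation (\<lambda>\<omega>. (\<Sum>j\<in>J. \<sigma> j * Z j \<omega>) ^ (2 * s)))"
proof -
  let ?T = "tuples (2 * s) J"
  have meas: "Z j \<in> borel_measurable M" if "j \<in> J" for j
    using ind that by (auto simp: indep_vars_def)
  have cnt: "count_list js j \<le> 2 * s" if "js \<in> ?T" for js j
    using that count_le_length[of js j] by (auto simp: tuples_def)
  have setT: "set js \<subseteq> J" if "js \<in> ?T" for js using that by (auto simp: tuples_def)
  have ip: "integrable M (\<lambda>\<omega>. prod_list (map (\<lambda>j. Z j \<omega>) js))"
    and ep: "expectation (\<lambda>\<omega>. prod_list (map (\<lambda>j. Z j \<omega>) js)) = (\<Prod>j\<in>J. expectation (\<lambda>\<omega>. Z j \<omega> ^ count_list js j))"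
    and ipa: "integrable M (\<lambda>\<omega>. prod_list (map (\<lambda>j. \<bar>Z j \<omega>\<bar>) js))" if js: "js \<in> ?T" for js
  proof -
    have i1: "indep_vars (\<lambda>_. borel) (\<lambda>j \<omega>. Z j \<omega> ^ count_list js j) J"
      by (rule indep_vars_compose2[OF ind, where Y="\<lambda>j x. x ^ count_list js j"]) simp
    have i2: "indep_vars (\<lambda>_. borel) (\<lambda>j \<omega>. \<bar>Z j \<omega>\<bar> ^ count_list js j) J"
      by (rule indep_vars_compose2[OF ind, where Y="\<lambda>j x. \<bar>x\<bar> ^ count_list js j"]) simp
    have j1: "integrable M (\<lambda>\<omega>. Z j \<omega> ^ count_list js j)" "integrable M (\<lambda>\<omega>. \<bar>Z j \<omega>\<bar> ^ count_list js j)" if "j \<in> J" for j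
      using integrable_power_le[OF meas[OF that] int[OF that] cnt[OF js]] by auto
    show "integrable M (\<lambda>\<omega>. prod_list (map (\<lambda>j. Z j \<omega>) js))"
      unfolding prod_list_map_count[OF J setT[OF js]] by (rule indep_vars_integrable[OF J i1 j1(1)])
    show "expectation (\<lambda>\<omega>. prod_list (map (\<lambda>j. Z j \<omega>) js)) = (\<Prod>j\<in>J. expectation (\<lambda>\<omega>. Z j \<omega> ^ count_list js j))"
      unfolding prod_list_map_count[OF J setT[OF js]] by (rule indep_vars_lebesgue_integral[OF J i1 j1(1)])
    show "integrable M (\<lambda>\<omega>. prod_list (map (\<lambda>j. \<bar>Z j \<omega>\<bar>) js))"
      unfolding prod_list_map_count[OF J setT[OF js]] by (rule indep_vars_integrable[OF J i2 j1(2)])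
  qed
  show "integrable M (\<lambda>\<omega>. \<Sum>js\<in>A. prod_list (map (\<lambda>j. Z j \<omega>) js))"
    using ip A by (intro Bochner_Integration.integrable_sum) auto
  \<comment> \<open>The moment of the monomial under skewed signs: nonnegative always, and at least
    1 unless some index occurs exactly once.\<close>
  define m where "m js = skew_avg J (\<lambda>\<xi>. prod_list (map \<xi> js))" for js
  have m: "m js = (\<Prod>j\<in>J. (3 ^ count_list js j + 3 * (-1) ^ count_list js j) / 4)" if "js \<in> ?T" for js
    unfolding m_def prod_list_map_count[OF J setT[OF that]] by (rule skew_avg_prod[OF J])
  have m0: "m js \<ge> 0" if "js \<in> ?T" for js
    unfolding m[OF that] by (intro prod_nonneg ballI skew_moment(1))
  have pa0: "prod_list (map (\<lambda>j. \<bar>Z j \<omega>\<bar>) js) \<ge> 0" for js \<omega>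
    by (induction js) auto
  have paZ: "\<bar>prod_list (map (\<lambda>j. Z j \<omega>) js)\<bar> = prod_list (map (\<lambda>j. \<bar>Z j \<omega>\<bar>) js)" for js \<omega>
    by (induction js) (auto simp: abs_mult)
  have term_le: "expectation (\<lambda>\<omega>. prod_list (map (\<lambda>j. Z j \<omega>) js)) \<le> expectation (\<lambda>\<omega>. m js * prod_list (map (\<lambda>j. \<bar>Z j \<omega>\<bar>) js))"
    if js: "js \<in> ?T" for js
  proof (cases "\<exists>j\<in>J. count_list js j = 1")
    \<comment> \<open>By independence an index occurring once brings in the factor
      \<open>expectation (Z j) = 0\<close>. The dominating side need only be nonnegative
      here.\<close>
    case True
    then obtain j where "j \<in> J" "count_list js j = 1" by blast
    then have "expectation (\<lambda>\<omega>. prod_list (map (\<lambda>j. Z j \<omega>) js)) = 0"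
      unfolding ep[OF js] using J mean by (intro prod_zero) (auto intro!: bexI[of _ j])
    also have "0 \<le> expectation (\<lambda>\<omega>. m js * prod_list (map (\<lambda>j. \<bar>Z j \<omega>\<bar>) js))"
      using m0[OF js] pa0 by (intro Bochner_Integration.integral_nonneg) auto
    finally show ?thesis .
  next
    case False
    then have m1: "m js \<ge> 1" unfolding m[OF js] by (intro prod_ge_1 skew_moment(2)) auto
    show ?thesis
    proof (rule integral_mono[OF ip[OF js]])
      show "integrable M (\<lambda>\<omega>. m js * prod_list (map (\<lambda>j. \<bar>Z j \<omega>\<bar>) js))" using ipa[OF js] by simp
      fix \<omega>
      have "prod_list (map (\<lambda>j. Z j \<omega>) js) \<le> 1 * prod_list (map (\<lambda>j. \<bar>Z j \<omega>\<bar>) js)"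
        using paZ[of \<omega> js] by simp
      also have "\<dots> \<le> m js * prod_list (map (\<lambda>j. \<bar>Z j \<omega>\<bar>) js)" by (rule mult_right_mono[OF m1 pa0])
      finally show "prod_list (map (\<lambda>j. Z j \<omega>) js) \<le> m js * prod_list (map (\<lambda>j. \<bar>Z j \<omega>\<bar>) js)" .
    qed
  qed
  have prod_mult: "prod_list (map (\<lambda>j. \<xi> j * y j) js) = prod_list (map \<xi> js) * prod_list (map y js)" for \<xi> y :: "'i \<Rightarrow> real" and js
    by (induction js) auto
  have sum_m: "(\<Sum>js\<in>?T. m js * prod_list (map y js)) = skew_avg J (\<lambda>\<xi>. (\<Sum>j\<in>J. \<xi> j * y j) ^ (2 * s))" for y
    unfolding m_def sum_power_tuples[OF J] prod_mult skew_avg_def sign_avg_sum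
    by (simp add: sign_avg_cmult[symmetric] mult.commute)
  have iS: "integrable M (\<lambda>\<omega>. (\<Sum>j\<in>J. \<sigma> j * Z j \<omega>) ^ (2 * s))" for \<sigma>
    unfolding sum_power_tuples[OF J] prod_mult using ip by (intro Bochner_Integration.integrable_sum integrable_mult_right) auto
  have "expectation (\<lambda>\<omega>. \<Sum>js\<in>A. prod_list (map (\<lambda>j. Z j \<omega>) js)) = (\<Sum>js\<in>A. expectation (\<lambda>\<omega>. prod_list (map (\<lambda>j. Z j \<omega>) js)))"
    using ip A by (intro Bochner_Integration.integral_sum) auto
  also have "\<dots> \<le> (\<Sum>js\<in>A. expectation (\<lambda>\<omega>. m js * prod_list (map (\<lambda>j. \<bar>Z j \<omega>\<bar>) js)))"
    using A by (intro sum_mono term_le) auto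
  also have "\<dots> \<le> (\<Sum>js\<in>?T. expectation (\<lambda>\<omega>. m js * prod_list (map (\<lambda>j. \<bar>Z j \<omega>\<bar>) js)))"
    using J A m0 pa0 by (intro sum_mono2 Bochner_Integration.integral_nonneg) auto
  also have "\<dots> = expectation (\<lambda>\<omega>. \<Sum>js\<in>?T. m js * prod_list (map (\<lambda>j. \<bar>Z j \<omega>\<bar>) js))"
    using ipa by (intro Bochner_Integration.integral_sum[symmetric]) auto
  \<comment> \<open>Summed over all tuples, the dominating terms recombine into a skewed average of
    a power of a sum. The absolute values then disappear, because random signs are insensitive to
    the signs of the coefficients.\<close>
  also have "\<dots> \<le> expectation (\<lambda>\<omega>. 9 ^ s * sign_avg J (\<lambda>\<sigma>. (\<Sum>j\<in>J. \<sigma> j * Z j \<omega>) ^ (2 * s)))"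
  proof (rule integral_mono)
    show "integrable M (\<lambda>\<omega>. \<Sum>js\<in>?T. m js * prod_list (map (\<lambda>j. \<bar>Z j \<omega>\<bar>) js))"
      using ipa by (intro Bochner_Integration.integrable_sum integrable_mult_right) auto
    show "integrable M (\<lambda>\<omega>. 9 ^ s * sign_avg J (\<lambda>\<sigma>. (\<Sum>j\<in>J. \<sigma> j * Z j \<omega>) ^ (2 * s)))"
      unfolding sign_avg_def using iS by simp
    show "(\<Sum>js\<in>?T. m js * prod_list (map (\<lambda>j. \<bar>Z j \<omega>\<bar>) js)) \<le> 9 ^ s * sign_avg J (\<lambda>\<sigma>. (\<Sum>j\<in>J. \<sigma> j * Z j \<omega>) ^ (2 * s))" for \<omega>
      unfolding sum_m using skew_avg_sum_power_le[OF J s, of "\<lambda>j. \<bar>Z j \<omega>\<bar>"] by (simp only: sign_avg_abs)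
  qed
  also have "\<dots> = 9 ^ s * sign_avg J (\<lambda>\<sigma>. expectation (\<lambda>\<omega>. (\<Sum>j\<in>J. \<sigma> j * Z j \<omega>) ^ (2 * s)))"
    unfolding sign_avg_def using iS by simp
  finally show "expectation (\<lambda>\<omega>. \<Sum>js\<in>A. prod_list (map (\<lambda>j. Z j \<omega>) js))
      \<le> 9 ^ s * sign_avg J (\<lambda>\<sigma>. expectation (\<lambda>\<omega>. (\<Sum>j\<in>J. \<sigma> j * Z j \<omega>) ^ (2 * s)))" .
qed

text \<open>The square contributes two tuples of distinct indices and the power of the sum an
  arbitrary one. Concatenated, they form a set of monomials of degree \<open>2 * s\<close> to which
  \<open>symmetrized_moment_bound\<close> applies.\<close>

lemma esym_mult_power_moment:
  fixes Z :: "'i \<Rightarrow> 'a \<Rightarrow> real"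
  assumes J: "finite J" and s: "s \<ge> 1" and k: "k \<le> s"
    and ind: "indep_vars (\<lambda>_. borel) Z J"
    and mean: "\<And>j. j \<in> J \<Longrightarrow> expectation (Z j) = 0"
    and int: "\<And>j. j \<in> J \<Longrightarrow> integrable M (\<lambda>\<omega>. \<bar>Z j \<omega>\<bar> ^ (2 * s))"
  shows "integrable M (\<lambda>\<omega>. (fact k * esym k J (\<lambda>j. Z j \<omega>))\<^sup>2 * (\<Sum>j\<in>J. Z j \<omega>) ^ (2 * (s - k)))"
    "expectation (\<lambda>\<omega>. (fact k * esym k J (\<lambda>j. Z j \<omega>))\<^sup>2 * (\<Sum>j\<in>J. Z j \<omega>) ^ (2 * (s - k)))
      \<le> 9 ^ s * sign_avg J (\<lambda>\<sigma>. expectation (\<lambda>\<omega>. (\<Sum>j\<in>J. \<sigma> j * Z j \<omega>) ^ (2 * s)))"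
proof -
  let ?P = "dtuples k J \<times> dtuples k J \<times> tuples (2 * (s - k)) J"
  define \<phi> where "\<phi> = (\<lambda>(a, b, c). a @ b @ c :: 'i list)"
  define A where "A = \<phi> ` ?P"
  \<comment> \<open>The three blocks can be recovered because the first two have fixed length
    \<open>k\<close>; so no monomial is counted twice.\<close>
  have inj: "inj_on \<phi> ?P"
    by (auto simp: inj_on_def \<phi>_def dtuples_def)
  have sub: "A \<subseteq> tuples (2 * s) J"
    using k by (auto simp: A_def \<phi>_def dtuples_def tuples_def)
  have eq: "(\<Sum>js\<in>A. prod_list (map z js)) = (fact k * esym k J z)\<^sup>2 * (\<Sum>j\<in>J. z j) ^ (2 * (s - k))" for z
  proof -
    have "(\<Sum>js\<in>A. prod_list (map z js)) = (\<Sum>(a, b, c)\<in>?P. prod_list (map z a) * (prod_list (map z b) * prod_list (map z c)))"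
      unfolding A_def by (subst sum.reindex[OF inj]) (auto intro!: sum.cong simp: \<phi>_def)
    also have "\<dots> = (\<Sum>a\<in>dtuples k J. \<Sum>b\<in>dtuples k J. \<Sum>c\<in>tuples (2 * (s - k)) J. prod_list (map z a) * (prod_list (map z b) * prod_list (map z c)))"
      by (simp add: sum.cartesian_product)
    also have "\<dots> = (\<Sum>a\<in>dtuples k J. prod_list (map z a)) * ((\<Sum>b\<in>dtuples k J. prod_list (map z b)) * (\<Sum>c\<in>tuples (2 * (s - k)) J. prod_list (map z c)))"
      by (simp only: sum_distrib_left[symmetric] sum_distrib_right[symmetric])
    finally show ?thesis
      unfolding sum_power_tuples[OF J, symmetric] sum_dtuples[OF J] by (simp add: power2_eq_square)
  qed
  show "integrable M (\<lambda>\<omega>. (fact k * esym k J (\<lambda>j. Z j \<omega>))\<^sup>2 * (\<Sum>j\<in>J. Z j \<omega>) ^ (2 * (s - k)))"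
    unfolding eq[symmetric] by (rule symmetrized_moment_bound(1)[OF J s ind mean int sub])
  show "expectation (\<lambda>\<omega>. (fact k * esym k J (\<lambda>j. Z j \<omega>))\<^sup>2 * (\<Sum>j\<in>J. Z j \<omega>) ^ (2 * (s - k)))
      \<le> 9 ^ s * sign_avg J (\<lambda>\<sigma>. expectation (\<lambda>\<omega>. (\<Sum>j\<in>J. \<sigma> j * Z j \<omega>) ^ (2 * s)))"
    unfolding eq[symmetric] by (rule symmetrized_moment_bound(2)[OF J s ind mean int sub])
qed

end

section \<open>Rademacher sums and orthogonality\<close>

text \<open>Passes from independence of the whole sign vector and the whole noise array to numerical
  functions of them, for which the product formula is available.\<close>

lemma (in prob_space) indep_rvs_compose:
  assumes "indep_rvs M S X T Y" and F: "F \<in> measurable S N" and G: "G \<in> measurable T L"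
  shows "indep_var N (\<lambda>\<omega>. F (X \<omega>)) L (\<lambda>\<omega>. G (Y \<omega>))"
proof -
  have X: "X \<in> measurable M S" and Y: "Y \<in> measurable M T"
    and ind: "indep_set (sigma_sets (space M) {X -` A \<inter> space M | A. A \<in> sets S})
       (sigma_sets (space M) {Y -` A \<inter> space M | A. A \<in> sets T})"
    using assms(1) unfolding indep_rvs_def by auto
  have sub: "sigma_sets (space M) {(\<lambda>\<omega>. H (Z \<omega>)) -` A \<inter> space M | A. A \<in> sets R}
     \<subseteq> sigma_sets (space M) {Z -` A \<inter> space M | A. A \<in> sets U}"
    if Z: "Z \<in> measurable M U" and H: "H \<in> measurable U R" for Z H U R
  proof (rule sigma_sets_mono, rule subsetI)
    fix B assume "B \<in> {(\<lambda>\<omega>. H (Z \<omega>)) -` A \<inter> space M | A. A \<in> sets R}"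
    then obtain A where A: "A \<in> sets R" "B = (\<lambda>\<omega>. H (Z \<omega>)) -` A \<inter> space M" by auto
    then have "B = Z -` (H -` A \<inter> space U) \<inter> space M"
      using measurable_space[OF Z] by auto
    moreover have "H -` A \<inter> space U \<in> sets U" using H A(1) by (rule measurable_sets)
    ultimately show "B \<in> sigma_sets (space M) {Z -` A \<inter> space M | A. A \<in> sets U}" by blast
  qed
  have "indep_set (sigma_sets (space M) {(\<lambda>\<omega>. F (X \<omega>)) -` A \<inter> space M | A. A \<in> sets N})
       (sigma_sets (space M) {(\<lambda>\<omega>. G (Y \<omega>)) -` A \<inter> space M | A. A \<in> sets L})"
  proof (rule indep_setI)
    show "sigma_sets (space M) {(\<lambda>\<omega>. F (X \<omega>)) -` A \<inter> space M | A. A \<in> sets N} \<subseteq> events"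
      using sub[OF X F] indep_setD_ev1[OF ind] by (rule subset_trans)
    show "sigma_sets (space M) {(\<lambda>\<omega>. G (Y \<omega>)) -` A \<inter> space M | A. A \<in> sets L} \<subseteq> events"
      using sub[OF Y G] indep_setD_ev2[OF ind] by (rule subset_trans)
  next
    fix a b
    assume "a \<in> sigma_sets (space M) {(\<lambda>\<omega>. F (X \<omega>)) -` A \<inter> space M | A. A \<in> sets N}"
      "b \<in> sigma_sets (space M) {(\<lambda>\<omega>. G (Y \<omega>)) -` A \<inter> space M | A. A \<in> sets L}"
    then show "prob (a \<inter> b) = prob a * prob b"
      using sub[OF X F] sub[OF Y G] by (intro indep_setD[OF ind]) auto
  qed
  then show ?thesis
    unfolding indep_var_eq using measurable_compose[OF X F] measurable_compose[OF Y G] by simp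
qed

lemma (in prob_space) indep_var_nn_integral_mult:
  fixes X Y :: "'a \<Rightarrow> ennreal"
  assumes "indep_var borel X borel Y"
  shows "(\<integral>\<^sup>+\<omega>. X \<omega> * Y \<omega> \<partial>M) = (\<integral>\<^sup>+\<omega>. X \<omega> \<partial>M) * (\<integral>\<^sup>+\<omega>. Y \<omega> \<partial>M)"
proof -
  have b: "case_bool borel borel = (\<lambda>_. borel)" by (auto simp: fun_eq_iff split: bool.split)
  have "indep_vars (\<lambda>_. borel) (case_bool X Y) UNIV"
    using assms unfolding indep_var_def b .
  from indep_vars_nn_integral[OF _ this] show ?thesis by (simp add: UNIV_bool mult.commute)
qed

text \<open>Split according to the realized sign pattern. On the event that it is
  \<open>\<sigma>\<close> the Rademacher sum is the sum with fixed signs \<open>\<sigma>\<close>,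
  and by independence this event contributes 2^(- card J) times the full moment. Since all terms are
  nonnegative, integrability for every single pattern follows as well.\<close>

lemma (in prob_space) rademacher_dominates_sign_avg:
  fixes \<epsilon> :: "nat \<Rightarrow> 'a \<Rightarrow> real^'d" and r :: "nat \<Rightarrow> 'a \<Rightarrow> real"
  assumes J: "finite J"
    and r: "rademacher M J r"
    and ind: "indep_rvs M (Pi\<^sub>M J (\<lambda>_. borel)) (\<lambda>\<omega>. \<lambda>j\<in>J. r j \<omega>) (Pi\<^sub>M J (\<lambda>_. borel)) (\<lambda>\<omega>. \<lambda>j\<in>J. \<epsilon> j \<omega>)"
    and int: "integrable M (\<lambda>\<omega>. (\<Sum>j\<in>J. r j \<omega> * \<epsilon> j \<omega> $ a) ^ (2 * k))"
  shows "\<And>\<sigma>. \<sigma> \<in> signs J \<Longrightarrow> integrable M (\<lambda>\<omega>. (\<Sum>j\<in>J. \<sigma> j * \<epsilon> j \<omega> $ a) ^ (2 * k))"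
    "sign_avg J (\<lambda>\<sigma>. expectation (\<lambda>\<omega>. (\<Sum>j\<in>J. \<sigma> j * \<epsilon> j \<omega> $ a) ^ (2 * k)))
      \<le> expectation (\<lambda>\<omega>. (\<Sum>j\<in>J. r j \<omega> * \<epsilon> j \<omega> $ a) ^ (2 * k))"
proof -
  have ri: "indep_vars (\<lambda>_. borel) r J"
    and rp: "\<And>j. j \<in> J \<Longrightarrow> measure M {\<omega> \<in> space M. r j \<omega> = 1} = 1 / 2"
      "\<And>j. j \<in> J \<Longrightarrow> measure M {\<omega> \<in> space M. r j \<omega> = - 1} = 1 / 2"
    using r unfolding rademacher_def by auto
  have [measurable]: "r j \<in> borel_measurable M" if "j \<in> J" for j
    using ri that by (auto simp: indep_vars_def)
  have em: "(\<lambda>\<omega>. \<lambda>j\<in>J. \<epsilon> j \<omega>) \<in> measurable M (Pi\<^sub>M J (\<lambda>_. borel))"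
    using ind unfolding indep_rvs_def by auto
  have [measurable]: "\<epsilon> j \<in> borel_measurable M" if j: "j \<in> J" for j
    using measurable_compose[OF em measurable_component_singleton[OF j]] j by simp
  have comp [measurable]: "(\<lambda>v::real^'d. v $ a) \<in> borel_measurable borel"
    by (intro borel_measurable_continuous_onI continuous_intros)
  define Y where "Y \<sigma> \<omega> = ennreal ((\<Sum>j\<in>J. \<sigma> j * \<epsilon> j \<omega> $ a) ^ (2 * k))" for \<sigma> \<omega>
  define Ir where "Ir \<sigma> \<omega> = (\<Prod>j\<in>J. indicator {\<sigma> j} (r j \<omega>) :: ennreal)" for \<sigma> \<omega>
  have Ym: "Y \<sigma> \<in> borel_measurable M" for \<sigma> unfolding Y_def by measurable
  have Im: "Ir \<sigma> \<in> borel_measurable M" for \<sigma> unfolding Ir_def by measurable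
  have eI: "(\<integral>\<^sup>+\<omega>. Ir \<sigma> \<omega> \<partial>M) = ennreal ((1 / 2) ^ card J)" if \<sigma>: "\<sigma> \<in> signs J" for \<sigma>
  proof -
    have "indep_vars (\<lambda>_. borel) (\<lambda>j \<omega>. indicator {\<sigma> j} (r j \<omega>) :: ennreal) J"
      by (rule indep_vars_compose2[OF ri, where Y="\<lambda>j x. indicator {\<sigma> j} x"]) measurable
    from indep_vars_nn_integral[OF J this]
    have "(\<integral>\<^sup>+\<omega>. Ir \<sigma> \<omega> \<partial>M) = (\<Prod>j\<in>J. \<integral>\<^sup>+\<omega>. indicator {\<sigma> j} (r j \<omega>) \<partial>M)" unfolding Ir_def by simp
    also have "\<dots> = (\<Prod>j\<in>J. ennreal (1 / 2))"
    proof (rule prod.cong[OF refl])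
      fix j assume j: "j \<in> J"
      have "(\<integral>\<^sup>+\<omega>. indicator {\<sigma> j} (r j \<omega>) \<partial>M) = (\<integral>\<^sup>+\<omega>. indicator {\<omega> \<in> space M. r j \<omega> = \<sigma> j} \<omega> \<partial>M)"
        by (intro nn_integral_cong) (auto simp: indicator_def)
      also have "\<dots> = emeasure M {\<omega> \<in> space M. r j \<omega> = \<sigma> j}"
        using j by (intro nn_integral_indicator) measurable
      also have "\<dots> = ennreal (1 / 2)"
      proof -
        have "\<sigma> j = -1 \<or> \<sigma> j = 1" using \<sigma> j by auto
        then have "prob {\<omega> \<in> space M. r j \<omega> = \<sigma> j} = 1 / 2" using rp[OF j] by auto
        then show ?thesis by (simp only: emeasure_eq_measure)
      qed
      finally show "(\<integral>\<^sup>+\<omega>. indicator {\<sigma> j} (r j \<omega>) \<partial>M) = ennreal (1 / 2)" .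
    qed
    also have "\<dots> = ennreal ((1 / 2) ^ card J)" by (subst prod_constant, rule ennreal_power) simp
    finally show ?thesis .
  qed
  have split: "(\<integral>\<^sup>+\<omega>. Ir \<sigma> \<omega> * Y \<sigma> \<omega> \<partial>M) = ennreal ((1 / 2) ^ card J) * (\<integral>\<^sup>+\<omega>. Y \<sigma> \<omega> \<partial>M)"
    if \<sigma>: "\<sigma> \<in> signs J" for \<sigma>
  proof -
    define F where "F \<rho> = (\<Prod>j\<in>J. indicator {\<sigma> j} (\<rho> j) :: ennreal)" for \<rho> :: "nat \<Rightarrow> real"
    define G where "G e = ennreal ((\<Sum>j\<in>J. \<sigma> j * e j $ a) ^ (2 * k))" for e :: "nat \<Rightarrow> real^'d"
    have Fm: "F \<in> borel_measurable (Pi\<^sub>M J (\<lambda>_. borel))"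
      unfolding F_def by (intro borel_measurable_prod_ennreal measurable_compose[OF measurable_component_singleton]) auto
    have em: "(\<lambda>e. e j $ a) \<in> borel_measurable (Pi\<^sub>M J (\<lambda>_. borel :: (real^'d) measure))" if "j \<in> J" for j
      by (rule measurable_compose[OF measurable_component_singleton[OF that] comp])
    have Gm: "G \<in> borel_measurable (Pi\<^sub>M J (\<lambda>_. borel))"
      unfolding G_def
      by (intro measurable_compose[OF _ measurable_ennreal] borel_measurable_power borel_measurable_sum borel_measurable_times
          borel_measurable_const em)
    have "indep_var borel (\<lambda>\<omega>. F (\<lambda>j\<in>J. r j \<omega>)) borel (\<lambda>\<omega>. G (\<lambda>j\<in>J. \<epsilon> j \<omega>))"
      by (rule indep_rvs_compose[OF ind Fm Gm])
    also have "(\<lambda>\<omega>. F (\<lambda>j\<in>J. r j \<omega>)) = Ir \<sigma>"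
      unfolding F_def Ir_def by (intro ext prod.cong refl) simp
    also have "(\<lambda>\<omega>. G (\<lambda>j\<in>J. \<epsilon> j \<omega>)) = Y \<sigma>"
      unfolding G_def Y_def by (simp cong: sum.cong)
    finally have "indep_var borel (Ir \<sigma>) borel (Y \<sigma>)" .
    from indep_var_nn_integral_mult[OF this] show ?thesis unfolding eI[OF \<sigma>] .
  qed
  let ?R = "\<lambda>\<omega>. (\<Sum>j\<in>J. r j \<omega> * \<epsilon> j \<omega> $ a) ^ (2 * k)"
  \<comment> \<open>At each \<open>\<omega>\<close> at most one pattern is realized, so the
    indicators add up to at most 1; points where some \<open>r j\<close> is not a sign are absorbed
    by the inequality.\<close>
  have pw: "(\<Sum>\<sigma>\<in>signs J. Ir \<sigma> \<omega> * Y \<sigma> \<omega>) \<le> ennreal (?R \<omega>)" for \<omega>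
  proof -
    have "(\<Sum>\<sigma>\<in>signs J. Ir \<sigma> \<omega> * Y \<sigma> \<omega>) = (\<Sum>\<sigma>\<in>signs J. Ir \<sigma> \<omega> * ennreal (?R \<omega>))"
    proof (rule sum.cong[OF refl])
      fix \<sigma>
      show "Ir \<sigma> \<omega> * Y \<sigma> \<omega> = Ir \<sigma> \<omega> * ennreal (?R \<omega>)"
      proof (cases "\<forall>j\<in>J. r j \<omega> = \<sigma> j")
        case True
        then show ?thesis unfolding Y_def by simp
      next
        case False
        then obtain i where "i \<in> J" "r i \<omega> \<noteq> \<sigma> i" by blast
        then have "Ir \<sigma> \<omega> = 0" unfolding Ir_def by (intro prod_zero[OF J] bexI[of _ i]) simp_all
        then show ?thesis by simp
      qed
    qed
    also have "\<dots> = (\<Sum>\<sigma>\<in>signs J. Ir \<sigma> \<omega>) * ennreal (?R \<omega>)" by (simp add: sum_distrib_right)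
    finally have eqR: "(\<Sum>\<sigma>\<in>signs J. Ir \<sigma> \<omega> * Y \<sigma> \<omega>) = (\<Sum>\<sigma>\<in>signs J. Ir \<sigma> \<omega>) * ennreal (?R \<omega>)" .
    have "(\<Sum>\<sigma>\<in>signs J. Ir \<sigma> \<omega>) = (\<Prod>j\<in>J. \<Sum>b\<in>{-1,1}. indicator {b} (r j \<omega>))"
      unfolding Ir_def using J by (intro prod_sum_PiE[symmetric]) auto
    also have "\<dots> \<le> 1"
    proof -
      have "(\<Sum>b\<in>{-1,1}. f b) = f (-1) + f 1" for f :: "real \<Rightarrow> ennreal" by simp
      then have "(\<Sum>b\<in>{-1,1}. indicator {b} x :: ennreal) \<le> 1" for x :: real by (simp only:) (auto simp: indicator_def)
      then have "(\<Prod>j\<in>J. \<Sum>b\<in>{-1,1}. indicator {b} (r j \<omega>) :: ennreal) \<le> (\<Prod>j\<in>J. 1)"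
        by (intro prod_mono_ennreal)
      then show ?thesis by simp
    qed
    finally have "(\<Sum>\<sigma>\<in>signs J. Ir \<sigma> \<omega>) * ennreal (?R \<omega>) \<le> 1 * ennreal (?R \<omega>)"
      by (rule mult_right_mono) simp
    then show ?thesis using eqR by simp
  qed
  have iR: "(\<integral>\<^sup>+\<omega>. ennreal (?R \<omega>) \<partial>M) = ennreal (expectation ?R)"
    by (intro nn_integral_eq_integral int) simp
  have tot: "(\<Sum>\<sigma>\<in>signs J. ennreal ((1 / 2) ^ card J) * (\<integral>\<^sup>+\<omega>. Y \<sigma> \<omega> \<partial>M)) \<le> ennreal (expectation ?R)"
  proof -
    have "(\<Sum>\<sigma>\<in>signs J. ennreal ((1 / 2) ^ card J) * (\<integral>\<^sup>+\<omega>. Y \<sigma> \<omega> \<partial>M)) = (\<Sum>\<sigma>\<in>signs J. \<integral>\<^sup>+\<omega>. Ir \<sigma> \<omega> * Y \<sigma> \<omega> \<partial>M)"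
      by (intro sum.cong refl split[symmetric])
    also have "\<dots> = (\<integral>\<^sup>+\<omega>. (\<Sum>\<sigma>\<in>signs J. Ir \<sigma> \<omega> * Y \<sigma> \<omega>) \<partial>M)"
      using Ym Im by (intro nn_integral_sum[symmetric]) auto
    also have "\<dots> \<le> (\<integral>\<^sup>+\<omega>. ennreal (?R \<omega>) \<partial>M)" by (intro nn_integral_mono pw)
    finally show ?thesis unfolding iR .
  qed
  have fS: "finite (signs J)" using J by (intro finite_PiE) auto
  show iY: "integrable M (\<lambda>\<omega>. (\<Sum>j\<in>J. \<sigma> j * \<epsilon> j \<omega> $ a) ^ (2 * k))" if \<sigma>: "\<sigma> \<in> signs J" for \<sigma>
  proof (rule integrableI_nonneg)
    have "ennreal ((1 / 2) ^ card J) * (\<integral>\<^sup>+\<omega>. Y \<sigma> \<omega> \<partial>M) \<le> (\<Sum>\<sigma>\<in>signs J. ennreal ((1 / 2) ^ card J) * (\<integral>\<^sup>+\<omega>. Y \<sigma> \<omega> \<partial>M))"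
      using fS \<sigma> by (intro member_le_sum) auto
    also note tot
    finally have "ennreal ((1 / 2) ^ card J) * (\<integral>\<^sup>+\<omega>. Y \<sigma> \<omega> \<partial>M) < \<infinity>" by (rule le_less_trans) simp
    moreover have "ennreal ((1 / 2) ^ card J) \<noteq> 0" by (simp only: ennreal_eq_0_iff) (simp add: not_le)
    ultimately show "(\<integral>\<^sup>+\<omega>. ennreal ((\<Sum>j\<in>J. \<sigma> j * \<epsilon> j \<omega> $ a) ^ (2 * k)) \<partial>M) < \<infinity>"
      unfolding Y_def by (auto simp: ennreal_mult_less_top)
  qed (auto, measurable)
  have "ennreal (sign_avg J (\<lambda>\<sigma>. expectation (\<lambda>\<omega>. (\<Sum>j\<in>J. \<sigma> j * \<epsilon> j \<omega> $ a) ^ (2 * k))))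
     = ennreal (\<Sum>\<sigma>\<in>signs J. (1 / 2) ^ card J * expectation (\<lambda>\<omega>. (\<Sum>j\<in>J. \<sigma> j * \<epsilon> j \<omega> $ a) ^ (2 * k)))"
    unfolding sign_avg_def by (simp add: sum_divide_distrib power_divide)
  also have "\<dots> = (\<Sum>\<sigma>\<in>signs J. ennreal ((1 / 2) ^ card J * expectation (\<lambda>\<omega>. (\<Sum>j\<in>J. \<sigma> j * \<epsilon> j \<omega> $ a) ^ (2 * k))))"
    by (intro sum_ennreal[symmetric] mult_nonneg_nonneg Bochner_Integration.integral_nonneg) auto
  also have "\<dots> = (\<Sum>\<sigma>\<in>signs J. ennreal ((1 / 2) ^ card J) * (\<integral>\<^sup>+\<omega>. Y \<sigma> \<omega> \<partial>M))"
    unfolding Y_def using iY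
    by (intro sum.cong refl) (subst nn_integral_eq_integral, auto intro!: ennreal_mult Bochner_Integration.integral_nonneg)
  also note tot
  finally show "sign_avg J (\<lambda>\<sigma>. expectation (\<lambda>\<omega>. (\<Sum>j\<in>J. \<sigma> j * \<epsilon> j \<omega> $ a) ^ (2 * k))) \<le> expectation ?R"
    by (subst (asm) ennreal_le_iff) (auto intro!: Bochner_Integration.integral_nonneg)
qed

text \<open>Flipping one sign changes the sum by twice that summand, so two patterns control each
  variable. In this way the hypothesis on Rademacher sums yields high moments of the single noise
  variables.\<close>

lemma (in prob_space) integrable_power_of_sign_sums:
  fixes Z :: "'i \<Rightarrow> 'a \<Rightarrow> real"
  assumes J: "finite J" and i: "i \<in> J" and [measurable]: "Z i \<in> borel_measurable M"
    and int: "\<And>\<sigma>. \<sigma> \<in> signs J \<Longrightarrow> integrable M (\<lambda>\<omega>. (\<Sum>j\<in>J. \<sigma> j * Z j \<omega>) ^ (2 * s))"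
  shows "integrable M (\<lambda>\<omega>. \<bar>Z i \<omega>\<bar> ^ (2 * s))"
proof -
  define \<sigma> where "\<sigma> = (\<lambda>j\<in>J. 1::real)"
  define \<tau> where "\<tau> = (\<lambda>j\<in>J. if j = i then -1 else 1::real)"
  let ?A = "\<lambda>\<omega>. \<Sum>j\<in>J. \<sigma> j * Z j \<omega>" and ?B = "\<lambda>\<omega>. \<Sum>j\<in>J. \<tau> j * Z j \<omega>"
  have sg: "\<sigma> \<in> signs J" "\<tau> \<in> signs J" unfolding \<sigma>_def \<tau>_def by auto
  have ab: "integrable M (\<lambda>\<omega>. ?A \<omega> ^ (2 * s) + ?B \<omega> ^ (2 * s))"
    by (intro Bochner_Integration.integrable_add int sg)
  show ?thesis
  proof (rule Bochner_Integration.integrable_bound[OF ab])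
    show "AE \<omega> in M. norm (\<bar>Z i \<omega>\<bar> ^ (2 * s)) \<le> norm (?A \<omega> ^ (2 * s) + ?B \<omega> ^ (2 * s))"
    proof (rule AE_I2)
      fix \<omega>
      have "?A \<omega> - ?B \<omega> = (\<Sum>j\<in>J. if j = i then 2 * Z i \<omega> else 0)"
        unfolding sum_subtractf[symmetric] by (intro sum.cong refl) (auto simp: \<sigma>_def \<tau>_def)
      also have "\<dots> = 2 * Z i \<omega>" using J i by simp
      finally have "2 * \<bar>Z i \<omega>\<bar> \<le> \<bar>?A \<omega>\<bar> + \<bar>?B \<omega>\<bar>" by linarith
      then have "\<bar>Z i \<omega>\<bar> \<le> max \<bar>?A \<omega>\<bar> \<bar>?B \<omega>\<bar>" by linarith
      then have "\<bar>Z i \<omega>\<bar> ^ (2 * s) \<le> (max \<bar>?A \<omega>\<bar> \<bar>?B \<omega>\<bar>) ^ (2 * s)" by (rule power_mono) simp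
      also have "\<dots> \<le> ?A \<omega> ^ (2 * s) + ?B \<omega> ^ (2 * s)"
        by (simp add: max_def power_even_abs)
      finally show "norm (\<bar>Z i \<omega>\<bar> ^ (2 * s)) \<le> norm (?A \<omega> ^ (2 * s) + ?B \<omega> ^ (2 * s))" by simp
    qed
  qed measurable
qed

lemma (in prob_space) orthogonal_sum_second_moment:
  fixes Y :: "'i \<Rightarrow> 'a \<Rightarrow> real" and c :: "'i \<Rightarrow> complex"
  assumes I: "finite I"
    and int: "\<And>i j. i \<in> I \<Longrightarrow> j \<in> I \<Longrightarrow> integrable M (\<lambda>\<omega>. Y i \<omega> * Y j \<omega>)"
    and orth: "\<And>i j. i \<in> I \<Longrightarrow> j \<in> I \<Longrightarrow> i \<noteq> j \<Longrightarrow> expectation (\<lambda>\<omega>. Y i \<omega> * Y j \<omega>) = 0"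
  shows "integrable M (\<lambda>\<omega>. (norm (\<Sum>i\<in>I. c i * complex_of_real (Y i \<omega>)))\<^sup>2)"
    "expectation (\<lambda>\<omega>. (norm (\<Sum>i\<in>I. c i * complex_of_real (Y i \<omega>)))\<^sup>2)
      = (\<Sum>i\<in>I. (norm (c i))\<^sup>2 * expectation (\<lambda>\<omega>. (Y i \<omega>)\<^sup>2))"
proof -
  \<comment> \<open>The real part of \<open>c i\<close> times the conjugate of
    \<open>c j\<close>.\<close>
  define w where "w i j = Re (c i) * Re (c j) + Im (c i) * Im (c j)" for i j
  have eq: "(norm (\<Sum>i\<in>I. c i * complex_of_real (Y i \<omega>)))\<^sup>2 = (\<Sum>i\<in>I. \<Sum>j\<in>I. w i j * (Y i \<omega> * Y j \<omega>))" for \<omega>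
    unfolding cmod_power2 Re_sum Im_sum w_def
    by (simp add: power2_eq_square sum_product sum.distrib[symmetric] algebra_simps)
  have ww: "w i i = (norm (c i))\<^sup>2" for i unfolding w_def cmod_power2 by (simp add: power2_eq_square)
  show "integrable M (\<lambda>\<omega>. (norm (\<Sum>i\<in>I. c i * complex_of_real (Y i \<omega>)))\<^sup>2)"
    unfolding eq by (intro Bochner_Integration.integrable_sum integrable_mult_right int)
  have "expectation (\<lambda>\<omega>. (norm (\<Sum>i\<in>I. c i * complex_of_real (Y i \<omega>)))\<^sup>2)
     = (\<Sum>i\<in>I. \<Sum>j\<in>I. w i j * expectation (\<lambda>\<omega>. Y i \<omega> * Y j \<omega>))"
    unfolding eq by (simp add: Bochner_Integration.integral_sum int)
  also have "\<dots> = (\<Sum>i\<in>I. \<Sum>j\<in>I. if j = i then w i i * expectation (\<lambda>\<omega>. Y i \<omega> * Y i \<omega>) else 0)"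
    using orth by (intro sum.cong refl) auto
  also have "\<dots> = (\<Sum>i\<in>I. (norm (c i))\<^sup>2 * expectation (\<lambda>\<omega>. (Y i \<omega>)\<^sup>2))"
    using I by (simp add: ww power2_eq_square)
  finally show "expectation (\<lambda>\<omega>. (norm (\<Sum>i\<in>I. c i * complex_of_real (Y i \<omega>)))\<^sup>2)
      = (\<Sum>i\<in>I. (norm (c i))\<^sup>2 * expectation (\<lambda>\<omega>. (Y i \<omega>)\<^sup>2))" .
qed

text \<open>If the index sets differ, an index in only one of them contributes a centred factor. If
  they agree, the coordinates differ and any index contributes a vanishing covariance. Independence
  acts across observations; within one observation only uncorrelatedness is used.\<close>

lemma (in prob_space) coordinate_products_orthogonal:
  fixes \<epsilon> :: "nat \<Rightarrow> 'a \<Rightarrow> real^'d"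
  assumes J: "finite J" and ind: "indep_vars (\<lambda>_. borel) \<epsilon> J"
    and mean: "\<And>j a. j \<in> J \<Longrightarrow> integrable M (\<lambda>\<omega>. \<epsilon> j \<omega> $ a) \<and> expectation (\<lambda>\<omega>. \<epsilon> j \<omega> $ a) = 0"
    and cov: "\<And>j a b. j \<in> J \<Longrightarrow> integrable M (\<lambda>\<omega>. \<epsilon> j \<omega> $ a * \<epsilon> j \<omega> $ b)"
      "\<And>j a b. j \<in> J \<Longrightarrow> a \<noteq> b \<Longrightarrow> expectation (\<lambda>\<omega>. \<epsilon> j \<omega> $ a * \<epsilon> j \<omega> $ b) = 0"
    and S: "S \<subseteq> J" "S \<noteq> {}" and T: "T \<subseteq> J" "T \<noteq> {}"
  shows "integrable M (\<lambda>\<omega>. (\<Prod>j\<in>S. \<epsilon> j \<omega> $ a) * (\<Prod>j\<in>T. \<epsilon> j \<omega> $ b))"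
    "(a, S) \<noteq> (b, T) \<Longrightarrow> expectation (\<lambda>\<omega>. (\<Prod>j\<in>S. \<epsilon> j \<omega> $ a) * (\<Prod>j\<in>T. \<epsilon> j \<omega> $ b)) = 0"
    "expectation (\<lambda>\<omega>. (\<Prod>j\<in>S. \<epsilon> j \<omega> $ a)\<^sup>2) = (\<Prod>j\<in>S. expectation (\<lambda>\<omega>. (\<epsilon> j \<omega> $ a)\<^sup>2))"
proof -
  \<comment> \<open>Both products are extended to all of \<open>J\<close> by factors 1, so that one
    product over independent variables covers every combination of \<open>S\<close> and
    \<open>T\<close>.\<close>
  define g where "g a b S T j v = (if j \<in> S then v $ a else 1) * (if j \<in> T then v $ b else 1)"
    for a b S T and j :: nat and v :: "real^'d"
  have comp [measurable]: "(\<lambda>v::real^'d. v $ a) \<in> borel_measurable borel" for a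
    by (intro borel_measurable_continuous_onI continuous_intros)
  have gm: "g a b S T j \<in> borel_measurable borel" for a b S T j
    unfolding g_def by (cases "j \<in> S"; cases "j \<in> T") (simp_all, measurable)
  have eq: "(\<Prod>j\<in>S. \<epsilon> j \<omega> $ a) * (\<Prod>j\<in>T. \<epsilon> j \<omega> $ b) = (\<Prod>j\<in>J. g a b S T j (\<epsilon> j \<omega>))"
    if "S \<subseteq> J" "T \<subseteq> J" for S T a b \<omega>
  proof -
    have e: "(\<Prod>j\<in>S. f j) = (\<Prod>j\<in>J. if j \<in> S then f j else 1)" if "S \<subseteq> J" for S and f :: "nat \<Rightarrow> real"
      using J that by (simp add: prod.inter_restrict[symmetric] Int_absorb1)
    show ?thesis unfolding g_def prod.distrib e[OF that(1)] e[OF that(2)] ..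
  qed
  have gi: "indep_vars (\<lambda>_. borel) (\<lambda>j \<omega>. g a b S T j (\<epsilon> j \<omega>)) J" for a b S T
    by (rule indep_vars_compose2[OF ind gm])
  have gint: "integrable M (\<lambda>\<omega>. g a b S T j (\<epsilon> j \<omega>))" if "j \<in> J" for j a b S T
    unfolding g_def using mean[OF that] cov(1)[OF that] by (cases "j \<in> S"; cases "j \<in> T") simp_all
  have ep: "expectation (\<lambda>\<omega>. (\<Prod>j\<in>S. \<epsilon> j \<omega> $ a) * (\<Prod>j\<in>T. \<epsilon> j \<omega> $ b)) = (\<Prod>j\<in>J. expectation (\<lambda>\<omega>. g a b S T j (\<epsilon> j \<omega>)))"
    if "S \<subseteq> J" "T \<subseteq> J" for S T a b
    unfolding eq[OF that] by (rule indep_vars_lebesgue_integral[OF J gi gint])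
  show "integrable M (\<lambda>\<omega>. (\<Prod>j\<in>S. \<epsilon> j \<omega> $ a) * (\<Prod>j\<in>T. \<epsilon> j \<omega> $ b))"
    unfolding eq[OF S(1) T(1)] by (rule indep_vars_integrable[OF J gi gint])
  show "expectation (\<lambda>\<omega>. (\<Prod>j\<in>S. \<epsilon> j \<omega> $ a) * (\<Prod>j\<in>T. \<epsilon> j \<omega> $ b)) = 0" if ne: "(a, S) \<noteq> (b, T)"
  proof -
    have "\<exists>j\<in>J. expectation (\<lambda>\<omega>. g a b S T j (\<epsilon> j \<omega>)) = 0"
    proof (cases "S = T")
      case True
      then have "a \<noteq> b" using ne by simp
      obtain j where "j \<in> S" using S by auto
      then show ?thesis using True S cov(2)[OF _ \<open>a \<noteq> b\<close>] by (intro bexI[of _ j]) (auto simp: g_def)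
    next
      case False
      then obtain j where j: "j \<in> J" "(j \<in> S \<and> j \<notin> T) \<or> (j \<in> T \<and> j \<notin> S)" using S T by blast
      then show ?thesis using mean[OF j(1)] by (intro bexI[of _ j]) (auto simp: g_def)
    qed
    then show ?thesis unfolding ep[OF S(1) T(1)] using J by (intro prod_zero) auto
  qed
  have "expectation (\<lambda>\<omega>. (\<Prod>j\<in>S. \<epsilon> j \<omega> $ a)\<^sup>2) = (\<Prod>j\<in>J. expectation (\<lambda>\<omega>. g a a S S j (\<epsilon> j \<omega>)))"
    unfolding power2_eq_square by (rule ep[OF S(1) S(1)])
  also have "\<dots> = (\<Prod>j\<in>J. if j \<in> S then expectation (\<lambda>\<omega>. (\<epsilon> j \<omega> $ a)\<^sup>2) else 1)"
    by (intro prod.cong refl) (auto simp: g_def power2_eq_square prob_space)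
  also have "\<dots> = (\<Prod>j\<in>S. expectation (\<lambda>\<omega>. (\<epsilon> j \<omega> $ a)\<^sup>2))"
    using J S by (simp add: prod.inter_restrict[symmetric] Int_absorb1)
  finally show "expectation (\<lambda>\<omega>. (\<Prod>j\<in>S. \<epsilon> j \<omega> $ a)\<^sup>2) = (\<Prod>j\<in>S. expectation (\<lambda>\<omega>. (\<epsilon> j \<omega> $ a)\<^sup>2))" .
qed

section \<open>Taylor expansion with U-statistics\<close>

text \<open>When \<open>u i\<close> is the normalized elementary symmetric polynomial of order
  \<open>i\<close>, this is the U-statistic of order \<open>k\<close> recentred at \<open>t\<close>,
  by \<open>esym_shift_normalized\<close>.\<close>

definition appell :: "(nat \<Rightarrow> real) \<Rightarrow> nat \<Rightarrow> real \<Rightarrow> real" where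
  "appell u k t = (\<Sum>i\<le>k. real (k choose i) * u i * (- t) ^ (k - i))"

lemma appell_0_right: "appell u k 0 = u k"
proof -
  have "appell u k 0 = (\<Sum>i\<le>k. if i = k then u k else 0)"
    unfolding appell_def by (intro sum.cong refl) auto
  then show ?thesis by simp
qed

lemma appell_has_derivative:
  "(appell u (Suc k) has_real_derivative - real (Suc k) * appell u k t) (at t)"
proof -
  have "(appell u (Suc k) has_real_derivative
      (\<Sum>i\<le>Suc k. real (Suc k choose i) * u i * (real (Suc k - i) * (- 1) * (- t) ^ (Suc k - i - 1)))) (at t)"
    unfolding appell_def by (auto intro!: derivative_eq_intros sum.cong simp: algebra_simps)
  also have "(\<Sum>i\<le>Suc k. real (Suc k choose i) * u i * (real (Suc k - i) * (- 1) * (- t) ^ (Suc k - i - 1)))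
     = (\<Sum>i\<le>k. real (Suc k choose i) * u i * (real (Suc k - i) * (- 1) * (- t) ^ (Suc k - i - 1)))"
    by simp
  also have "\<dots> = (\<Sum>i\<le>k. - real (Suc k) * (real (k choose i) * u i * (- t) ^ (k - i)))"
  proof (rule sum.cong[OF refl])
    fix i
    have "(Suc k - i) * (Suc k choose i) = Suc k * (k choose i)"
      using binomial_absorb_comp[of "Suc k" i] by simp
    then have "real (Suc k - i) * real (Suc k choose i) = real (Suc k) * real (k choose i)"
      by (simp only: of_nat_mult[symmetric])
    then have "real (Suc k - i) * real (Suc k choose i) * (- (u i * (- t) ^ (k - i))) = real (Suc k) * real (k choose i) * (- (u i * (- t) ^ (k - i)))"
      by (rule arg_cong)
    then show "real (Suc k choose i) * u i * (real (Suc k - i) * (- 1) * (- t) ^ (Suc k - i - 1)) = - real (Suc k) * (real (k choose i) * u i * (- t) ^ (k - i))"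
      by (simp add: ac_simps del: of_nat_Suc)
  qed
  also have "\<dots> = - real (Suc k) * appell u k t" unfolding appell_def by (simp only: sum_distrib_left)
  finally show ?thesis .
qed

lemma abs_appell_le:
  assumes "\<bar>t\<bar> \<le> b"
  shows "\<bar>appell u k t\<bar> \<le> (\<Sum>i\<le>k. real (k choose i) * \<bar>u i\<bar> * b ^ (k - i))"
proof -
  have "\<bar>appell u k t\<bar> \<le> (\<Sum>i\<le>k. \<bar>real (k choose i) * u i * (- t) ^ (k - i)\<bar>)"
    unfolding appell_def by (rule sum_abs)
  also have "\<dots> \<le> (\<Sum>i\<le>k. real (k choose i) * \<bar>u i\<bar> * b ^ (k - i))"
    using assms by (intro sum_mono) (auto simp: abs_mult power_abs intro!: mult_left_mono power_mono)
  finally show ?thesis .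
qed

definition corrected_taylor :: "(nat \<Rightarrow> real \<Rightarrow> complex) \<Rightarrow> (nat \<Rightarrow> real) \<Rightarrow> real \<Rightarrow> nat \<Rightarrow> real \<Rightarrow> complex" where
  "corrected_taylor D u x m t = (\<Sum>k\<le>m. D k (x + t) * complex_of_real (appell u k t) / fact k)"

text \<open>The derivative telescopes, because the polynomials \<^term>\<open>appell u k\<close> form an Appell sequence.\<close>

lemma corrected_taylor_has_derivative:
  assumes D: "\<And>k x. (D k has_vector_derivative D (Suc k) x) (at x)"
  shows "(corrected_taylor D u x m has_vector_derivative
      D (Suc m) (x + t) * complex_of_real (appell u m t) / fact m) (at t)"
proof (induction m)
  have Dsh: "((\<lambda>t. D k (x + t)) has_vector_derivative D (Suc k) (x + t)) (at t)" for k
  proof -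
    have "((\<lambda>t. x + t) has_vector_derivative 1) (at t)"
      by (auto intro!: derivative_eq_intros simp: has_real_derivative_iff_has_vector_derivative[symmetric])
    from vector_diff_chain_at[OF this D[of k "x + t"]] show ?thesis by (simp add: comp_def)
  qed
  {
    case 0
    have "corrected_taylor D u x 0 = (\<lambda>t. D 0 (x + t) * complex_of_real (u 0))"
      by (simp add: corrected_taylor_def appell_def fun_eq_iff)
    moreover have "((\<lambda>t. D 0 (x + t) * complex_of_real (u 0)) has_vector_derivative D (Suc 0) (x + t) * complex_of_real (u 0)) (at t)"
      by (intro has_vector_derivative_mult_left Dsh)
    ultimately show ?case by (simp add: appell_def)
  next
    case (Suc m)
    have ap: "((\<lambda>t. complex_of_real (appell u (Suc m) t)) has_vector_derivative complex_of_real (- real (Suc m) * appell u m t)) (at t)"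
      using appell_has_derivative[of u m t]
      by (intro has_vector_derivative_of_real) (simp add: has_real_derivative_iff_has_vector_derivative)
    have eq: "corrected_taylor D u x (Suc m) = (\<lambda>t. corrected_taylor D u x m t + (1 / fact (Suc m)) * (D (Suc m) (x + t) * complex_of_real (appell u (Suc m) t)))"
      by (simp add: corrected_taylor_def fun_eq_iff)
    have "(corrected_taylor D u x (Suc m) has_vector_derivative
       D (Suc m) (x + t) * complex_of_real (appell u m t) / fact m + (1 / fact (Suc m)) *
        (D (Suc m) (x + t) * complex_of_real (- real (Suc m) * appell u m t) + D (Suc (Suc m)) (x + t) * complex_of_real (appell u (Suc m) t))) (at t)"
      unfolding eq by (intro has_vector_derivative_add Suc has_vector_derivative_mult_right has_vector_derivative_mult Dsh ap)
    also have "(1 / fact (Suc m)) *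
        (D (Suc m) (x + t) * complex_of_real (- real (Suc m) * appell u m t) + D (Suc (Suc m)) (x + t) * complex_of_real (appell u (Suc m) t))
       = - (D (Suc m) (x + t) * complex_of_real (appell u m t) / fact m) + D (Suc (Suc m)) (x + t) * complex_of_real (appell u (Suc m) t) / fact (Suc m)"
    proof -
      have f: "(fact (Suc m) :: complex) = of_real (real (Suc m)) * fact m" by (simp only: fact_Suc of_real_of_nat_eq)
      have nz: "(of_real (real (Suc m)) :: complex) \<noteq> 0" by (simp del: of_nat_Suc)
      have "(1 / fact (Suc m)) * (D (Suc m) (x + t) * complex_of_real (- real (Suc m) * appell u m t))
         = - (D (Suc m) (x + t) * complex_of_real (appell u m t) / fact m)"
        unfolding f using nz by (simp del: of_nat_Suc)
      then show ?thesis by (simp only: distrib_left mult_1_left times_divide_eq_left)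
    qed
    finally show ?case by (simp only: add_uminus_conv_diff add_diff_cancel_left' add.assoc[symmetric] diff_self add_0_left right_minus)
  }
qed

text \<open>Mean value inequality on the segment from 0 to \<open>t\<close>. The additional factor
  \<open>\<bar>t\<bar>\<close> makes every term homogeneous of degree \<open>Suc m\<close>: one
  U-statistic times a power of the mean.\<close>

lemma corrected_taylor_increment:
  assumes D: "\<And>k x. (D k has_vector_derivative D (Suc k) x) (at x)"
    and B: "\<And>x. norm (D (Suc m) x) \<le> B"
  shows "norm (corrected_taylor D u x m t - corrected_taylor D u x m 0)
     \<le> B / fact m * (\<Sum>i\<le>m. real (m choose i) * (\<bar>u i\<bar> * \<bar>t\<bar> ^ (Suc m - i)))"
proof -
  let ?S = "\<Sum>i\<le>m. real (m choose i) * \<bar>u i\<bar> * \<bar>t\<bar> ^ (m - i)"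
  have B0: "B \<ge> 0" using B[of 0] norm_ge_zero order_trans by blast
  have "norm (corrected_taylor D u x m t - corrected_taylor D u x m 0) \<le> (B / fact m * ?S) * norm (t - 0)"
  proof (rule differentiable_bound[where S="closed_segment 0 t"])
    fix y assume y: "y \<in> closed_segment 0 t"
    then have "\<bar>y\<bar> \<le> \<bar>t\<bar>" by (auto simp: closed_segment_eq_real_ivl split: if_splits)
    then have V: "\<bar>appell u m y\<bar> \<le> ?S" by (rule abs_appell_le)
    let ?v = "D (Suc m) (x + y) * complex_of_real (appell u m y) / fact m"
    have "(corrected_taylor D u x m has_vector_derivative ?v) (at y)"
      by (rule corrected_taylor_has_derivative) (rule D)
    then show "(corrected_taylor D u x m has_derivative (\<lambda>h. h *\<^sub>R ?v)) (at y within closed_segment 0 t)"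
      unfolding has_vector_derivative_def by (rule has_derivative_at_withinI)
    have "norm ?v = norm (D (Suc m) (x + y)) * \<bar>appell u m y\<bar> / fact m"
      by (simp add: norm_mult norm_divide)
    also have "\<dots> \<le> B * ?S / fact m"
      by (intro divide_right_mono mult_mono B V B0) auto
    finally have v: "norm ?v \<le> B / fact m * ?S" by simp
    show "onorm (\<lambda>h. h *\<^sub>R ?v) \<le> B / fact m * ?S"
    proof (rule onorm_bound)
      show "0 \<le> B / fact m * ?S" by (rule order_trans[OF norm_ge_zero v])
      show "norm (h *\<^sub>R ?v) \<le> B / fact m * ?S * norm h" for h
        using mult_left_mono[OF v, of "\<bar>h\<bar>"] by (simp add: mult.commute)
    qed
  qed auto
  also have "\<dots> = B / fact m * (?S * \<bar>t\<bar>)" by simp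
  also have "?S * \<bar>t\<bar> = (\<Sum>i\<le>m. real (m choose i) * (\<bar>u i\<bar> * \<bar>t\<bar> ^ (Suc m - i)))"
    unfolding sum_distrib_right by (intro sum.cong refl) (simp add: Suc_diff_le)
  finally show ?thesis .
qed

section \<open>Numerical inequalities\<close>

lemma prod_one_minus_ge:
  fixes a :: "nat \<Rightarrow> real"
  assumes "\<And>i. i < k \<Longrightarrow> 0 \<le> a i \<and> a i \<le> 1"
  shows "1 - (\<Sum>i<k. a i) \<le> (\<Prod>i<k. 1 - a i)" "0 \<le> (\<Prod>i<k. 1 - a i) \<and> (\<Prod>i<k. 1 - a i) \<le> 1"
  using assms
proof (induction k)
  case (Suc k)
  {
    case 1
    have IH: "1 - (\<Sum>i<k. a i) \<le> (\<Prod>i<k. 1 - a i)" "(\<Prod>i<k. 1 - a i) \<le> 1" using Suc.IH 1 by auto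
    have "(\<Prod>i<k. 1 - a i) * a k \<le> 1 * a k" using IH(2) 1[of k] by (intro mult_right_mono) auto
    then show ?case using IH by (simp add: algebra_simps)
  next
    case 2
    have "0 \<le> (\<Prod>i<k. 1 - a i) \<and> (\<Prod>i<k. 1 - a i) \<le> 1" using Suc.IH 2 by auto
    then show ?case using 2[of k] by (auto intro!: mult_le_one)
  }
qed auto

text \<open>From \<open>ln 2 \<le> 25 / 36\<close> the square of \<open>k\<close> is at most 25 n /
  72. Hence the ratios i / n add up to at most 25/144, the product of the factors 1 - i / n is at
  least 119/144, and the square of 119/144 exceeds 2/3.\<close>

lemma power_le_falling_factorial:
  assumes k: "real k \<le> real s" and s: "real s \<le> sqrt (real n / 2 * ln 2)" and n: "n \<ge> 1"
  shows "(real n ^ k)\<^sup>2 \<le> 3 / 2 * (fact k * real (n choose k))\<^sup>2" "k \<le> n"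
proof -
  have "(real k)\<^sup>2 \<le> (sqrt (real n / 2 * ln 2))\<^sup>2" using k s by (intro power_mono) auto
  also have "\<dots> = real n / 2 * ln 2" by simp
  also have "\<dots> \<le> real n / 2 * (25/36)" by (intro mult_left_mono ln2_le_25_over_36) simp
  finally have k2: "(real k)\<^sup>2 \<le> real n * (25/72)" by simp
  have "real k \<le> (real k)\<^sup>2" by (cases k) (auto simp: power2_eq_square)
  also have "\<dots> \<le> real n" using k2 of_nat_0_le_iff[of n, where 'a=real] by linarith
  finally show kn: "k \<le> n" by simp
  have "(\<Sum>i<k. real i / real n) = (\<Sum>i<k. real i) / real n" by (simp add: sum_divide_distrib)
  also have "(\<Sum>i<k. real i) \<le> (real k)\<^sup>2 / 2"
    by (induction k) (auto simp: power2_eq_square algebra_simps add_divide_distrib)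
  then have "(\<Sum>i<k. real i) / real n \<le> (real n * (25/72)) / 2 / real n"
    using k2 by (intro divide_right_mono) auto
  also have "(real n * (25/72)) / 2 / real n = 25/144" using n by simp
  finally have sm: "(\<Sum>i<k. real i / real n) \<le> 25/144" .
  have "119/144 \<le> 1 - (\<Sum>i<k. real i / real n)" using sm by simp
  also have "\<dots> \<le> (\<Prod>i<k. 1 - real i / real n)"
    using kn n by (intro prod_one_minus_ge(1)) auto
  finally have pr: "119/144 \<le> (\<Prod>i<k. 1 - real i / real n)" .
  have "fact k * real (n choose k) = (\<Prod>i<k. real n - real i)"
    by (simp add: binomial_gbinomial gbinomial_prod_rev atLeast0LessThan)
  also have "\<dots> = (\<Prod>i<k. real n * (1 - real i / real n))"
    using n by (intro prod.cong refl) (simp add: field_simps)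
  also have "\<dots> = real n ^ k * (\<Prod>i<k. 1 - real i / real n)" by (simp add: prod.distrib)
  finally have "real n ^ k * (119/144) \<le> fact k * real (n choose k)"
    using mult_left_mono[OF pr, of "real n ^ k"] by simp
  then have "(real n ^ k * (119/144))\<^sup>2 \<le> (fact k * real (n choose k))\<^sup>2" by (rule power_mono) simp
  moreover have "(real n ^ k * (119/144))\<^sup>2 = (119/144)\<^sup>2 * (real n ^ k)\<^sup>2" by (simp only: power_mult_distrib mult.commute)
  moreover have "2/3 * (real n ^ k)\<^sup>2 \<le> (119/144)\<^sup>2 * (real n ^ k)\<^sup>2"
    by (intro mult_right_mono) (auto simp: power2_eq_square)
  ultimately have "2/3 * (real n ^ k)\<^sup>2 \<le> (fact k * real (n choose k))\<^sup>2" by linarith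
  then show "(real n ^ k)\<^sup>2 \<le> 3 / 2 * (fact k * real (n choose k))\<^sup>2" by simp
qed

lemma exp_partial_sum_le:
  fixes y :: real
  assumes "y \<ge> 0"
  shows "(\<Sum>k\<le>m. y ^ k / fact k) \<le> exp y" "y ^ k / fact k \<le> exp y"
proof -
  show 1: "(\<Sum>k\<le>m. y ^ k / fact k) \<le> exp y" for m
  proof -
    obtain t where "exp y = (\<Sum>m<Suc m. y ^ m / fact m) + exp t / fact (Suc m) * y ^ Suc m"
      using Maclaurin_exp_le[of y "Suc m"] by blast
    moreover have "0 \<le> exp t / fact (Suc m) * y ^ Suc m" using assms by simp
    ultimately show ?thesis by (simp add: lessThan_Suc_atMost)
  qed
  have "y ^ k / fact k \<le> (\<Sum>k\<le>k. y ^ k / fact k)"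
    using assms by (intro member_le_sum) auto
  with 1[of k] show "y ^ k / fact k \<le> exp y" by linarith
qed

text \<open>A crude Stirling bound, from a single term of the exponential series at
  \<open>s\<close>.\<close>

lemma power_le_fact: "(real s / exp 1) ^ s \<le> fact s"
proof -
  have "real s ^ s / fact s \<le> exp (real s)" by (rule exp_partial_sum_le(2)) simp
  also have "exp (real s) = exp 1 ^ s" by (simp flip: exp_of_nat_mult)
  finally show ?thesis by (simp add: power_divide field_simps)
qed

text \<open>As \<open>e \<le> 3\<close>, \<open>exp (1 / 2) \<le> 16 / 9\<close>, and the term of
  order 4 in the series of exp (s / 2) gives s^4 / 384 as a lower bound for (16/9)^s. The threshold
  72 is 384 * 3 / 16. The bound reached is in fact 1 / s.\<close>

lemma geometric_beats_polynomial:
  assumes s: "s \<ge> 72"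
  shows "3 / 16 * (real s)\<^sup>2 * (9 / 16) ^ s \<le> real s powr (- 1 / 2)"
proof -
  have s0: "real s > 0" "real s \<ge> 72" using s by auto
  have "exp (1 / 2 :: real) \<le> 16 / 9"
  proof -
    have "(exp (1 / 2 :: real))\<^sup>2 = exp 1" by (simp flip: exp_of_nat_mult)
    also have "\<dots> \<le> (16 / 9)\<^sup>2" using exp_le by (rule order_trans) (simp add: power2_eq_square)
    finally show ?thesis by (rule power2_le_imp_le) simp
  qed
  then have e: "exp (1 / 2) ^ s \<le> (16 / 9 :: real) ^ s" by (rule power_mono) simp
  have "(real s / 2) ^ 4 / fact 4 \<le> exp (real s / 2)" by (rule exp_partial_sum_le(2)) simp
  also have "exp (real s / 2) = exp (1 / 2) ^ s" by (simp flip: exp_of_nat_mult)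
  also note e
  finally have 1: "real s ^ 4 / 384 \<le> (16 / 9) ^ s" by (simp add: power_divide fact_numeral)
  have "3 / 16 * real s ^ 3 \<le> real s ^ 4 / 384"
  proof -
    have "72 * real s ^ 3 \<le> real s * real s ^ 3" using s0 by (intro mult_right_mono) auto
    then show ?thesis by (simp add: numeral_eq_Suc)
  qed
  with 1 have "3 / 16 * real s ^ 3 \<le> (16 / 9) ^ s" by linarith
  then have "3 / 16 * real s ^ 3 * (9 / 16) ^ s \<le> (16 / 9) ^ s * (9 / 16) ^ s"
    by (rule mult_right_mono) simp
  also have "\<dots> = (1::real)" by (simp flip: power_mult_distrib)
  finally have 2: "3 / 16 * real s ^ 3 * (9 / 16) ^ s \<le> 1" .
  have "3 / 16 * (real s)\<^sup>2 * (9 / 16) ^ s * real s = 3 / 16 * real s ^ 3 * (9 / 16) ^ s"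
    by (simp add: power2_eq_square power3_eq_cube)
  with 2 have "3 / 16 * (real s)\<^sup>2 * (9 / 16) ^ s * real s \<le> 1" by linarith
  then have "3 / 16 * (real s)\<^sup>2 * (9 / 16) ^ s \<le> 1 / real s" by (simp only: pos_le_divide_eq[OF s0(1)])
  also have "\<dots> = real s powr (- 1)" using s0 by (simp add: powr_minus_divide)
  also have "\<dots> \<le> real s powr (- 1 / 2)" using s0 by (intro powr_mono) auto
  finally show ?thesis .
qed

lemma weighted_cauchy_schwarz:
  fixes p y :: "'i \<Rightarrow> real"
  assumes "\<And>i. i \<in> A \<Longrightarrow> p i \<ge> 0"
  shows "(\<Sum>i\<in>A. p i * y i)\<^sup>2 \<le> (\<Sum>i\<in>A. p i) * (\<Sum>i\<in>A. p i * (y i)\<^sup>2)"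
proof -
  have "(\<Sum>i\<in>A. sqrt (p i) * (sqrt (p i) * y i))\<^sup>2 \<le> (\<Sum>i\<in>A. (sqrt (p i))\<^sup>2) * (\<Sum>i\<in>A. (sqrt (p i) * y i)\<^sup>2)"
    by (rule Cauchy_Schwarz_ineq_sum)
  also have "(\<Sum>i\<in>A. sqrt (p i) * (sqrt (p i) * y i)) = (\<Sum>i\<in>A. p i * y i)"
    using assms by (intro sum.cong refl) (simp add: mult.assoc[symmetric])
  also have "(\<Sum>i\<in>A. (sqrt (p i))\<^sup>2) = (\<Sum>i\<in>A. p i)" using assms by simp
  also have "(\<Sum>i\<in>A. (sqrt (p i) * y i)\<^sup>2) = (\<Sum>i\<in>A. p i * (y i)\<^sup>2)"
    using assms by (intro sum.cong refl) (simp add: power_mult_distrib)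
  finally show ?thesis .
qed

text \<open>Stands in for Minkowski's inequality in L2: with weights equal to bounds on the three
  norms, integrating the right-hand side yields the square of their sum.\<close>

lemma norm_add3_square_le:
  fixes A B R :: complex
  assumes "\<alpha> > 0" "\<beta> > 0" "\<gamma> > 0"
  shows "(norm (A + B + R))\<^sup>2 \<le> (\<alpha> + \<beta> + \<gamma>) * ((norm A)\<^sup>2 / \<alpha> + (norm B)\<^sup>2 / \<beta> + (norm R)\<^sup>2 / \<gamma>)"
proof -
  define p where "p i = (if i = 0 then \<alpha> else if i = 1 then \<beta> else \<gamma>)" for i :: nat
  define y where "y i = (if i = 0 then norm A / \<alpha> else if i = 1 then norm B / \<beta> else norm R / \<gamma>)" for i :: nat
  have "norm (A + B + R) \<le> norm A + norm B + norm R" by (rule norm_triangle_le) (simp add: norm_triangle_ineq)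
  then have "(norm (A + B + R))\<^sup>2 \<le> (norm A + norm B + norm R)\<^sup>2" by (rule power_mono) simp
  also have "norm A + norm B + norm R = (\<Sum>i<3. p i * y i)"
    using assms by (simp add: p_def y_def numeral_3_eq_3)
  also have "(\<Sum>i<3. p i * y i)\<^sup>2 \<le> (\<Sum>i<3. p i) * (\<Sum>i<3. p i * (y i)\<^sup>2)"
    using assms by (intro weighted_cauchy_schwarz) (auto simp: p_def)
  also have "(\<Sum>i<3. p i) = \<alpha> + \<beta> + \<gamma>" by (simp add: p_def numeral_3_eq_3)
  also have "(\<Sum>i<3. p i * (y i)\<^sup>2) = (norm A)\<^sup>2 / \<alpha> + (norm B)\<^sup>2 / \<beta> + (norm R)\<^sup>2 / \<gamma>"
    using assms by (simp add: p_def y_def numeral_3_eq_3 power2_eq_square)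
  finally show ?thesis .
qed

section \<open>Second moments of the two random error terms\<close>

lemma borel_measurable_esym [measurable]:
  assumes "\<And>j. j \<in> J \<Longrightarrow> Z j \<in> borel_measurable M"
  shows "(\<lambda>\<omega>. esym k J (\<lambda>j. Z j \<omega>)) \<in> borel_measurable M"
  unfolding esym_def using assms by (intro borel_measurable_sum borel_measurable_prod) auto

text \<open>All coordinates and orders together form one orthogonal sum indexed by pairs of a
  coordinate and a nonempty index set. For fixed order the second moments add up to an elementary
  symmetric polynomial in the variances, bounded by a power of their sum. The sum over coordinates
  ends up outside the square, which is the source of the gain 1 / d.\<close>

lemma (in prob_space) degenerate_part_second_moment:
  fixes \<epsilon> :: "nat \<Rightarrow> 'a \<Rightarrow> real^'d" and c :: "nat \<Rightarrow> 'd \<Rightarrow> complex"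
  assumes ind: "indep_vars (\<lambda>_. borel) \<epsilon> {1..n}"
    and mean: "\<And>j a. j \<in> {1..n} \<Longrightarrow> integrable M (\<lambda>\<omega>. \<epsilon> j \<omega> $ a) \<and> expectation (\<lambda>\<omega>. \<epsilon> j \<omega> $ a) = 0"
    and cov: "\<And>j a b. j \<in> {1..n} \<Longrightarrow> integrable M (\<lambda>\<omega>. \<epsilon> j \<omega> $ a * \<epsilon> j \<omega> $ b)"
      "\<And>j a b. j \<in> {1..n} \<Longrightarrow> a \<noteq> b \<Longrightarrow> expectation (\<lambda>\<omega>. \<epsilon> j \<omega> $ a * \<epsilon> j \<omega> $ b) = 0"
    and var: "\<And>a. (\<Sum>j\<in>{1..n}. expectation (\<lambda>\<omega>. (\<epsilon> j \<omega> $ a)\<^sup>2)) \<le> (real n * \<sigma>)\<^sup>2"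
    and m: "m \<le> n"
  defines "B \<omega> \<equiv> \<Sum>a\<in>UNIV. \<Sum>k=1..m. c k a * complex_of_real (esym k {1..n} (\<lambda>j. \<epsilon> j \<omega> $ a) / real (n choose k))"
  shows "integrable M (\<lambda>\<omega>. (norm (B \<omega>))\<^sup>2)"
    "expectation (\<lambda>\<omega>. (norm (B \<omega>))\<^sup>2)
      \<le> (\<Sum>a\<in>UNIV. \<Sum>k=1..m. (norm (c k a))\<^sup>2 * ((real n ^ k)\<^sup>2 / (fact k * real (n choose k))\<^sup>2) * (fact k * \<sigma> ^ (2 * k)))"
proof -
  let ?J = "{1..n}"
  define \<S> where "\<S> = {S. S \<subseteq> ?J \<and> 1 \<le> card S \<and> card S \<le> m}"
  have fS: "finite \<S>" unfolding \<S>_def by (rule finite_subset[of _ "Pow ?J"]) auto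
  define Y where "Y = (\<lambda>(a, S) \<omega>. \<Prod>j\<in>S. \<epsilon> j \<omega> $ a)"
  define w where "w = (\<lambda>(a, S :: nat set). c (card S) a * complex_of_real (1 / real (n choose card S)))"
  let ?I = "(UNIV :: 'd set) \<times> \<S>"
  have grp: "(\<Sum>S\<in>\<S>. g S) = (\<Sum>k=1..m. \<Sum>S | S \<subseteq> ?J \<and> card S = k. g S)" for g :: "nat set \<Rightarrow> 'z::comm_monoid_add"
  proof -
    have "(\<Sum>S\<in>\<S>. g S) = (\<Sum>k\<in>{1..m}. \<Sum>S | S \<in> \<S> \<and> card S = k. g S)"
      by (rule sum.group[symmetric]) (use fS in \<open>auto simp: \<S>_def\<close>)
    also have "\<dots> = (\<Sum>k=1..m. \<Sum>S | S \<subseteq> ?J \<and> card S = k. g S)"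
      by (intro sum.cong refl) (auto simp: \<S>_def)
    finally show ?thesis .
  qed
  have Beq: "B \<omega> = (\<Sum>i\<in>?I. w i * complex_of_real (Y i \<omega>))" for \<omega>
  proof -
    have "(\<Sum>i\<in>?I. w i * complex_of_real (Y i \<omega>)) = (\<Sum>a\<in>UNIV. \<Sum>S\<in>\<S>. w (a, S) * complex_of_real (Y (a, S) \<omega>))"
      by (simp add: sum.cartesian_product)
    also have "\<dots> = (\<Sum>a\<in>UNIV. \<Sum>k=1..m. \<Sum>S | S \<subseteq> ?J \<and> card S = k. w (a, S) * complex_of_real (Y (a, S) \<omega>))"
      unfolding grp ..
    also have "\<dots> = B \<omega>"
      unfolding B_def esym_def w_def Y_def
      by (intro sum.cong refl) (simp add: sum_divide_distrib sum_distrib_left)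
    finally show ?thesis by simp
  qed
  have Sne: "S \<subseteq> ?J" "S \<noteq> {}" if "S \<in> \<S>" for S using that unfolding \<S>_def by auto
  note cp = coordinate_products_orthogonal[OF finite_atLeastAtMost ind mean cov]
  have i1: "integrable M (\<lambda>\<omega>. Y i \<omega> * Y j \<omega>)" if "i \<in> ?I" "j \<in> ?I" for i j
  proof -
    obtain a S b T where ij: "i = (a, S)" "j = (b, T)" by (cases i, cases j) auto
    then have "S \<in> \<S>" "T \<in> \<S>" using that by auto
    then show ?thesis unfolding ij Y_def case_prod_conv by (intro cp(1) Sne)
  qed
  have i2: "expectation (\<lambda>\<omega>. Y i \<omega> * Y j \<omega>) = 0" if "i \<in> ?I" "j \<in> ?I" "i \<noteq> j" for i j
  proof -
    obtain a S b T where ij: "i = (a, S)" "j = (b, T)" by (cases i, cases j) auto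
    then have "S \<in> \<S>" "T \<in> \<S>" "(a, S) \<noteq> (b, T)" using that by auto
    then show ?thesis unfolding ij Y_def case_prod_conv by (intro cp(2) Sne)
  qed
  have fI: "finite ?I" using fS by simp
  note os = orthogonal_sum_second_moment[OF fI i1 i2, where c=w]
  show "integrable M (\<lambda>\<omega>. (norm (B \<omega>))\<^sup>2)" unfolding Beq by (rule os(1))
  define v where "v a j = expectation (\<lambda>\<omega>. (\<epsilon> j \<omega> $ a)\<^sup>2)" for a j
  have v0: "v a j \<ge> 0" for a j unfolding v_def by (intro Bochner_Integration.integral_nonneg) auto
  have EY: "expectation (\<lambda>\<omega>. (Y (a, S) \<omega>)\<^sup>2) = (\<Prod>j\<in>S. v a j)" if "S \<in> \<S>" for a S
    unfolding Y_def v_def case_prod_conv by (rule cp(3)[where S=S and T=S]) (use Sne[OF that] in simp_all)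
  have "expectation (\<lambda>\<omega>. (norm (B \<omega>))\<^sup>2) = (\<Sum>i\<in>?I. (norm (w i))\<^sup>2 * expectation (\<lambda>\<omega>. (Y i \<omega>)\<^sup>2))"
    unfolding Beq by (rule os(2))
  also have "\<dots> = (\<Sum>a\<in>UNIV. \<Sum>S\<in>\<S>. (norm (w (a, S)))\<^sup>2 * expectation (\<lambda>\<omega>. (Y (a, S) \<omega>)\<^sup>2))"
    by (simp add: sum.cartesian_product)
  also have "\<dots> = (\<Sum>a\<in>UNIV. \<Sum>S\<in>\<S>. (norm (w (a, S)))\<^sup>2 * (\<Prod>j\<in>S. v a j))"
    by (intro sum.cong refl) (simp add: EY)
  also have "\<dots> = (\<Sum>a\<in>UNIV. \<Sum>k=1..m. \<Sum>S | S \<subseteq> ?J \<and> card S = k. (norm (w (a, S)))\<^sup>2 * (\<Prod>j\<in>S. v a j))"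
    unfolding grp ..
  also have "\<dots> = (\<Sum>a\<in>UNIV. \<Sum>k=1..m. (norm (c k a) / real (n choose k))\<^sup>2 * esym k ?J (v a))"
    unfolding esym_def sum_distrib_left w_def
    by (intro sum.cong refl) (auto simp: norm_mult norm_divide)
  also have "\<dots> \<le> (\<Sum>a\<in>UNIV. \<Sum>k=1..m. (norm (c k a))\<^sup>2 * ((real n ^ k)\<^sup>2 / (fact k * real (n choose k))\<^sup>2) * (fact k * \<sigma> ^ (2 * k)))"
  proof (intro sum_mono)
    fix a k assume k: "k \<in> {1..m}"
    have "fact k * esym k ?J (v a) \<le> (\<Sum>j\<in>?J. v a j) ^ k"
      by (intro fact_esym_le_power v0) simp
    also have "\<dots> \<le> ((real n * \<sigma>)\<^sup>2) ^ k"
      using var[of a] v0 unfolding v_def by (intro power_mono sum_nonneg) auto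
    also have "\<dots> = (real n ^ k)\<^sup>2 * \<sigma> ^ (2 * k)"
      by (simp add: power_mult_distrib power_mult[symmetric] mult.commute)
    finally have e: "esym k ?J (v a) \<le> (real n ^ k)\<^sup>2 * \<sigma> ^ (2 * k) / fact k"
      by (simp add: pos_le_divide_eq mult.commute)
    have "(norm (c k a) / real (n choose k))\<^sup>2 * esym k ?J (v a)
      \<le> (norm (c k a) / real (n choose k))\<^sup>2 * ((real n ^ k)\<^sup>2 * \<sigma> ^ (2 * k) / fact k)"
      by (rule mult_left_mono[OF e]) simp
    also have "\<dots> = (norm (c k a))\<^sup>2 * ((real n ^ k)\<^sup>2 / (fact k * real (n choose k))\<^sup>2) * (fact k * \<sigma> ^ (2 * k))"
      by (simp add: power_divide power_mult_distrib power2_eq_square ac_simps)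
    finally show "(norm (c k a) / real (n choose k))\<^sup>2 * esym k ?J (v a)
       \<le> (norm (c k a))\<^sup>2 * ((real n ^ k)\<^sup>2 / (fact k * real (n choose k))\<^sup>2) * (fact k * \<sigma> ^ (2 * k))" .
  qed
  finally show "expectation (\<lambda>\<omega>. (norm (B \<omega>))\<^sup>2)
      \<le> (\<Sum>a\<in>UNIV. \<Sum>k=1..m. (norm (c k a))\<^sup>2 * ((real n ^ k)\<^sup>2 / (fact k * real (n choose k))\<^sup>2) * (fact k * \<sigma> ^ (2 * k)))" .
qed

text \<open>\<open>G\<close> is the pointwise bound of \<open>corrected_taylor_increment\<close>.
  Cauchy-Schwarz with binomial weights produces 2^m twice, once from the weights and once from
  summing moment bounds that do not depend on \<open>i\<close>; hence 4^m.\<close>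

lemma (in prob_space) remainder_second_moment:
  fixes Z :: "nat \<Rightarrow> 'a \<Rightarrow> real"
  assumes s: "s \<ge> 1" and m: "m = s - 1" and n: "n \<ge> 1"
    and ind: "indep_vars (\<lambda>_. borel) Z {1..n}"
    and mean: "\<And>j. j \<in> {1..n} \<Longrightarrow> expectation (Z j) = 0"
    and int: "\<And>j. j \<in> {1..n} \<Longrightarrow> integrable M (\<lambda>\<omega>. \<bar>Z j \<omega>\<bar> ^ (2 * s))"
    and sym: "sign_avg {1..n} (\<lambda>\<sigma>. expectation (\<lambda>\<omega>. (\<Sum>j\<in>{1..n}. \<sigma> j * Z j \<omega>) ^ (2 * s))) \<le> real n ^ (2 * s) * W"
    and fall: "\<And>k. k \<le> m \<Longrightarrow> (real n ^ k)\<^sup>2 \<le> 3 / 2 * (fact k * real (n choose k))\<^sup>2"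
  defines "G \<omega> \<equiv> \<Sum>i\<le>m. real (m choose i) * (\<bar>esym i {1..n} (\<lambda>j. Z j \<omega>) / real (n choose i)\<bar> * \<bar>(\<Sum>j\<in>{1..n}. Z j \<omega>) / real n\<bar> ^ (Suc m - i))"
  shows "integrable M (\<lambda>\<omega>. (G \<omega>)\<^sup>2)" "expectation (\<lambda>\<omega>. (G \<omega>)\<^sup>2) \<le> 4 ^ m * (3 / 2 * 9 ^ s * W)"
proof -
  let ?J = "{1..n}"
  define H where "H i \<omega> = (fact i * esym i ?J (\<lambda>j. Z j \<omega>))\<^sup>2 * (\<Sum>j\<in>?J. Z j \<omega>) ^ (2 * (s - i))" for i \<omega>
  \<comment> \<open>Collects the powers of \<open>n\<close>, of total degree \<open>2 * s\<close>
    for every \<open>i\<close>; the 3/2 pays for replacing \<open>n choose i\<close> times the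
    factorial by a power of \<open>n\<close>.\<close>
  define c where "c = 3 / 2 / real n ^ (2 * s)"
  have c0: "c \<ge> 0" unfolding c_def by simp
  have Zm [measurable]: "Z j \<in> borel_measurable M" if "j \<in> ?J" for j
    using ind that by (auto simp: indep_vars_def)
  have Gm: "G \<in> borel_measurable M" unfolding G_def
    by (intro borel_measurable_sum borel_measurable_times borel_measurable_const borel_measurable_abs
        borel_measurable_divide borel_measurable_esym borel_measurable_power Zm) auto
  have H: "integrable M (H i)" "expectation (H i) \<le> 9 ^ s * (real n ^ (2 * s) * W)" if "i \<le> m" for i
  proof -
    have "i \<le> s" using that m by simp
    note e = esym_mult_power_moment[OF finite_atLeastAtMost s this ind mean int]
    show "integrable M (H i)" unfolding H_def by (rule e(1))
    have "expectation (H i) \<le> 9 ^ s * sign_avg ?J (\<lambda>\<sigma>. expectation (\<lambda>\<omega>. (\<Sum>j\<in>?J. \<sigma> j * Z j \<omega>) ^ (2 * s)))"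
      unfolding H_def by (rule e(2))
    also have "\<dots> \<le> 9 ^ s * (real n ^ (2 * s) * W)" by (intro mult_left_mono sym) simp
    finally show "expectation (H i) \<le> 9 ^ s * (real n ^ (2 * s) * W)" .
  qed
  have H0: "H i \<omega> \<ge> 0" for i \<omega> unfolding H_def by simp
  have term_le: "(\<bar>esym i ?J (\<lambda>j. Z j \<omega>) / real (n choose i)\<bar> * \<bar>(\<Sum>j\<in>?J. Z j \<omega>) / real n\<bar> ^ (Suc m - i))\<^sup>2 \<le> c * H i \<omega>"
    if i: "i \<le> m" for i \<omega>
  proof -
    let ?e = "esym i ?J (\<lambda>j. Z j \<omega>)" and ?S = "\<Sum>j\<in>?J. Z j \<omega>" and ?b = "real (n choose i)"
    have si: "Suc m - i = s - i" using m s by simp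
    have F: "(real n ^ i)\<^sup>2 \<le> 3 / 2 * (fact i * ?b)\<^sup>2" by (rule fall[OF i])
    have npos: "real n ^ j > 0" for j using n by simp
    then have "0 < (real n ^ i)\<^sup>2" by simp
    with F have fb: "(fact i * ?b)\<^sup>2 > 0" by linarith
    have inv: "1 / (fact i * ?b)\<^sup>2 \<le> 3 / 2 / (real n ^ i)\<^sup>2"
    proof -
      have "1 / (fact i * ?b)\<^sup>2 * (real n ^ i)\<^sup>2 \<le> 1 / (fact i * ?b)\<^sup>2 * (3 / 2 * (fact i * ?b)\<^sup>2)"
        by (rule mult_left_mono[OF F]) simp
      also have "\<dots> = 3 / 2" using fb by simp
      finally show ?thesis using \<open>0 < (real n ^ i)\<^sup>2\<close> by (simp only: pos_le_divide_eq)
    qed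
    have "(\<bar>?e / ?b\<bar> * \<bar>?S / real n\<bar> ^ (Suc m - i))\<^sup>2 = (?e / ?b)\<^sup>2 * (?S ^ (2 * (s - i)) / real n ^ (2 * (s - i)))"
      unfolding si by (simp add: power_mult_distrib power_divide power_mult[symmetric] power_even_abs mult.commute)
    also have "\<dots> = 1 / (fact i * ?b)\<^sup>2 * (H i \<omega> / real n ^ (2 * (s - i)))"
      unfolding H_def by (simp add: power_mult_distrib power_divide)
    also have "\<dots> \<le> 3 / 2 / (real n ^ i)\<^sup>2 * (H i \<omega> / real n ^ (2 * (s - i)))"
      by (intro mult_right_mono inv divide_nonneg_nonneg H0) simp
    also have "\<dots> = c * H i \<omega>"
    proof -
      have "(real n ^ i)\<^sup>2 * real n ^ (2 * (s - i)) = real n ^ (2 * s)"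
      proof -
        have e: "i * 2 + 2 * (s - i) = 2 * s" using i m by simp
        show ?thesis unfolding power_mult[symmetric] power_add[symmetric] e ..
      qed
      then show ?thesis unfolding c_def by (metis (no_types, lifting) divide_divide_eq_left times_divide_eq_left times_divide_eq_right)
    qed
    finally show ?thesis .
  qed
  have le: "(G \<omega>)\<^sup>2 \<le> 2 ^ m * (\<Sum>i\<le>m. real (m choose i) * (c * H i \<omega>))" for \<omega>
  proof -
    have "(G \<omega>)\<^sup>2 \<le> (\<Sum>i\<le>m. real (m choose i)) * (\<Sum>i\<le>m. real (m choose i) *
        (\<bar>esym i ?J (\<lambda>j. Z j \<omega>) / real (n choose i)\<bar> * \<bar>(\<Sum>j\<in>?J. Z j \<omega>) / real n\<bar> ^ (Suc m - i))\<^sup>2)"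
      unfolding G_def by (rule weighted_cauchy_schwarz) simp
    also have "(\<Sum>i\<le>m. real (m choose i)) = 2 ^ m"
      using choose_row_sum[of m] by (simp flip: of_nat_sum)
    also have "2 ^ m * (\<Sum>i\<le>m. real (m choose i) *
        (\<bar>esym i ?J (\<lambda>j. Z j \<omega>) / real (n choose i)\<bar> * \<bar>(\<Sum>j\<in>?J. Z j \<omega>) / real n\<bar> ^ (Suc m - i))\<^sup>2)
       \<le> 2 ^ m * (\<Sum>i\<le>m. real (m choose i) * (c * H i \<omega>))"
      by (intro mult_left_mono sum_mono term_le) auto
    finally show ?thesis .
  qed
  have iH: "integrable M (\<lambda>\<omega>. 2 ^ m * (\<Sum>i\<le>m. real (m choose i) * (c * H i \<omega>)))"
    using H(1) by (intro integrable_mult_right Bochner_Integration.integrable_sum) auto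
  show iG: "integrable M (\<lambda>\<omega>. (G \<omega>)\<^sup>2)"
  proof (rule Bochner_Integration.integrable_bound[OF iH])
    show "AE \<omega> in M. norm ((G \<omega>)\<^sup>2) \<le> norm (2 ^ m * (\<Sum>i\<le>m. real (m choose i) * (c * H i \<omega>)))"
      by (intro AE_I2) (use le in \<open>auto intro: order_trans[OF _ abs_ge_self]\<close>)
  qed (use Gm in simp)
  have "expectation (\<lambda>\<omega>. (G \<omega>)\<^sup>2) \<le> expectation (\<lambda>\<omega>. 2 ^ m * (\<Sum>i\<le>m. real (m choose i) * (c * H i \<omega>)))"
    by (rule integral_mono[OF iG iH le])
  also have "\<dots> = 2 ^ m * (\<Sum>i\<le>m. real (m choose i) * (c * expectation (H i)))"
    using H(1) by (simp add: Bochner_Integration.integral_sum)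
  also have "\<dots> \<le> 2 ^ m * (\<Sum>i\<le>m. real (m choose i) * (c * (9 ^ s * (real n ^ (2 * s) * W))))"
    using H(2) c0 by (intro mult_left_mono sum_mono) auto
  also have "\<dots> = 2 ^ m * ((\<Sum>i\<le>m. real (m choose i)) * (c * (9 ^ s * (real n ^ (2 * s) * W))))"
    by (simp only: sum_distrib_right)
  also have "(\<Sum>i\<le>m. real (m choose i)) = 2 ^ m"
    using choose_row_sum[of m] by (simp flip: of_nat_sum)
  also have "c * (9 ^ s * (real n ^ (2 * s) * W)) = 3 / 2 * 9 ^ s * W"
    unfolding c_def using n by simp
  also have "2 ^ m * (2 ^ m * (3 / 2 * 9 ^ s * W)) = 4 ^ m * (3 / 2 * 9 ^ s * W)"
    by (simp flip: power_mult_distrib mult.assoc)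
  finally show "expectation (\<lambda>\<omega>. (G \<omega>)\<^sup>2) \<le> 4 ^ m * (3 / 2 * 9 ^ s * W)" .
qed

text \<open>Normalized sums over distinct tuples are averages over index sets. The shift formula
  then moves the centre from the sample mean to any reference point \<open>t\<close>, later the true
  mean.\<close>

lemma u_stat_eq_appell:
  fixes X :: "nat \<Rightarrow> real^'d"
  assumes n: "n \<ge> 1" and k: "k \<le> n"
  shows "u_stat n X k a = appell (\<lambda>i. esym i {1..n} (\<lambda>j. X j $ a - t) / real (n choose i)) k (sample_mean n X a - t)"
proof -
  let ?x = "sample_mean n X a"
  have set_eq: "{js. length js = k \<and> distinct js \<and> set js \<subseteq> {1..n}} = dtuples k {1..n}"
    unfolding dtuples_def ..
  have "(\<Sum>js\<in>dtuples k {1..n}. \<Prod>l<k. (X (js ! l) $ a - ?x)) = (\<Sum>js\<in>dtuples k {1..n}. prod_list (map (\<lambda>j. X j $ a - ?x) js))"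
    by (intro sum.cong refl) (auto simp: dtuples_def prod.list_conv_set_nth atLeast0LessThan)
  then have "u_stat n X k a = fact (n - k) / fact n * (fact k * esym k {1..n} (\<lambda>j. X j $ a - ?x))"
    unfolding u_stat_def set_eq by (simp add: sum_dtuples)
  also have "\<dots> = esym k {1..n} (\<lambda>j. X j $ a - ?x) / real (n choose k)"
    using k by (simp add: binomial_fact)
  also have "(\<lambda>j. X j $ a - ?x) = (\<lambda>j. (X j $ a - t) - (?x - t))" by simp
  also have "esym k {1..n} (\<lambda>j. (X j $ a - t) - (?x - t)) / real (n choose k)
      = appell (\<lambda>i. esym i {1..n} (\<lambda>j. X j $ a - t) / real (n choose i)) k (?x - t)"
    unfolding appell_def using esym_shift_normalized[of "{1..n}" k "\<lambda>j. X j $ a - t" "?x - t"] k by simp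
  finally show ?thesis .
qed

lemma esym_0 [simp]: "finite J \<Longrightarrow> esym 0 J z = 1"
proof -
  assume "finite J"
  then have "{S. S \<subseteq> J \<and> card S = 0} = {{}}" by (auto dest: finite_subset)
  then show ?thesis unfolding esym_def by simp
qed

lemma esym_1: "finite J \<Longrightarrow> esym 1 J z = (\<Sum>j\<in>J. z j)"
proof -
  assume J: "finite J"
  have "esym 1 J z = (\<Sum>js\<in>dtuples 1 J. prod_list (map z js))" using sum_dtuples[OF J, of z 1] by simp
  also have "dtuples 1 J = (\<lambda>j. [j]) ` J" by (auto simp: dtuples_def length_Suc_conv)
  also have "(\<Sum>js\<in>(\<lambda>j. [j]) ` J. prod_list (map z js)) = (\<Sum>j\<in>J. z j)"
    by (subst sum.reindex) (auto simp: inj_on_def)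
  finally show ?thesis .
qed

text \<open>The estimator has no term of order 1, but the full expansion agrees with it: deviations
  from the sample mean add up to zero, so that term vanishes.\<close>

lemma f_hat_eq_corrected_taylor:
  fixes X :: "nat \<Rightarrow> real^'d"
  assumes n: "n \<ge> 1" and m: "m \<le> n" "m \<ge> 1"
  shows "f_hat fh n m X = (\<Sum>a\<in>UNIV. corrected_taylor (\<lambda>k. nth_vderiv k fh)
      (\<lambda>i. esym i {1..n} (\<lambda>j. X j $ a - \<theta> $ a) / real (n choose i)) (\<theta> $ a) m (sample_mean n X a - \<theta> $ a)) / of_nat CARD('d)"
proof -
  have "fh (sample_mean n X a) + (\<Sum>k=2..m. nth_vderiv k fh (sample_mean n X a) * complex_of_real (u_stat n X k a) / fact k)
     = corrected_taylor (\<lambda>k. nth_vderiv k fh)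
      (\<lambda>i. esym i {1..n} (\<lambda>j. X j $ a - \<theta> $ a) / real (n choose i)) (\<theta> $ a) m (sample_mean n X a - \<theta> $ a)" for a
  proof -
    let ?u = "\<lambda>i. esym i {1..n} (\<lambda>j. X j $ a - \<theta> $ a) / real (n choose i)"
    let ?t = "sample_mean n X a - \<theta> $ a"
    let ?g = "\<lambda>k. nth_vderiv k fh (sample_mean n X a) * complex_of_real (appell ?u k ?t) / fact k"
    have "appell ?u 1 ?t = ?u 1 - ?t" unfolding appell_def by (simp add: atMost_Suc)
    also have "\<dots> = 0" using n by (subst esym_1) (simp_all add: sum_subtractf sample_mean_def diff_divide_distrib)
    finally have a1: "appell ?u 1 ?t = 0" .
    have a0: "appell ?u 0 ?t = 1" unfolding appell_def by simp
    have "{..m} = insert 0 (insert 1 {2..m})" using m by auto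
    then have "(\<Sum>k\<le>m. ?g k) = ?g 0 + ?g 1 + (\<Sum>k=2..m. ?g k)" by simp
    also have "\<dots> = fh (sample_mean n X a) + (\<Sum>k=2..m. ?g k)"
      unfolding a0 a1 by (simp add: nth_vderiv_def)
    also have "(\<Sum>k=2..m. ?g k) = (\<Sum>k=2..m. nth_vderiv k fh (sample_mean n X a) * complex_of_real (u_stat n X k a) / fact k)"
      using m by (intro sum.cong refl) (subst u_stat_eq_appell[OF n, of _ _ _ "\<theta> $ a"], auto)
    finally show ?thesis unfolding corrected_taylor_def by simp
  qed
  then show ?thesis unfolding f_hat_def by simp
qed

section \<open>The risk bound\<close>

text \<open>As 128 * 9 / 16 = 72 = 8 * 9, the hypothesis on \<open>s\<close> says that 72 L is at
  most 9/16 times s / e, and \<open>power_le_fact\<close> yields the geometric factor (9/16)^s. The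
  factor s^2 comes from fact s / (fact m)^2 = s^2 / fact s, and 3/16 is 3/2 divided by the surplus 8
  in 8^s = 8 * 8^m.\<close>

lemma remainder_constant_le:
  assumes s: "s \<ge> 72" and m: "m = s - 1" and L: "L \<ge> 0" "128 * exp 1 * L \<le> real s"
  shows "L ^ s * (4 ^ m * (3 / 2 * 9 ^ s * (2 ^ m * fact s))) / (fact m)\<^sup>2 \<le> real s powr (- 1 / 2)"
proof -
  have sm: "s = Suc m" using s m by simp
  have fs: "fact s = real s * fact m" unfolding sm by simp
  have "72 * L \<le> 9 / 16 * (real s / exp 1)"
    using L(2) by (simp add: field_simps)
  then have "(72 * L) ^ s \<le> (9 / 16 * (real s / exp 1)) ^ s" using L(1) by (intro power_mono) auto
  also have "\<dots> = (9 / 16) ^ s * (real s / exp 1) ^ s" by (rule power_mult_distrib)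
  also have "\<dots> \<le> (9 / 16) ^ s * fact s" by (intro mult_left_mono power_le_fact) simp
  finally have le: "(72 * L) ^ s / fact s \<le> (9 / 16) ^ s" by (simp only: pos_divide_le_eq fact_gt_zero)
  have "(4::real) ^ m * 2 ^ m = 8 ^ m" by (simp flip: power_mult_distrib)
  moreover have "(8::real) ^ s = 8 * 8 ^ m" unfolding sm by (rule power_Suc)
  ultimately have p8: "8 * ((4::real) ^ m * 2 ^ m) = 8 ^ s" by (simp only:)
  have p72: "(72 * L) ^ s = L ^ s * 9 ^ s * 8 ^ s"
    unfolding power_mult_distrib[symmetric] by (rule arg_cong[of _ _ "\<lambda>x. x ^ s"]) simp
  have mono: "a * (f * (3 / 2 * n * (t * (y * g)))) / g\<^sup>2 = 3 / 16 * y\<^sup>2 * (a * n * (8 * (f * t)) / (y * g))"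
    if "g \<noteq> 0" "y \<noteq> 0" for a f n t y g :: real
    using that by (simp add: power2_eq_square)
  have "L ^ s * (4 ^ m * (3 / 2 * 9 ^ s * (2 ^ m * fact s))) / (fact m)\<^sup>2
      = 3 / 16 * (real s)\<^sup>2 * (L ^ s * 9 ^ s * (8 * (4 ^ m * 2 ^ m)) / fact s)"
    unfolding fs by (rule mono) (use s in simp_all)
  also have "8 * (4 ^ m * 2 ^ m) = (8 :: real) ^ s" using p8 by (simp only:)
  also have "L ^ s * 9 ^ s * 8 ^ s = (72 * L) ^ s" by (rule p72[symmetric])
  also have "3 / 16 * (real s)\<^sup>2 * ((72 * L) ^ s / fact s) \<le> 3 / 16 * (real s)\<^sup>2 * (9 / 16) ^ s" by (rule mult_left_mono[OF le]) simp
  also have "\<dots> \<le> real s powr (- 1 / 2)" by (rule geometric_beats_polynomial[OF s])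
  finally show ?thesis .
qed

text \<open>The weight 3/2 pays for falling factorials, and 9/4 is the square of the factor 3/2 in
  the first derivative bound. The excess 3/4 * L at order 1 fits into the slack between 3/2 and
  2.\<close>

lemma weighted_exponential_sum_le:
  fixes L :: real
  assumes L: "L \<ge> 0" and m: "m \<ge> 1"
  shows "(\<Sum>k=1..m. (if k = 1 then 9 / 4 else 3 / 2) * (L ^ k / fact k)) \<le> 2 * exp L"
proof -
  have "(\<Sum>k=1..m. (if k = 1 then 9 / 4 else 3 / 2) * (L ^ k / fact k))
      = (\<Sum>k=1..m. (if k = 1 then 3 / 4 * L else 0) + 3 / 2 * (L ^ k / fact k))"
    by (intro sum.cong refl) auto
  also have "\<dots> = 3 / 4 * L + 3 / 2 * (\<Sum>k=1..m. L ^ k / fact k)"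
    using m by (simp add: sum.distrib sum_distrib_left)
  also have "(\<Sum>k=1..m. L ^ k / fact k) \<le> exp L"
  proof -
    have "(\<Sum>k=1..m. L ^ k / fact k) \<le> (\<Sum>k\<le>m. L ^ k / fact k)" using L by (intro sum_mono2) auto
    then show ?thesis using exp_partial_sum_le(1)[OF L, of m] by linarith
  qed
  also have "3 / 4 * L \<le> exp L / 2"
  proof -
    have "L \<le> exp (L - 1)" using exp_ge_add_one_self[of "L - 1"] by simp
    moreover have "exp L = exp 1 * exp (L - 1)" by (simp flip: exp_add)
    moreover have "2 * exp (L - 1) \<le> exp 1 * exp (L - 1)"
      using exp_ge_add_one_self[of 1] by (intro mult_right_mono) auto
    ultimately show ?thesis using L by linarith
  qed
  finally show ?thesis by simp
qed

theorem theorem5p4: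
  fixes M :: "'w measure"
    and x :: "nat \<Rightarrow> 'w \<Rightarrow> real^'d"
    and \<epsilon> :: "nat \<Rightarrow> 'w \<Rightarrow> real^'d"
    and r :: "nat \<Rightarrow> 'w \<Rightarrow> real"
    and \<theta> :: "real^'d"
    and Q K fh :: "real \<Rightarrow> complex"
    and n d s m :: nat
    and p \<sigma> h C\<^sub>1 :: real
  assumes "prob_space M"
    and "0 < p" "p < 1"
    and "n \<ge> 1"
    and "d = CARD('d)" "d \<ge> 2"
    and "int s = \<lceil>2 ^ 7 * exp 1 * ln (real d / ln (real d))\<rceil>"
    and "m = s - 1"
    and "real s \<le> sqrt (real n / 2 * ln 2)"
    and "prob_space.indep_vars M (\<lambda>_. borel) x {1..n}"
    and "\<And>j. j \<in> {1..n} \<Longrightarrow> integrable M (x j) \<and> (\<integral>\<omega>. x j \<omega> \<partial>M) = \<theta>"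
    and "\<epsilon> = (\<lambda>j \<omega>. x j \<omega> - \<theta>)"
    and "\<sigma> > 0"
    and "\<And>j a b. j \<in> {1..n} \<Longrightarrow> a \<noteq> b \<Longrightarrow>
           integrable M (\<lambda>\<omega>. \<epsilon> j \<omega> $ a * \<epsilon> j \<omega> $ b) \<and> (\<integral>\<omega>. \<epsilon> j \<omega> $ a * \<epsilon> j \<omega> $ b \<partial>M) = 0"
    and "rademacher M {1..n} r"
    and "indep_rvs M
           (Pi\<^sub>M {1..n} (\<lambda>_. borel)) (\<lambda>\<omega>. \<lambda>j\<in>{1..n}. r j \<omega>)
           (Pi\<^sub>M {1..n} (\<lambda>_. borel)) (\<lambda>\<omega>. \<lambda>j\<in>{1..n}. \<epsilon> j \<omega>)"
    and "\<And>a k. k \<in> {1..s} \<Longrightarrow>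
           integrable M (\<lambda>\<omega>. \<bar>(\<Sum>j=1..n. r j \<omega> * \<epsilon> j \<omega> $ a) / real n\<bar> ^ (2 * k)) \<and>
           (\<integral>\<omega>. \<bar>(\<Sum>j=1..n. r j \<omega> * \<epsilon> j \<omega> $ a) / real n\<bar> ^ (2 * k) \<partial>M)
             \<le> \<sigma> ^ (2 * k) * 2 ^ (k - 1) * fact k"
    and "twice_cont_diff Q"
    and "Q 0 = complex_of_real (1 / sqrt (2 * pi))"
    and "closure {\<zeta>. Q \<zeta> \<noteq> 0} = {-1..1}"
    and "L1_norm Q \<le> C\<^sub>1 / sqrt (2 / pi)"
    and "Max ((\<lambda>k. L2_norm (nth_vderiv k Q)) ` {0, 2}) \<le> C\<^sub>1 / sqrt (2 * pi)"
    and "K = inv_fourier Q"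
    and "h = \<sigma> / sqrt (ln (real d / ln (real d)))"
    and "fh = kernel_smooth K h (\<lambda>t. \<bar>t\<bar> powr p)"
  shows "integrable M (\<lambda>\<omega>. (norm (f_hat fh n m (\<lambda>j. x j \<omega>) - complex_of_real (lp_functional p \<theta>)))\<^sup>2) \<and>
         (\<integral>\<omega>. (norm (f_hat fh n m (\<lambda>j. x j \<omega>) - complex_of_real (lp_functional p \<theta>)))\<^sup>2 \<partial>M)
           \<le> (1 + sqrt (2 / ln (real d)) + real s powr (- 1 / 4))\<^sup>2 * C\<^sub>1\<^sup>2
             * (\<sigma>\<^sup>2 / ln (real d / ln (real d))) powr p"
proof -
  interpret prob_space M by (rule assms(1))
  note p = assms(2,3) and n = assms(4) and d = assms(5,6) and m = assms(8) and s_le = assms(9)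
    and \<epsilon> = assms(12) and \<sigma> = assms(13)
  let ?J = "{1..n}"

  \<comment> \<open>The logarithm, the order of the expansion and the bandwidth\<close>
  define L where "L = ln (real d / ln (real d))"
  have d2: "real d \<ge> 2" using d by simp
  have lnd: "ln (real d) > 0" using d2 by simp
  \<comment> \<open>The maximum of log x / x is 1 / e. Hence \<open>L \<ge> 1\<close>, which makes
    \<open>h\<close> positive and \<open>s\<close> large.\<close>
  have "ln (real d) \<le> real d / exp 1"
  proof -
    have "ln (real d / exp 1) \<le> real d / exp 1 - 1" using d2 by (intro ln_le_minus_one) simp
    then show ?thesis using d2 by (simp add: ln_div)
  qed
  then have "exp 1 \<le> real d / ln (real d)" using lnd by (simp add: field_simps)
  then have L1: "L \<ge> 1" unfolding L_def using d2 lnd by (subst ln_ge_iff) auto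
  have expL: "exp L = real d / ln (real d)" unfolding L_def using d2 lnd by (intro exp_ln) simp
  have sL: "128 * exp 1 * L \<le> real s"
  proof -
    have "128 * exp 1 * L \<le> real_of_int \<lceil>2 ^ 7 * exp 1 * ln (real d / ln (real d))\<rceil>"
      unfolding L_def by (rule order_trans[OF _ le_of_int_ceiling]) simp
    also have "\<dots> = real s" unfolding assms(7)[symmetric] by simp
    finally show ?thesis .
  qed
  \<comment> \<open>In fact \<open>s\<close> is at least 128 e; the numerical lemmas ask only for
    72.\<close>
  have "128 * 1 * 1 \<le> 128 * exp 1 * L" using L1 by (intro mult_mono) auto
  with sL have s72: "s \<ge> 72" by linarith
  then have s1: "s \<ge> 1" and m1: "m \<ge> 1" and sm: "Suc m = s" using m by auto
  have h_eq: "h = \<sigma> / sqrt L" using assms(24) unfolding L_def .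
  have h: "h > 0" unfolding h_eq using \<sigma> L1 by simp
  \<comment> \<open>Through this identity the powers of \<open>\<sigma>\<close> in the moments and
    of 1 / h in the derivatives combine into powers of \<open>L\<close>.\<close>
  have h2: "\<sigma>\<^sup>2 = L * h\<^sup>2" unfolding h_eq using L1 by (simp add: power_divide)
  have L2: "L2_norm Q \<le> C\<^sub>1 / sqrt (2 * pi)" "L2_norm (nth_vderiv 2 Q) \<le> C\<^sub>1 / sqrt (2 * pi)"
    using assms(22) by (simp_all add: nth_vderiv_def)
  interpret KS: kernel_smoothing Q p h C\<^sub>1
    by unfold_locales (use assms(18-21) L2 p h in auto)
  have fh: "fh = KS.fh" unfolding KS.fh_def using assms(23,25) by simp
  define c where "c = C\<^sub>1 * h powr p"
  have c: "c > 0" unfolding c_def using KS.C_pos h by simp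
  let ?D = "\<lambda>k. nth_vderiv k fh"
  have D: "(?D k has_vector_derivative ?D (Suc k) y) (at y)" for k y
    unfolding fh by (rule KS.nth_vderiv_fh_has_derivative)
  have D0: "?D 0 = fh" by (simp add: nth_vderiv_def)
  have Dk: "norm (?D k y) \<le> c / h ^ k" if "k \<ge> 2" for k y
    unfolding fh c_def by (rule KS.nth_vderiv_fh_bound[OF that])
  have D1: "norm (?D 1 y) \<le> 3 / 2 * c / h" for y
    using KS.nth_vderiv_fh_bound_1[of y] unfolding fh c_def by (simp add: mult.assoc)

  \<comment> \<open>Moments of the noise\<close>
  have ind: "indep_vars (\<lambda>_. borel) \<epsilon> ?J"
    unfolding \<epsilon> by (rule indep_vars_compose2[OF assms(10), where Y="\<lambda>j v. v - \<theta>"]) simp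
  have comp [measurable]: "(\<lambda>v::real^'d. v $ a) \<in> borel_measurable borel" for a
    by (intro borel_measurable_continuous_onI continuous_intros)
  have em: "(\<lambda>\<omega>. \<epsilon> j \<omega> $ a) \<in> borel_measurable M" if "j \<in> ?J" for j a
    using ind that by (intro measurable_compose[OF _ comp]) (auto simp: indep_vars_def)
  have mean: "integrable M (\<lambda>\<omega>. \<epsilon> j \<omega> $ a) \<and> expectation (\<lambda>\<omega>. \<epsilon> j \<omega> $ a) = 0" if j: "j \<in> ?J" for j a
  proof -
    have ix: "integrable M (x j)" "expectation (x j) = \<theta>" using assms(11)[OF j] by auto
    have "integrable M (\<lambda>\<omega>. x j \<omega> $ a)" by (rule integrable_bounded_linear[OF bounded_linear_vec_nth ix(1)])
    moreover have "expectation (\<lambda>\<omega>. x j \<omega> $ a) = \<theta> $ a"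
      using integral_bounded_linear[OF bounded_linear_vec_nth ix(1), of a] ix(2) by simp
    ultimately show ?thesis unfolding \<epsilon> by (simp add: prob_space)
  qed
  have mom: "integrable M (\<lambda>\<omega>. (\<Sum>j\<in>?J. r j \<omega> * \<epsilon> j \<omega> $ a) ^ (2 * k))"
    "expectation (\<lambda>\<omega>. (\<Sum>j\<in>?J. r j \<omega> * \<epsilon> j \<omega> $ a) ^ (2 * k)) \<le> real n ^ (2 * k) * (\<sigma> ^ (2 * k) * 2 ^ (k - 1) * fact k)"
    if k: "k \<in> {1..s}" for a k
  proof -
    have npos: "real n ^ (2 * k) > 0" using n by simp
    have eq: "(\<Sum>j\<in>?J. r j \<omega> * \<epsilon> j \<omega> $ a) ^ (2 * k) = real n ^ (2 * k) * \<bar>(\<Sum>j\<in>?J. r j \<omega> * \<epsilon> j \<omega> $ a) / real n\<bar> ^ (2 * k)" for \<omega>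
      using n by (simp add: power_even_abs power_divide)
    show "integrable M (\<lambda>\<omega>. (\<Sum>j\<in>?J. r j \<omega> * \<epsilon> j \<omega> $ a) ^ (2 * k))"
      unfolding eq using assms(17)[OF k, of a] by (intro integrable_mult_right) auto
    show "expectation (\<lambda>\<omega>. (\<Sum>j\<in>?J. r j \<omega> * \<epsilon> j \<omega> $ a) ^ (2 * k)) \<le> real n ^ (2 * k) * (\<sigma> ^ (2 * k) * 2 ^ (k - 1) * fact k)"
      unfolding eq integral_mult_right_zero using assms(17)[OF k, of a] npos by (intro mult_left_mono) auto
  qed
  note rad = rademacher_dominates_sign_avg[OF finite_atLeastAtMost assms(15,16) mom(1)]
  have sym: "sign_avg ?J (\<lambda>\<sigma>. expectation (\<lambda>\<omega>. (\<Sum>j\<in>?J. \<sigma> j * \<epsilon> j \<omega> $ a) ^ (2 * k)))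
      \<le> real n ^ (2 * k) * (\<sigma> ^ (2 * k) * 2 ^ (k - 1) * fact k)" if k: "k \<in> {1..s}" for a k
    by (rule order_trans[OF rad(2)[OF k] mom(2)[OF k]])
  have s_mem: "s \<in> {1..s}" "1 \<in> {1..s}" using s1 by auto
  have int: "integrable M (\<lambda>\<omega>. \<bar>\<epsilon> j \<omega> $ a\<bar> ^ (2 * s))" if j: "j \<in> ?J" for j a
    by (rule integrable_power_of_sign_sums[OF finite_atLeastAtMost j em[OF j] rad(1)[OF s_mem(1)]])
  \<comment> \<open>Off the diagonal this is a hypothesis; on it, square integrability follows from
    the moments of order \<open>2 * s\<close>.\<close>
  have cov: "integrable M (\<lambda>\<omega>. \<epsilon> j \<omega> $ a * \<epsilon> j \<omega> $ b)" if j: "j \<in> ?J" for j a b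
  proof (cases "a = b")
    case True
    have "integrable M (\<lambda>\<omega>. (\<epsilon> j \<omega> $ a)\<^sup>2)"
      by (rule integrable_power_le(2)[OF em[OF j] int[OF j]]) (use s1 in simp)
    then show ?thesis using True by (simp add: power2_eq_square)
  next
    case False
    then show ?thesis using assms(14)[OF j] by blast
  qed
  have cov0: "expectation (\<lambda>\<omega>. \<epsilon> j \<omega> $ a * \<epsilon> j \<omega> $ b) = 0" if "j \<in> ?J" "a \<noteq> b" for j a b
    using assms(14)[OF that] by blast
  note orth = coordinate_products_orthogonal[OF finite_atLeastAtMost ind mean cov cov0]
  \<comment> \<open>By orthogonality all sign patterns give a signed sum the same second moment, so
    the moment hypothesis with \<open>k = 1\<close> bounds the sum of the variances.\<close>
  have var: "(\<Sum>j\<in>?J. expectation (\<lambda>\<omega>. (\<epsilon> j \<omega> $ a)\<^sup>2)) \<le> (real n * \<sigma>)\<^sup>2" for a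
  proof -
    have i1: "integrable M (\<lambda>\<omega>. \<epsilon> i \<omega> $ a * \<epsilon> j \<omega> $ a)" if "i \<in> ?J" "j \<in> ?J" for i j
      using orth(1)[of "{i}" "{j}" a a] that by simp
    have i2: "expectation (\<lambda>\<omega>. \<epsilon> i \<omega> $ a * \<epsilon> j \<omega> $ a) = 0" if "i \<in> ?J" "j \<in> ?J" "i \<noteq> j" for i j
      using orth(2)[of "{i}" "{j}" a a] that by simp
    have E: "expectation (\<lambda>\<omega>. (\<Sum>j\<in>?J. \<tau> j * \<epsilon> j \<omega> $ a) ^ (2 * 1)) = (\<Sum>j\<in>?J. expectation (\<lambda>\<omega>. (\<epsilon> j \<omega> $ a)\<^sup>2))"
      if \<tau>: "\<tau> \<in> signs ?J" for \<tau>
    proof -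
      have "expectation (\<lambda>\<omega>. (norm (\<Sum>j\<in>?J. complex_of_real (\<tau> j) * complex_of_real (\<epsilon> j \<omega> $ a)))\<^sup>2)
         = (\<Sum>j\<in>?J. (norm (complex_of_real (\<tau> j)))\<^sup>2 * expectation (\<lambda>\<omega>. (\<epsilon> j \<omega> $ a)\<^sup>2))"
        by (rule orthogonal_sum_second_moment(2)[OF finite_atLeastAtMost i1 i2])
      also have "\<dots> = (\<Sum>j\<in>?J. expectation (\<lambda>\<omega>. (\<epsilon> j \<omega> $ a)\<^sup>2))"
      proof (rule sum.cong[OF refl])
        fix j assume "j \<in> ?J"
        then have "\<tau> j = -1 \<or> \<tau> j = 1" using \<tau> by auto
        then show "(norm (complex_of_real (\<tau> j)))\<^sup>2 * expectation (\<lambda>\<omega>. (\<epsilon> j \<omega> $ a)\<^sup>2) = expectation (\<lambda>\<omega>. (\<epsilon> j \<omega> $ a)\<^sup>2)" by auto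
      qed
      also have "(\<lambda>\<omega>. (norm (\<Sum>j\<in>?J. complex_of_real (\<tau> j) * complex_of_real (\<epsilon> j \<omega> $ a)))\<^sup>2)
         = (\<lambda>\<omega>. (\<Sum>j\<in>?J. \<tau> j * \<epsilon> j \<omega> $ a) ^ (2 * 1))"
        by (simp only: of_real_mult[symmetric] of_real_sum[symmetric] norm_of_real power2_abs mult_1_right)
      finally show ?thesis .
    qed
    have "(\<Sum>j\<in>?J. expectation (\<lambda>\<omega>. (\<epsilon> j \<omega> $ a)\<^sup>2))
        = sign_avg ?J (\<lambda>\<tau>. expectation (\<lambda>\<omega>. (\<Sum>j\<in>?J. \<tau> j * \<epsilon> j \<omega> $ a) ^ (2 * 1)))"
      by (simp only: E sign_avg_const[OF finite_atLeastAtMost] cong: sign_avg_cong)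
    also have "\<dots> \<le> real n ^ (2 * 1) * (\<sigma> ^ (2 * 1) * 2 ^ (1 - 1) * fact 1)" by (rule sym[OF s_mem(2)])
    finally show ?thesis by (simp add: power_mult_distrib)
  qed
  have fall: "(real n ^ k)\<^sup>2 \<le> 3 / 2 * (fact k * real (n choose k))\<^sup>2" "k \<le> n" if "k \<le> s" for k
    using power_le_falling_factorial[OF _ s_le n, of k] that by auto
  have mn: "m \<le> n" using fall(2)[of m] m by simp

  \<comment> \<open>Decomposition of the error\<close>
  define u where "u a \<omega> i = esym i ?J (\<lambda>j. \<epsilon> j \<omega> $ a) / real (n choose i)" for a \<omega> i
  define t where "t a \<omega> = (\<Sum>j\<in>?J. \<epsilon> j \<omega> $ a) / real n" for a \<omega>
  let ?T = "\<lambda>a \<omega>. corrected_taylor ?D (u a \<omega>) (\<theta> $ a) m"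
  define A where "A = (\<Sum>a\<in>UNIV. (fh (\<theta> $ a) - complex_of_real (\<bar>\<theta> $ a\<bar> powr p)) / of_nat d)"
  define e where "e k a = ?D k (\<theta> $ a) / (fact k * of_nat d)" for k a
  \<comment> \<open>Order 1 is present here although the estimator omits it: relative to the true
    mean the U-statistic of order 1 is the noise mean, which does not vanish.\<close>
  define B where "B \<omega> = (\<Sum>a\<in>UNIV. \<Sum>k=1..m. e k a * complex_of_real (esym k ?J (\<lambda>j. \<epsilon> j \<omega> $ a) / real (n choose k)))" for \<omega>
  define R where "R \<omega> = (\<Sum>a\<in>UNIV. (?T a \<omega> (t a \<omega>) - ?T a \<omega> 0) / of_nat d)" for \<omega>
  let ?F = "\<lambda>\<omega>. f_hat fh n m (\<lambda>j. x j \<omega>) - complex_of_real (lp_functional p \<theta>)"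
  have F_eq: "?F \<omega> = A + B \<omega> + R \<omega>" for \<omega>
  proof -
    have tt: "sample_mean n (\<lambda>j. x j \<omega>) a - \<theta> $ a = t a \<omega>" for a
      unfolding sample_mean_def t_def \<epsilon> using n by (simp add: sum_subtractf diff_divide_distrib)
    have f1: "f_hat fh n m (\<lambda>j. x j \<omega>) = (\<Sum>a\<in>UNIV. ?T a \<omega> (t a \<omega>)) / of_nat d"
      unfolding f_hat_eq_corrected_taylor[OF n mn m1, of fh _ \<theta>] tt u_def \<epsilon> d(1) by simp
    have T0: "?T a \<omega> 0 = fh (\<theta> $ a) + (\<Sum>k=1..m. ?D k (\<theta> $ a) * complex_of_real (u a \<omega> k) / fact k)" for a
    proof -
      have "{..m} = insert 0 {1..m}" by auto
      then show ?thesis unfolding corrected_taylor_def appell_0_right by (simp add: D0 u_def)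
    qed
    have B_eq: "B \<omega> = (\<Sum>a\<in>UNIV. (?T a \<omega> 0 - fh (\<theta> $ a)) / of_nat d)"
      unfolding B_def T0 e_def u_def by (simp add: sum_divide_distrib ac_simps)
    have "A + B \<omega> + R \<omega> = (\<Sum>a\<in>UNIV. (?T a \<omega> (t a \<omega>) - complex_of_real (\<bar>\<theta> $ a\<bar> powr p)) / of_nat d)"
      unfolding A_def B_eq R_def by (simp add: sum.distrib[symmetric] diff_divide_distrib)
    also have "\<dots> = ?F \<omega>"
      unfolding f1 lp_functional_def d(1) by (simp add: sum_subtractf diff_divide_distrib sum_divide_distrib)
    finally show ?thesis by simp
  qed

  \<comment> \<open>Bias\<close>
  have A_le: "norm A \<le> c"
  proof -
    have "norm A \<le> (\<Sum>a\<in>(UNIV::'d set). c / real d)"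
      unfolding A_def
    proof (rule sum_norm_le)
      fix a
      show "norm ((fh (\<theta> $ a) - complex_of_real (\<bar>\<theta> $ a\<bar> powr p)) / of_nat d) \<le> c / real d"
        using KS.fh_bias[of "\<theta> $ a"] unfolding fh c_def by (simp add: norm_divide divide_right_mono)
    qed
    also have "\<dots> = c" using d by simp
    finally show ?thesis .
  qed

  \<comment> \<open>Degenerate part\<close>
  have B_int: "integrable M (\<lambda>\<omega>. (norm (B \<omega>))\<^sup>2)"
    unfolding B_def by (rule degenerate_part_second_moment(1)[OF ind mean cov cov0 var mn])
  have B_le: "expectation (\<lambda>\<omega>. (norm (B \<omega>))\<^sup>2) \<le> c\<^sup>2 * (2 / ln (real d))"
  proof -
    have term_le: "(norm (e k a))\<^sup>2 * ((real n ^ k)\<^sup>2 / (fact k * real (n choose k))\<^sup>2) * (fact k * \<sigma> ^ (2 * k))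
       \<le> (c / real d)\<^sup>2 * ((if k = 1 then 9 / 4 else 3 / 2) * (L ^ k / fact k))" if k: "k \<in> {1..m}" for k a
    proof -
      have sk: "\<sigma> ^ (2 * k) = L ^ k * (h ^ k)\<^sup>2"
        unfolding power_mult h2 by (simp add: power_mult_distrib power_mult[symmetric] mult.commute)
      have ne: "norm (e k a) = norm (?D k (\<theta> $ a)) / (fact k * real d)"
        unfolding e_def by (simp add: norm_divide norm_mult)
      define g where "g = norm (?D k (\<theta> $ a)) * h ^ k"
      define q where "q = (real n ^ k)\<^sup>2 / (fact k * real (n choose k))\<^sup>2"
      have gq: "g\<^sup>2 * q \<le> c\<^sup>2 * (if k = 1 then 9 / 4 else 3 / 2)"
      proof (cases "k = 1")
        case True
        have "g \<le> 3 / 2 * c" unfolding g_def True using D1[of "\<theta> $ a"] h by (simp add: field_simps)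
        then have "g\<^sup>2 \<le> (3 / 2 * c)\<^sup>2" unfolding g_def using h by (intro power_mono) auto
        \<comment> \<open>At order 1 the falling factorial equals the power of \<open>n\<close>, so
          the two losses never multiply: the order pays 9/4 and not 9/4 times 3/2.\<close>
        moreover have "q = 1" unfolding q_def True using n by simp
        ultimately show ?thesis using True by (simp add: power_mult_distrib power2_eq_square)
      next
        case False
        have "g \<le> c" unfolding g_def using Dk[of k "\<theta> $ a"] False k h by (simp add: field_simps)
        then have g: "g\<^sup>2 \<le> c\<^sup>2" unfolding g_def using h by (intro power_mono) auto
        have "q \<le> 3 / 2"
        proof -
          have ks: "k \<le> s" using k sm by (simp add: le_SucI flip: sm)
          have "(fact k * real (n choose k))\<^sup>2 > 0" using fall(2)[OF ks] by simp
          then show ?thesis unfolding q_def using fall(1)[OF ks] by (simp only: pos_divide_le_eq)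
        qed
        then have "g\<^sup>2 * q \<le> c\<^sup>2 * (3 / 2)" using g unfolding q_def by (intro mult_mono) auto
        then show ?thesis using False by simp
      qed
      have "(norm (e k a))\<^sup>2 * q * (fact k * \<sigma> ^ (2 * k)) = (g\<^sup>2 * q) * (L ^ k / (fact k * (real d)\<^sup>2))"
        unfolding ne sk g_def by (simp add: power_divide power_mult_distrib power2_eq_square ac_simps)
      also have "\<dots> \<le> (c\<^sup>2 * (if k = 1 then 9 / 4 else 3 / 2)) * (L ^ k / (fact k * (real d)\<^sup>2))"
        using L1 by (intro mult_right_mono gq) simp
      also have "\<dots> = (c / real d)\<^sup>2 * ((if k = 1 then 9 / 4 else 3 / 2) * (L ^ k / fact k))"
        by (simp add: power_divide ac_simps)
      finally show ?thesis unfolding q_def .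
    qed
    have "expectation (\<lambda>\<omega>. (norm (B \<omega>))\<^sup>2)
       \<le> (\<Sum>a\<in>UNIV. \<Sum>k=1..m. (norm (e k a))\<^sup>2 * ((real n ^ k)\<^sup>2 / (fact k * real (n choose k))\<^sup>2) * (fact k * \<sigma> ^ (2 * k)))"
      unfolding B_def by (rule degenerate_part_second_moment(2)[OF ind mean cov cov0 var mn])
    also have "\<dots> \<le> (\<Sum>a\<in>(UNIV::'d set). \<Sum>k=1..m. (c / real d)\<^sup>2 * ((if k = 1 then 9 / 4 else 3 / 2) * (L ^ k / fact k)))"
      by (intro sum_mono term_le)
    also have "\<dots> = real d * ((c / real d)\<^sup>2 * (\<Sum>k=1..m. (if k = 1 then 9 / 4 else 3 / 2) * (L ^ k / fact k)))"
      using d(1) by (simp only: sum_distrib_left[symmetric] sum_constant mult.left_commute)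
    also have "\<dots> \<le> real d * ((c / real d)\<^sup>2 * (2 * exp L))"
      using L1 m1 by (intro mult_left_mono weighted_exponential_sum_le) auto
    \<comment> \<open>The gain 1 / d from orthogonality meets
      \<open>exp L = real d / ln (real d)\<close> from the exponential series; this balance dictates
      the logarithm in the bandwidth.\<close>
    also have "\<dots> = c\<^sup>2 * (2 / ln (real d))"
      unfolding expL using d2 by (simp add: power2_eq_square)
    finally show ?thesis .
  qed

  \<comment> \<open>Remainder\<close>
  define G where "G a \<omega> = (\<Sum>i\<le>m. real (m choose i) * (\<bar>esym i ?J (\<lambda>j. \<epsilon> j \<omega> $ a) / real (n choose i)\<bar>
      * \<bar>(\<Sum>j\<in>?J. \<epsilon> j \<omega> $ a) / real n\<bar> ^ (Suc m - i)))" for a \<omega>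
  define W where "W = \<sigma> ^ (2 * s) * 2 ^ (s - 1) * fact s"
  define b where "b = c / h ^ s / fact m"
  have ind_a: "indep_vars (\<lambda>_. borel) (\<lambda>j \<omega>. \<epsilon> j \<omega> $ a) ?J" for a
    by (rule indep_vars_compose2[OF ind, where Y="\<lambda>j v. v $ a"]) (rule comp)
  have mean0: "expectation (\<lambda>\<omega>. \<epsilon> j \<omega> $ a) = 0" if "j \<in> ?J" for j a using mean[OF that] by blast
  have fall_m: "(real n ^ k)\<^sup>2 \<le> 3 / 2 * (fact k * real (n choose k))\<^sup>2" if "k \<le> m" for k
    using fall(1)[of k] that m by simp
  have G_int: "integrable M (\<lambda>\<omega>. (G a \<omega>)\<^sup>2)" for a
    unfolding G_def
    by (rule remainder_second_moment(1)[OF s1 m n ind_a mean0 int sym[OF s_mem(1)] fall_m])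
  have G_le: "expectation (\<lambda>\<omega>. (G a \<omega>)\<^sup>2) \<le> 4 ^ m * (3 / 2 * 9 ^ s * W)" for a
    unfolding G_def W_def
    by (rule remainder_second_moment(2)[OF s1 m n ind_a mean0 int sym[OF s_mem(1)] fall_m])
  have T_le: "norm (?T a \<omega> (t a \<omega>) - ?T a \<omega> 0) \<le> b * G a \<omega>" for a \<omega>
  proof -
    \<comment> \<open>Since \<open>m \<ge> 1\<close>, the order \<open>Suc m\<close> lies in the
      range of the derivative bound without the factor 3/2.\<close>
    have "norm (?D (Suc m) y) \<le> c / h ^ s" for y using Dk[of "Suc m" y] m1 unfolding sm[symmetric] by simp
    from corrected_taylor_increment[of ?D, OF D this, of "u a \<omega>" "\<theta> $ a" "t a \<omega>"]
    show ?thesis unfolding b_def G_def u_def t_def .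
  qed
  \<comment> \<open>Only convexity over the coordinates is available: their remainders need not be
    orthogonal.\<close>
  have R_pw: "(norm (R \<omega>))\<^sup>2 \<le> (\<Sum>a\<in>(UNIV::'d set). 1 / real d * (b\<^sup>2 * (G a \<omega>)\<^sup>2))" for \<omega>
  proof -
    have "norm (R \<omega>) \<le> (\<Sum>a\<in>(UNIV::'d set). 1 / real d * (b * G a \<omega>))"
      unfolding R_def
    proof (rule sum_norm_le)
      fix a
      show "norm ((?T a \<omega> (t a \<omega>) - ?T a \<omega> 0) / of_nat d) \<le> 1 / real d * (b * G a \<omega>)"
        using T_le[of a \<omega>] by (simp add: norm_divide divide_right_mono)
    qed
    then have "(norm (R \<omega>))\<^sup>2 \<le> (\<Sum>a\<in>(UNIV::'d set). 1 / real d * (b * G a \<omega>))\<^sup>2" by (rule power_mono) simp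
    also have "\<dots> \<le> (\<Sum>a\<in>(UNIV::'d set). 1 / real d) * (\<Sum>a\<in>UNIV. 1 / real d * (b * G a \<omega>)\<^sup>2)"
      by (rule weighted_cauchy_schwarz) simp
    also have "(\<Sum>a\<in>(UNIV::'d set). 1 / real d) = 1" using d by simp
    finally show ?thesis by (simp add: power_mult_distrib)
  qed
  have contD: "continuous_on UNIV (?D k)" for k
    using D by (auto intro!: continuous_at_imp_continuous_on has_vector_derivative_continuous)
  have Dm: "?D k \<in> borel_measurable borel" for k by (rule borel_measurable_continuous_onI[OF contD])
  have tm: "t a \<in> borel_measurable M" for a
    unfolding t_def by (intro borel_measurable_divide borel_measurable_sum em borel_measurable_const)
  have um: "(\<lambda>\<omega>. u a \<omega> i) \<in> borel_measurable M" for a i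
    unfolding u_def by (intro borel_measurable_divide borel_measurable_esym em borel_measurable_const)
  have Rm: "R \<in> borel_measurable M"
  proof -
    have am: "(\<lambda>\<omega>. appell (u a \<omega>) k (y \<omega>)) \<in> borel_measurable M" if "y \<in> borel_measurable M" for a k y
      unfolding appell_def
      by (intro borel_measurable_sum borel_measurable_times borel_measurable_const borel_measurable_power
          borel_measurable_uminus um that)
    have Tm: "(\<lambda>\<omega>. ?T a \<omega> (y \<omega>)) \<in> borel_measurable M" if y: "y \<in> borel_measurable M" for a y
      unfolding corrected_taylor_def
      by (intro borel_measurable_sum borel_measurable_times borel_measurable_divide borel_measurable_const
          measurable_compose[OF _ Dm] borel_measurable_add y measurable_compose[OF am[OF y] borel_measurable_of_real])
    show ?thesis unfolding R_def
      by (intro borel_measurable_sum borel_measurable_divide borel_measurable_diff borel_measurable_const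
          Tm[OF tm] Tm[OF borel_measurable_const])
  qed
  have RG_int: "integrable M (\<lambda>\<omega>. \<Sum>a\<in>(UNIV::'d set). 1 / real d * (b\<^sup>2 * (G a \<omega>)\<^sup>2))"
    by (intro Bochner_Integration.integrable_sum integrable_mult_right G_int)
  have R_int: "integrable M (\<lambda>\<omega>. (norm (R \<omega>))\<^sup>2)"
  proof (rule Bochner_Integration.integrable_bound[OF RG_int])
    show "AE \<omega> in M. norm ((norm (R \<omega>))\<^sup>2) \<le> norm (\<Sum>a\<in>(UNIV::'d set). 1 / real d * (b\<^sup>2 * (G a \<omega>)\<^sup>2))"
      by (intro AE_I2) (use R_pw in \<open>auto intro: order_trans[OF _ abs_ge_self]\<close>)
  qed (use Rm in simp)
  have R_le: "expectation (\<lambda>\<omega>. (norm (R \<omega>))\<^sup>2) \<le> c\<^sup>2 * real s powr (- 1 / 2)"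
  proof -
    have "expectation (\<lambda>\<omega>. (norm (R \<omega>))\<^sup>2) \<le> expectation (\<lambda>\<omega>. \<Sum>a\<in>(UNIV::'d set). 1 / real d * (b\<^sup>2 * (G a \<omega>)\<^sup>2))"
      by (rule integral_mono[OF R_int RG_int R_pw])
    also have "\<dots> = (\<Sum>a\<in>(UNIV::'d set). 1 / real d * (b\<^sup>2 * expectation (\<lambda>\<omega>. (G a \<omega>)\<^sup>2)))"
      using G_int by (subst Bochner_Integration.integral_sum) auto
    also have "\<dots> \<le> (\<Sum>a\<in>(UNIV::'d set). 1 / real d * (b\<^sup>2 * (4 ^ m * (3 / 2 * 9 ^ s * W))))"
      by (intro sum_mono mult_left_mono G_le) auto
    also have "\<dots> = b\<^sup>2 * (4 ^ m * (3 / 2 * 9 ^ s * W))" using d by simp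
    also have "\<dots> = c\<^sup>2 * (L ^ s * (4 ^ m * (3 / 2 * 9 ^ s * (2 ^ m * fact s))) / (fact m)\<^sup>2)"
    proof -
      have "\<sigma> ^ (2 * s) = L ^ s * (h ^ s)\<^sup>2"
        unfolding power_mult h2 by (simp add: power_mult_distrib power_mult[symmetric] mult.commute)
      then have W: "W = L ^ s * (h ^ s)\<^sup>2 * 2 ^ m * fact s" unfolding W_def m by simp
      have cancel: "(c / H / f)\<^sup>2 * (x * (y * (l * H\<^sup>2 * t * g))) = c\<^sup>2 * (l * (x * (y * (t * g))) / f\<^sup>2)"
        if "H \<noteq> 0" for H f x y l t g :: real
        using that by (simp add: power_divide power_mult_distrib ac_simps)
      show ?thesis unfolding W b_def by (rule cancel) (use h in simp)
    qed
    also have "\<dots> \<le> c\<^sup>2 * real s powr (- 1 / 2)"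
      using L1 sL by (intro mult_left_mono remainder_constant_le s72 m) auto
    finally show ?thesis .
  qed

  \<comment> \<open>Combination of the three error terms\<close>
  define \<beta> where "\<beta> = sqrt (2 / ln (real d)) * c"
  define \<gamma> where "\<gamma> = real s powr (- 1 / 4) * c"
  have pos: "\<beta> > 0" "\<gamma> > 0" unfolding \<beta>_def \<gamma>_def using c lnd s1 by auto
  have \<beta>2: "\<beta>\<^sup>2 = c\<^sup>2 * (2 / ln (real d))" unfolding \<beta>_def power_mult_distrib using lnd by simp
  have \<gamma>2: "\<gamma>\<^sup>2 = c\<^sup>2 * real s powr (- 1 / 2)"
  proof -
    have "(real s powr (- 1 / 4))\<^sup>2 = real s powr (- 1 / 2)"
      unfolding power2_eq_square powr_add[symmetric] by simp
    then show ?thesis unfolding \<gamma>_def power_mult_distrib by simp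
  qed
  \<comment> \<open>The weights \<open>c\<close>, \<open>\<beta>\<close> and \<open>\<gamma>\<close>
    are the bounds on the three L2 norms, so after integration every quotient is at most its own
    weight.\<close>
  let ?U = "\<lambda>\<omega>. (c + \<beta> + \<gamma>) * ((norm A)\<^sup>2 / c + (norm (B \<omega>))\<^sup>2 / \<beta> + (norm (R \<omega>))\<^sup>2 / \<gamma>)"
  have U_int: "integrable M ?U"
    by (intro integrable_mult_right Bochner_Integration.integrable_add integrable_divide B_int R_int) simp
  have F_le: "(norm (?F \<omega>))\<^sup>2 \<le> ?U \<omega>" for \<omega>
    unfolding F_eq by (rule norm_add3_square_le[OF c pos])
  have Bm: "B \<in> borel_measurable M"
    unfolding B_def
    by (intro borel_measurable_sum borel_measurable_times borel_measurable_const
        measurable_compose[OF _ borel_measurable_of_real] borel_measurable_divide borel_measurable_esym em)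
  have F_int: "integrable M (\<lambda>\<omega>. (norm (?F \<omega>))\<^sup>2)"
  proof (rule Bochner_Integration.integrable_bound[OF U_int])
    have "(\<lambda>\<omega>. A + B \<omega> + R \<omega>) \<in> borel_measurable M"
      by (intro borel_measurable_add Bm Rm borel_measurable_const)
    then show "(\<lambda>\<omega>. (norm (?F \<omega>))\<^sup>2) \<in> borel_measurable M"
      unfolding F_eq by simp
    show "AE \<omega> in M. norm ((norm (?F \<omega>))\<^sup>2) \<le> norm (?U \<omega>)"
      by (intro AE_I2) (use F_le in \<open>auto intro: order_trans[OF _ abs_ge_self]\<close>)
  qed
  have "expectation (\<lambda>\<omega>. (norm (?F \<omega>))\<^sup>2) \<le> expectation ?U"
    by (rule integral_mono[OF F_int U_int F_le])
  also have "\<dots> = (c + \<beta> + \<gamma>) * ((norm A)\<^sup>2 / c + expectation (\<lambda>\<omega>. (norm (B \<omega>))\<^sup>2) / \<beta> + expectation (\<lambda>\<omega>. (norm (R \<omega>))\<^sup>2) / \<gamma>)"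
    using B_int R_int by (simp add: prob_space)
  also have "\<dots> \<le> (c + \<beta> + \<gamma>) * (c\<^sup>2 / c + \<beta>\<^sup>2 / \<beta> + \<gamma>\<^sup>2 / \<gamma>)"
    using c pos A_le B_le R_le unfolding \<beta>2[symmetric] \<gamma>2[symmetric]
    by (intro mult_left_mono add_mono divide_right_mono power_mono) auto
  also have "\<dots> = (c + \<beta> + \<gamma>)\<^sup>2" using c pos by (simp add: power2_eq_square)
  also have "\<dots> = ((1 + sqrt (2 / ln (real d)) + real s powr (- 1 / 4)) * c)\<^sup>2"
    unfolding \<beta>_def \<gamma>_def by (simp add: algebra_simps)
  also have "\<dots> = (1 + sqrt (2 / ln (real d)) + real s powr (- 1 / 4))\<^sup>2 * C\<^sub>1\<^sup>2 * (\<sigma>\<^sup>2 / L) powr p"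
  proof -
    have "\<sigma>\<^sup>2 / L = h\<^sup>2" unfolding h2 using L1 by simp
    then have "(\<sigma>\<^sup>2 / L) powr p = (h powr p)\<^sup>2"
      using h by (simp add: power2_eq_square powr_mult)
    then show ?thesis unfolding c_def by (simp add: power_mult_distrib)
  qed
  finally show ?thesis using F_int unfolding L_def by blast
qed

end
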